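(* 1) Let $v$ be a twice continuously differentiable function on a convex set $A\subset\mathbb{R}^d$. Then there exists a constant $C(d)$ depending only on $d$ such that $$ \sup_{x\in A}v(x)\le\sup_{x\in\partial A}v(x)+C(d)\int_{\mathcal C_{-v,l}}|\nabla v|\,K\,dx, $$ where $K(x)$ is the Gauss curvature of the convex surface $\partial\,\mathrm{conv}\{y\in A: v(x)\le v(y)\}$ at $x$ and $\mathcal C_{-v,l}$ is the set of contact points of the sublevel sets of $-v$. 2) Let $\Omega=\{(r,\theta): R_1\le r\le R_2,\ \theta\in Q\}\subset\mathbb{R}^d$ (polar coordinates), where $Q\subset S^{d-1}_+$ is spherically convex and satisfies $\mathrm{dist}(Q,\partial S^{d-1}_+)>0$. Then there are constants $C_1,C_2>0$ depending only on $d$ and $Q$ such that for every twice continuously differentiable function $f:\Omega\to\mathbb{R}$ satisfying $\sup_{\partial_p\Omega}f\ge0$ one has $$ \sup_\Omega f\le C_1\sup_{\partial_p\Omega}f+C_2\left[\int_{\Gamma_f}\frac{\big|f_r\det(f\cdot\mathrm{Id}+D^2_\theta f)\big|}{r^{d-1}}\,dx\right]^{1/d}, $$ where $\Gamma_f=\{x\in\Omega: f_r\le0,\ f\cdot\mathrm{Id}+D_\theta^2f\le0\}$.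
   Context: The convex set $A$ is compact. $S^{d-1}$ is the unit sphere in $\mathbb{R}^d$ and $S^{d-1}_+$ its upper half; $f_r$ is the radial derivative and $D_\theta^2f$ the Hessian of $f$ in the variable $\theta$ on the unit sphere $S^{d-1}$ (a matrix in an orthonormal basis of the tangent space); matrix inequalities are in the sense of quadratic forms; $dx$ is Lebesgue measure. The parabolic boundary of $\Omega$ is $\partial_p\Omega=(Q\times\{R_2\})\cup(\partial Q\times[R_1,R_2])$. Contact points: for a continuous function $g$ on a convex set $A$ let $A_t=\{x\in A:g(x)\le t\}$ and let $\mathrm{conv}(A_t)$ be its convex hull. A point $x\in\mathrm{Int}\,A$ is a contact point if $x\in A_t\cap\partial\,\mathrm{conv}(A_t)$ for some $t$; the set of all such points is denoted $\mathcal C_{g,l}$. Gauss curvature of a convex surface: for a compact convex set $C$ with nonempty interior let $H_C(\theta)=\sup_{x\in C}\langle\theta,x\rangle$, $\theta\in S^{d-1}$. For $\mathrm n\in S^{d-1}$ and an orthonormal basis $e_1,\dots,e_{d-1}$ of $\mathrm n^\perp$, use local coordinates $\theta\mapsto\sum_i\theta_ie_i+\sqrt{1-|\theta|^2}\,\mathrm n$ on $S^{d-1}$; $H_C$ is twice Alexandrov differentiable at $\mathrm n$ if in these coordinates $H_C(\theta)=H_C(0)+\langle p,\theta\rangle+\frac12\langle Q_0\theta,\theta\rangle+o(|\theta|^2)$ for a symmetric matrix $Q_0$, and then $(D_\theta^2)_aH_C(\mathrm n):=Q_0$. At $x\in\partial C$ with unique outer unit normal $\mathrm n(x)$, $K(x)=1/\det\big(H_C\cdot\mathrm{Id}+(D^2_\theta)_aH_C\big)(\mathrm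 n(x))$ if $H_C$ is twice Alexandrov differentiable at $\mathrm n(x)$ and this matrix is nondegenerate; if $\mathrm n(x)$ is unique but $H_C$ is not twice Alexandrov differentiable at $\mathrm n(x)$, then $K(x)=0$. *)

theory Defs
  imports "HOL-Analysis.Analysis" "Jordan_Normal_Form.Determinant"
begin

text \<open>
  The space R^d is an arbitrary \<^typ>\<open>'a::euclidean_space\<close> with d = \<^term>\<open>DIM('a::euclidean_space)\<close>.
  The \<open>(d - 1) \<times> (d - 1)\<close> matrices on tangent spaces of the sphere are those of
  \<^theory>\<open>Jordan_Normal_Form.Matrix\<close>, since d - 1 is not the cardinality of a type.
\<close>

subsection \<open>Functions of class C2 on a set\<close>

text \<open>
  Derivatives are taken relative to \<open>S\<close>. If \<open>S\<close> is a convex body, or a sector of a spherical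
  shell, this means being C2 in the interior with first and second derivatives
  extending continuously to \<open>S\<close>.
\<close>

definition C2_on :: "'a::euclidean_space set \<Rightarrow> ('a \<Rightarrow> real) \<Rightarrow> bool" where
  "C2_on S f \<longleftrightarrow>
    (\<exists>(f' :: 'a \<Rightarrow> 'a \<Rightarrow>\<^sub>L real) (f'' :: 'a \<Rightarrow> 'a \<Rightarrow>\<^sub>L ('a \<Rightarrow>\<^sub>L real)).
      (\<forall>x\<in>S. (f has_derivative blinfun_apply (f' x)) (at x within S)) \<and>
      (\<forall>x\<in>S. (f' has_derivative blinfun_apply (f'' x)) (at x within S)) \<and>
      continuous_on S f'')"

definition gradient :: "('a::euclidean_space \<Rightarrow> real) \<Rightarrow> 'a \<Rightarrow> 'a" where
  "gradient v x = (THE D. GDERIV v x :> D)"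


subsection \<open>Contact points\<close>

definition sublevel :: "('a::euclidean_space \<Rightarrow> real) \<Rightarrow> 'a set \<Rightarrow> real \<Rightarrow> 'a set" where
  "sublevel g A t = {x \<in> A. g x \<le> t}"

definition contact_points :: "('a::euclidean_space \<Rightarrow> real) \<Rightarrow> 'a set \<Rightarrow> 'a set" where
  "contact_points g A =
    {x \<in> interior A. \<exists>t. x \<in> sublevel g A t \<inter> frontier (convex hull (sublevel g A t))}"


subsection \<open>Local coordinates on the unit sphere\<close>

definition orthonormal_frame :: "'a::euclidean_space \<Rightarrow> (nat \<Rightarrow> 'a) \<Rightarrow> bool" where
  "orthonormal_frame n e \<longleftrightarrow>
    (\<forall>i < DIM('a) - 1. e i \<bullet> n = 0) \<and>
    (\<forall>i < DIM('a) - 1. \<forall>j < DIM('a) - 1. e i \<bullet> e j = (if i = j then 1 else 0))"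

text \<open>
  A fixed choice of orthonormal basis of the tangent space at \<open>n\<close>. Another choice conjugates the
  matrices below by an orthogonal matrix, so determinants and signs of
  quadratic forms do not depend on it.
\<close>

definition tangent_frame :: "'a::euclidean_space \<Rightarrow> nat \<Rightarrow> 'a" where
  "tangent_frame n = (SOME e. orthonormal_frame n e)"

text \<open>
  The local coordinates \<open>\<theta> = (\<theta>\<^sub>1, \<dots>, \<theta>\<^sub>d\<^sub>-\<^sub>1)\<close> are encoded by the tangent vector
  \<open>w = (\<Sum>i. \<theta>\<^sub>i *\<^sub>R e\<^sub>i)\<close>, so that \<open>\<theta>\<^sub>i = w \<bullet> e\<^sub>i\<close> and \<open>\<bar>\<theta>\<bar> = norm w\<close>.
\<close>

definition sphere_chart :: "'a::euclidean_space \<Rightarrow> 'a \<Rightarrow> 'a" where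
  "sphere_chart n w = w + sqrt (1 - (norm w)\<^sup>2) *\<^sub>R n"


subsection \<open>Gauss curvature of the boundary of a convex body\<close>

definition support_fun :: "'a::euclidean_space set \<Rightarrow> 'a \<Rightarrow> real" where
  "support_fun C \<theta> = (SUP x\<in>C. \<theta> \<bullet> x)"

definition alexandrov_hessian_at ::
    "('a::euclidean_space \<Rightarrow> real) \<Rightarrow> 'a \<Rightarrow> real Matrix.mat \<Rightarrow> bool" where
  "alexandrov_hessian_at H n M \<longleftrightarrow>
    M \<in> carrier_mat (DIM('a) - 1) (DIM('a) - 1) \<and> transpose_mat M = M \<and>
    (\<exists>p. ((\<lambda>w. (H (sphere_chart n w) - H n - p \<bullet> w
              - (1/2) * (\<Sum>i<DIM('a) - 1. \<Sum>j<DIM('a) - 1.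
                  M $$ (i, j) * (w \<bullet> tangent_frame n i) * (w \<bullet> tangent_frame n j)))
            / (norm w)\<^sup>2) \<longlongrightarrow> 0) (at 0 within {w. w \<bullet> n = 0}))"

definition twice_alexandrov_differentiable :: "('a::euclidean_space \<Rightarrow> real) \<Rightarrow> 'a \<Rightarrow> bool" where
  "twice_alexandrov_differentiable H n \<longleftrightarrow> (\<exists>M. alexandrov_hessian_at H n M)"

definition alexandrov_hessian :: "('a::euclidean_space \<Rightarrow> real) \<Rightarrow> 'a \<Rightarrow> real Matrix.mat" where
  "alexandrov_hessian H n = (THE M. alexandrov_hessian_at H n M)"

definition outer_unit_normal :: "'a::euclidean_space set \<Rightarrow> 'a \<Rightarrow> 'a \<Rightarrow> bool" where
  "outer_unit_normal C x n \<longleftrightarrow> norm n = 1 \<and> (\<forall>y\<in>C. n \<bullet> (y - x) \<le> 0)"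

text \<open>
  The curvature is set to 0 where the usual definition assigns no value: where the outer unit
  normal is not unique (in particular if \<open>C\<close> has empty interior) and where
  \<open>H\<^sub>C Id + (D\<^sup>2\<^sub>\<theta>)\<^sub>a H\<^sub>C\<close> is degenerate. For \<open>C = conv {y \<in> A. v x \<le> v y}\<close> and \<open>x\<close> in
  the interior of \<open>A\<close> these cases force \<open>\<nabla>v(x) = 0\<close>: if \<open>\<nabla>v(x) \<noteq> 0\<close> and \<open>x \<in> \<partial>C\<close>, then \<open>C\<close> contains
  a ball touching \<open>\<partial>C\<close> at \<open>x\<close>.
\<close>

definition gauss_curvature :: "'a::euclidean_space set \<Rightarrow> 'a \<Rightarrow> real" where
  "gauss_curvature C x =
    (if \<exists>!n. outer_unit_normal C x n then
       (let n = (THE n. outer_unit_normal C x n);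
            H = support_fun C;
            M = H n \<cdot>\<^sub>m 1\<^sub>m (DIM('a) - 1) + alexandrov_hessian H n
        in if twice_alexandrov_differentiable H n \<and> Determinant.det M \<noteq> 0
           then 1 / Determinant.det M else 0)
     else 0)"


subsection \<open>Sectors of spherical shells\<close>

definition upper_half_sphere :: "'a::euclidean_space \<Rightarrow> 'a set" where
  "upper_half_sphere e = {\<theta> \<in> sphere 0 1. \<theta> \<bullet> e > 0}"

definition sphere_frontier :: "'a::euclidean_space set \<Rightarrow> 'a set" where
  "sphere_frontier Q = top_of_set (sphere 0 1) frontier_of Q"

text \<open>The minor arc between \<open>x\<close> and \<open>y\<close> consists of their unit nonnegative combinations.\<close>

definition spherically_convex :: "'a::euclidean_space set \<Rightarrow> bool" where
  "spherically_convex Q \<longleftrightarrow> Q \<subseteq> sphere 0 1 \<and>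
    (\<forall>x\<in>Q. \<forall>y\<in>Q. x \<noteq> - y \<longrightarrow>
      (\<forall>a\<ge>0. \<forall>b\<ge>0. norm (a *\<^sub>R x + b *\<^sub>R y) = 1 \<longrightarrow> a *\<^sub>R x + b *\<^sub>R y \<in> Q))"

definition polar_region :: "'a::euclidean_space set \<Rightarrow> real \<Rightarrow> real \<Rightarrow> 'a set" where
  "polar_region Q R1 R2 = {r *\<^sub>R \<theta> | r \<theta>. R1 \<le> r \<and> r \<le> R2 \<and> \<theta> \<in> Q}"

text \<open>\<open>polar_region Q R2 R2\<close> is the outer face \<open>Q \<times> {R2}\<close>; the inner face is not part of the boundary.\<close>

definition parabolic_boundary :: "'a::euclidean_space set \<Rightarrow> real \<Rightarrow> real \<Rightarrow> 'a set" where
  "parabolic_boundary Q R1 R2 =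
    polar_region Q R2 R2 \<union> polar_region (sphere_frontier Q) R1 R2"

definition radial_deriv :: "real \<Rightarrow> real \<Rightarrow> ('a::euclidean_space \<Rightarrow> real) \<Rightarrow> 'a \<Rightarrow> real" where
  "radial_deriv R1 R2 f x =
    vector_derivative (\<lambda>r. f (r *\<^sub>R sgn x)) (at (norm x) within {R1..R2})"

text \<open>
  The Hessian at \<open>n \<in> Q\<close> of a function \<open>g\<close> on \<open>Q\<close>, computed in the local coordinates at
  \<open>n\<close>, whose Christoffel symbols vanish at the base point. Derivatives are relative to the coordinate
  image of \<open>Q\<close>, so that they also make sense at boundary points of \<open>Q\<close>.
\<close>

definition sphere_hessian ::
    "'a::euclidean_space set \<Rightarrow> ('a \<Rightarrow> real) \<Rightarrow> 'a \<Rightarrow> real Matrix.mat" where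
  "sphere_hessian Q g n =
    (let U = {w. w \<bullet> n = 0 \<and> norm w < 1 \<and> sphere_chart n w \<in> Q};
         G = (\<lambda>w. g (sphere_chart n w));
         e = tangent_frame n
     in Matrix.mat (DIM('a) - 1) (DIM('a) - 1) (\<lambda>(i, j).
          frechet_derivative (\<lambda>w. frechet_derivative G (at w within U) (e j)) (at 0 within U) (e i)))"

definition angular_hessian ::
    "'a::euclidean_space set \<Rightarrow> ('a \<Rightarrow> real) \<Rightarrow> 'a \<Rightarrow> real Matrix.mat" where
  "angular_hessian Q f x = sphere_hessian Q (\<lambda>\<theta>. f (norm x *\<^sub>R \<theta>)) (sgn x)"

definition angular_matrix ::
    "'a::euclidean_space set \<Rightarrow> ('a \<Rightarrow> real) \<Rightarrow> 'a \<Rightarrow> real Matrix.mat" where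
  "angular_matrix Q f x = f x \<cdot>\<^sub>m 1\<^sub>m (DIM('a) - 1) + angular_hessian Q f x"

definition nonpos_quadratic_form :: "real Matrix.mat \<Rightarrow> bool" where
  "nonpos_quadratic_form M \<longleftrightarrow>
    (\<forall>c :: nat \<Rightarrow> real. (\<Sum>i<dim_row M. \<Sum>j<dim_col M. M $$ (i, j) * c i * c j) \<le> 0)"

definition Gamma_set ::
    "'a::euclidean_space set \<Rightarrow> real \<Rightarrow> real \<Rightarrow> ('a \<Rightarrow> real) \<Rightarrow> 'a set" where
  "Gamma_set Q R1 R2 f =
    {x \<in> polar_region Q R1 R2.
      radial_deriv R1 R2 f x \<le> 0 \<and> nonpos_quadratic_form (angular_matrix Q f x)}"

end

theory Submission
  imports Defs
begin

text \<open>
  Both estimates compare the volume of a set of "slopes" with an integral of a Jacobian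
  determinant, as in the Aleksandrov-Bakelman-Pucci method.

  For part 2 let \<open>\<Psi>(x)\<close> be the gradient at \<open>x / |x|\<close> of the 1-homogeneous extension of
  \<open>\<theta> \<mapsto> f (|x| \<theta>)\<close>, that is \<open>\<Psi>(x) = (f - x \<bullet> \<nabla>f) x/|x| + |x| \<nabla>f\<close>. In an orthonormal
  basis adapted to \<open>x\<close> its derivative is block triangular with determinant
  \<open>f\<^sub>r det (f Id + D\<^sup>2\<^sub>\<theta> f) / r^(d-1)\<close>, the integrand. If \<open>M = max f\<close> is attained at
  \<open>(r\<^sub>0, \<theta>\<^sub>0)\<close> and \<open>q\<close> satisfies \<open>q \<bullet> \<theta>\<^sub>0 < M\<close> and \<open>q \<bullet> \<theta> > m\<close> on \<open>Q\<close>, where \<open>m\<close> bounds \<open>f\<close> on the parabolic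
  boundary, then at the last radius at which \<open>f(r, \<theta>) \<ge> q \<bullet> \<theta>\<close> for some \<open>\<theta>\<close> there is a point of
  \<open>\<Gamma>\<^sub>f\<close> with \<open>\<Psi> = q\<close>. As \<open>Q\<close> stays away from the equator, these \<open>q\<close> contain a ball of radius
  proportional to \<open>M\<close> as soon as \<open>M\<close> is large compared with \<open>m\<close>.

  For part 1 let \<open>\<Phi>(x) = - (v(x) - m) \<nabla>v/|\<nabla>v|\<close>: the polar coordinates of \<open>\<Phi>(x)\<close> are the height of
  \<open>v\<close> over its boundary maximum \<open>m\<close> and the outer normal of the superlevel set. Every \<open>y\<close> with
  \<open>|y| < max v - m\<close> has a support point \<open>x\<close>, maximising \<open>y \<bullet> x\<close> on \<open>{v \<ge> m + |y|}\<close>. Outside a null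
  set of \<open>y\<close> it is unique, \<open>\<nabla>v(x) \<noteq> 0\<close> and \<open>\<Phi>\<close> is a local diffeomorphism at \<open>x\<close>. There the support
  function is C2 near the normal, so its Alexandrov Hessian is classical and
  \<open>|det D\<Phi>| = |\<nabla>v| K (v - m)^(d-1)\<close>.
\<close>

text \<open>In part 1 the curvature is defined by an Alexandrov expansion at arbitrary contact
  points, where little is known about it. It is never studied on the whole contact set: the
  integrand is nonnegative, so it suffices to find a Borel set of contact points whose slopes fill a
  region up to a null set, and to compute K there. Among the discarded slopes, those with a critical
  support point are the real obstacle, because in high dimension the critical values of a C2
  function may have positive measure. Uniqueness of the support point is what lets a local inverse
  of \<open>level_map\<close> describe the support function of the whole convex hull. The weight (v
  - m)^(d-1) explains why part 1 is linear in the integral: for slopes of length comparable to the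
  gap between the maximum and m, the volume is of order gap^d and the weight at most of order
  gap^(d-1). In part 2 the Jacobian carries no such weight, whence the power 1/d.\<close>

no_notation scalar_prod (infix "\<bullet>" 70)
no_notation vec_index (infixl "$" 100)

subsection \<open>Determinants and area inequalities in Euclidean spaces\<close>

text \<open>
  The change of variables theory of the library is stated for \<open>real ^ 'n\<close> with a wellordered index type
  \<open>'n\<close>. This index type makes it available on an arbitrary Euclidean space.
\<close>

typedef (overloaded) ('a::euclidean_space) coord = "{..<DIM('a)}"
  morphisms coord_nat of_nat_coord
  using DIM_positive by blast

instantiation coord :: (euclidean_space) wellorder
begin
definition "i \<le> j \<longleftrightarrow> coord_nat i \<le> coord_nat j"
definition "i < j \<longleftrightarrow> coord_nat i < coord_nat j"
instance
proof
  fix P :: "'a coord \<Rightarrow> bool" and a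
  assume step: "\<And>x. (\<And>y. y < x \<Longrightarrow> P y) \<Longrightarrow> P x"
  show "P a"
  proof (induction "coord_nat a" arbitrary: a rule: less_induct)
    case less
    then show ?case
      using step by (auto simp: less_coord_def)
  qed
qed (auto simp: less_eq_coord_def less_coord_def coord_nat_inject)
end

lemma bij_betw_coord_nat: "bij_betw coord_nat (UNIV :: 'a coord set) {..<DIM('a::euclidean_space)}"
  by (metis (no_types, lifting) bij_betw_def coord_nat_inject inj_onI
      type_definition.Rep_range type_definition_coord)

instance coord :: (euclidean_space) finite
  by standard (use bij_betw_coord_nat bij_betw_finite in blast)

lemma CARD_coord: "CARD('a::euclidean_space coord) = DIM('a)"
  using bij_betw_same_card[OF bij_betw_coord_nat] by auto

definition coord_basis :: "nat \<Rightarrow> 'a::euclidean_space" where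
  "coord_basis = (SOME b. bij_betw b {..<DIM('a)} Basis)"

lemma bij_betw_coord_basis: "bij_betw coord_basis {..<DIM('a)} (Basis :: 'a::euclidean_space set)"
proof -
  obtain b where "bij_betw b {..<DIM('a)} (Basis :: 'a set)"
    using finite_same_card_bij[of "{..<DIM('a)}" "Basis :: 'a set"] by auto
  then show ?thesis
    unfolding coord_basis_def by (rule someI[of "\<lambda>b. bij_betw b _ _"])
qed

definition coord_vec :: "'a coord \<Rightarrow> 'a::euclidean_space" where
  "coord_vec i = coord_basis (coord_nat i)"

lemma bij_betw_coord_vec: "bij_betw coord_vec (UNIV :: 'a::euclidean_space coord set) Basis"
  using bij_betw_trans[OF bij_betw_coord_nat bij_betw_coord_basis]
  by (simp add: o_def coord_vec_def[abs_def])

lemma coord_vec_in_Basis [simp]: "coord_vec i \<in> Basis"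
  using bij_betw_coord_vec bij_betwE by blast

lemma coord_vec_eq_iff [simp]: "coord_vec i = coord_vec j \<longleftrightarrow> i = j"
  using bij_betw_coord_vec by (metis UNIV_I bij_betw_imp_inj_on inj_onD)

lemma inner_coord_vec: "coord_vec i \<bullet> coord_vec j = (if i = j then 1 else 0)"
  by (simp add: inner_Basis)

lemma sum_Basis_coord: "(\<Sum>b\<in>Basis. f b) = (\<Sum>i\<in>UNIV. f (coord_vec i))"
  using sum.reindex_bij_betw[OF bij_betw_coord_vec] by metis

lemma prod_Basis_coord: "(\<Prod>b\<in>Basis. f b) = (\<Prod>i\<in>UNIV. f (coord_vec i))"
  using prod.reindex_bij_betw[OF bij_betw_coord_vec] by metis

definition to_cart :: "'a::euclidean_space \<Rightarrow> real ^ 'a coord" where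
  "to_cart x = (\<chi> i. x \<bullet> coord_vec i)"

definition of_cart :: "real ^ 'a coord \<Rightarrow> 'a::euclidean_space" where
  "of_cart y = (\<Sum>i\<in>UNIV. (y $ i) *\<^sub>R coord_vec i)"

lemma linear_to_cart: "linear to_cart"
  by (rule linearI) (auto simp: to_cart_def Finite_Cartesian_Product.vec_eq_iff inner_add_left)

lemma linear_of_cart: "linear of_cart"
  by (rule linearI) (auto simp: of_cart_def scaleR_add_left sum.distrib scaleR_sum_right)

lemma of_cart_to_cart [simp]: "of_cart (to_cart x) = x"
  using euclidean_representation[of x] by (simp add: sum_Basis_coord of_cart_def to_cart_def)

lemma to_cart_of_cart [simp]: "to_cart (of_cart y) = y"
  by (simp add: to_cart_def of_cart_def Finite_Cartesian_Product.vec_eq_iff inner_sum_left inner_coord_vec if_distrib cong: if_cong)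

lemma of_cart_axis: "of_cart (axis i 1) = coord_vec i"
  by (simp add: of_cart_def axis_def if_distrib[where f="\<lambda>c. c *\<^sub>R _"] cong: if_cong)

lemma to_cart_has_derivative [derivative_intros]:
  "(f has_derivative f') F \<Longrightarrow> ((\<lambda>x. to_cart (f x)) has_derivative (\<lambda>x. to_cart (f' x))) F"
  by (rule bounded_linear.has_derivative[OF linear_conv_bounded_linear[THEN iffD1, OF linear_to_cart]])

lemma of_cart_has_derivative [derivative_intros]:
  "(f has_derivative f') F \<Longrightarrow> ((\<lambda>x. of_cart (f x)) has_derivative (\<lambda>x. of_cart (f' x))) F"
  by (rule bounded_linear.has_derivative[OF linear_conv_bounded_linear[THEN iffD1, OF linear_of_cart]])

lemma continuous_on_to_cart [continuous_intros]: "continuous_on S to_cart"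
  by (simp add: linear_continuous_on linear_conv_bounded_linear[THEN iffD1, OF linear_to_cart])

lemma continuous_on_of_cart [continuous_intros]: "continuous_on S of_cart"
  by (simp add: linear_continuous_on linear_conv_bounded_linear[THEN iffD1, OF linear_of_cart])

lemma to_cart_measurable [measurable]: "to_cart \<in> borel_measurable borel"
  by (rule borel_measurable_continuous_onI) (rule continuous_on_to_cart)

lemma of_cart_measurable [measurable]: "of_cart \<in> borel_measurable borel"
  by (rule borel_measurable_continuous_onI) (rule continuous_on_of_cart)

text \<open>Coordinates carry boxes to boxes with the same side lengths, and Lebesgue measure is
  determined by its values on boxes.\<close>

lemma distr_lborel_to_cart: "distr lborel borel to_cart = (lborel :: (real ^ 'a::euclidean_space coord) measure)"
proof (rule lborel_eqI[symmetric])
  fix l u :: "real ^ 'a coord"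
  assume lu: "\<And>b. b \<in> Basis \<Longrightarrow> l \<bullet> b \<le> u \<bullet> b"
  have le: "l $ i \<le> u $ i" for i
    using lu[of "axis i 1"] by (simp add: inner_axis axis_in_Basis_iff)
  have inner: "of_cart y \<bullet> coord_vec i = y $ i" for y i
    by (metis to_cart_def to_cart_of_cart vec_lambda_beta)
  have pre: "to_cart -` box l u = box (of_cart l) (of_cart u)"
    by (auto simp: box_def Basis_vec_def inner_axis to_cart_def inner
        bij_betw_imp_surj_on[OF bij_betw_coord_vec, symmetric])
  have "emeasure (distr lborel borel to_cart) (box l u) = emeasure lborel (box (of_cart l) (of_cart u))"
    by (subst emeasure_distr) (auto simp: pre)
  also have "\<dots> = (\<Prod>b\<in>Basis. (of_cart u - of_cart l) \<bullet> b)"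
    by (subst emeasure_lborel_box)
       (auto simp: bij_betw_imp_surj_on[OF bij_betw_coord_vec, symmetric] inner le)
  also have "\<dots> = (\<Prod>b\<in>Basis. (u - l) \<bullet> b)"
    by (simp add: prod_Basis_coord inner inner_diff_left Basis_vec_def UNION_singleton_eq_range
        prod.reindex inj_on_def axis_eq_axis inner_axis)
  finally show "emeasure (distr lborel borel to_cart) (box l u) = (\<Prod>b\<in>Basis. (u - l) \<bullet> b)" .
qed simp

lemma negligible_to_cart_image: "negligible S \<Longrightarrow> negligible (to_cart ` S)"
  by (rule negligible_differentiable_image_negligible)
     (auto simp: CARD_coord linear_imp_differentiable_on linear_to_cart)

lemma negligible_of_cart_image: "negligible S \<Longrightarrow> negligible (of_cart ` S)"
  by (rule negligible_differentiable_image_negligible)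
     (auto simp: CARD_coord linear_imp_differentiable_on linear_of_cart)

text \<open>The determinant of an endomorphism, computed in the standard basis; for linear
  \<open>g\<close> every orthonormal basis gives the same value, see
  \<open>ldet_eq_det_frame_mat\<close>.\<close>

definition ldet :: "('a::euclidean_space \<Rightarrow> 'a) \<Rightarrow> real" where
  "ldet g = Determinants.det (matrix (\<lambda>y. to_cart (g (of_cart y))))"

lemma ldet_eq_0_iff:
  assumes "linear g"
  shows "ldet g = 0 \<longleftrightarrow> \<not> inj g"
proof -
  have lin: "linear (\<lambda>y. to_cart (g (of_cart y)))"
    using linear_compose[OF linear_of_cart linear_compose[OF assms linear_to_cart]] by (simp add: o_def)
  have "ldet g \<noteq> 0 \<longleftrightarrow> inj (\<lambda>y. to_cart (g (of_cart y)))"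
    unfolding ldet_def using det_nz_iff_inj[OF lin] by (simp add: matrix_works)
  also have "\<dots> \<longleftrightarrow> inj g"
    by (metis (mono_tags, lifting) injI injD of_cart_to_cart to_cart_of_cart)
  finally show ?thesis by blast
qed

text \<open>Conjugation by the coordinate maps reduces this to matrices of deficient rank. The
  derivative is only relative to \<open>S\<close>, where it need not be unique; the arguments on
  double contacts and on critical contacts exploit this freedom.\<close>

theorem baby_Sard_euclidean:
  fixes f :: "'a::euclidean_space \<Rightarrow> 'a"
  assumes der: "\<And>x. x \<in> S \<Longrightarrow> (f has_derivative f' x) (at x within S)"
    and "\<And>x. x \<in> S \<Longrightarrow> \<not> inj (f' x)"
  shows "negligible (f ` S)"
proof -
  define g where "g = (\<lambda>y. to_cart (f (of_cart y)))"
  define g' where "g' y = (\<lambda>h. to_cart (f' (of_cart y) (of_cart h)))" for y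
  have "negligible (g ` (to_cart ` S))"
  proof (rule baby_Sard)
    fix y assume "y \<in> to_cart ` S"
    then obtain x where x: "x \<in> S" "y = to_cart x" by auto
    have im: "of_cart ` to_cart ` S = S" by (simp add: image_image)
    have "(f has_derivative f' x) (at (of_cart y) within of_cart ` to_cart ` S)"
      using der[OF x(1)] x(2) im by simp
    then have "((\<lambda>y. f (of_cart y)) has_derivative (\<lambda>h. f' x (of_cart h))) (at y within to_cart ` S)"
      by (rule has_derivative_in_compose[OF of_cart_has_derivative[OF has_derivative_ident]])
    then show "(g has_derivative g' y) (at y within to_cart ` S)"
      unfolding g_def g'_def using x(2) by (auto intro: to_cart_has_derivative)
    have "linear (f' x)"
      using der[OF x(1)] has_derivative_linear by blast
    then have "ldet (f' x) = 0"
      using assms(2)[OF x(1)] ldet_eq_0_iff by blast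
    then have "Determinants.det (matrix (g' y)) = 0"
      using x(2) by (simp add: ldet_def g'_def)
    then show "rank (matrix (g' y)) < CARD('a coord)"
      by (simp add: det_eq_0_rank)
  qed simp
  then have "negligible (of_cart ` g ` to_cart ` S)"
    by (rule negligible_of_cart_image)
  then show ?thesis
    by (simp add: g_def image_image)
qed

text \<open>The area inequality, with a null set \<open>N\<close> of targets that may be missed.
  Points covered several times only increase the right-hand side, so the bound holds for
  noninjective maps.\<close>

theorem measure_le_nn_integral_ldet:
  fixes f :: "'a::euclidean_space \<Rightarrow> 'a"
  assumes S: "S \<in> sets borel"
    and der: "\<And>x. x \<in> S \<Longrightarrow> (f has_derivative f' x) (at x within S)"
    and cont: "continuous_on S (\<lambda>x. ldet (f' x))"
    and N: "negligible N" and B: "B \<in> sets borel" "B \<subseteq> f ` S \<union> N"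
  shows "emeasure lborel B \<le> (\<integral>\<^sup>+x\<in>S. ennreal \<bar>ldet (f' x)\<bar> \<partial>lborel)"
proof (cases "(\<integral>\<^sup>+x\<in>S. ennreal \<bar>ldet (f' x)\<bar> \<partial>lborel) = \<infinity>")
  case False
  define T where "T = to_cart ` S"
  have T_eq: "T = of_cart -` S"
    unfolding T_def by (auto intro: image_eqI[where x="of_cart _"])
  have [measurable]: "S \<in> sets borel" by fact
  have T_borel [measurable]: "T \<in> sets borel"
    using measurable_sets[OF of_cart_measurable S] by (simp add: T_eq)
  define g where "g = (\<lambda>y. to_cart (f (of_cart y)))"
  define g' where "g' y = (\<lambda>h. to_cart (f' (of_cart y) (of_cart h)))" for y
  have g_der: "(g has_derivative g' y) (at y within T)" if "y \<in> T" for y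
  proof -
    obtain x where x: "x \<in> S" "y = to_cart x" using \<open>y \<in> T\<close> unfolding T_def by blast
    have im: "of_cart ` T = S" by (simp add: image_image T_def)
    have "(f has_derivative f' x) (at (of_cart y) within of_cart ` T)"
      using der[OF x(1)] x(2) im by simp
    then have "((\<lambda>y. f (of_cart y)) has_derivative (\<lambda>h. f' x (of_cart h))) (at y within T)"
      by (rule has_derivative_in_compose[OF of_cart_has_derivative[OF has_derivative_ident]])
    then show ?thesis
      unfolding g_def g'_def using x(2) by (auto intro: to_cart_has_derivative)
  qed
  have det_g': "Determinants.det (matrix (g' y)) = ldet (f' (of_cart y))" for y
    by (simp add: g'_def ldet_def)
  define J where "J x = \<bar>ldet (f' x)\<bar> * indicator S x" for x
  have J [measurable]: "J \<in> borel_measurable borel"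
    unfolding J_def
    using borel_measurable_continuous_on_indicator[OF S continuous_on_rabs[OF cont]]
    by (simp add: mult.commute)
  have J_cart: "(\<integral>\<^sup>+y. ennreal (J (of_cart y)) \<partial>lborel) = (\<integral>\<^sup>+x. ennreal (J x) \<partial>lborel)"
  proof -
    have "(\<integral>\<^sup>+y. ennreal (J (of_cart y)) \<partial>lborel)
        = (\<integral>\<^sup>+y. ennreal (J (of_cart y)) \<partial>distr lborel borel to_cart)"
      by (simp add: distr_lborel_to_cart)
    also have "\<dots> = (\<integral>\<^sup>+x. ennreal (J (of_cart (to_cart x))) \<partial>lborel)"
      by (rule nn_integral_distr) auto
    finally show ?thesis by simp
  qed
  have J_eq: "(\<integral>\<^sup>+x. ennreal (J x) \<partial>lborel) = (\<integral>\<^sup>+x\<in>S. ennreal \<bar>ldet (f' x)\<bar> \<partial>lborel)"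
    by (rule nn_integral_cong) (auto simp: J_def indicator_def)
  \<comment> \<open>An infinite integral makes the claim trivial. A finite one can be rewritten as
    the gauge integral that \<open>measure_differentiable_image\<close> works with.\<close>
  obtain r where r: "r \<ge> 0" "(\<integral>\<^sup>+y. ennreal (J (of_cart y)) \<partial>lborel) = ennreal r"
    using False J_cart J_eq by (metis ennreal_cases infinity_ennreal_def)
  have "((\<lambda>y. J (of_cart y)) has_integral r) UNIV"
  proof (rule nn_integral_has_integral)
    show "(\<lambda>y. J (of_cart y)) \<in> borel_measurable borel" by measurable
  qed (use r in \<open>auto simp: J_def\<close>)
  then have "((\<lambda>y. if y \<in> T then \<bar>Determinants.det (matrix (g' y))\<bar> else 0) has_integral r) UNIV"
    by (rule has_integral_eq[rotated]) (auto simp: J_def det_g' T_eq)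
  then have int: "((\<lambda>y. \<bar>Determinants.det (matrix (g' y))\<bar>) has_integral r) T"
    by (simp add: has_integral_restrict_UNIV)
  have T_leb: "T \<in> sets lebesgue" using T_borel by simp
  have gT: "g ` T \<in> lmeasurable"
    by (rule measurable_differentiable_image[OF T_leb g_der]) (use int in auto)
  have gT_le: "measure lebesgue (g ` T) \<le> r"
    using measure_differentiable_image[OF T_leb g_der] int
    by (metis has_integral_integrable integral_unique)
  define B' where "B' = of_cart -` B"
  have B' [measurable]: "B' \<in> sets borel"
    using measurable_sets[OF of_cart_measurable B(1)] by (simp add: B'_def)
  have N': "negligible (to_cart ` N)"
    using N by (rule negligible_to_cart_image)
  have sub: "B' \<subseteq> g ` T \<union> to_cart ` N"
  proof
    fix y assume "y \<in> B'"
    then have "of_cart y \<in> f ` S \<union> N" using B(2) by (auto simp: B'_def)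
    then show "y \<in> g ` T \<union> to_cart ` N"
    proof
      assume "of_cart y \<in> f ` S"
      then obtain x where "x \<in> S" "of_cart y = f x" by auto
      then have "y = g (to_cart x)" "to_cart x \<in> T"
        by (auto simp: g_def T_def) (metis to_cart_of_cart)
      then show ?thesis by blast
    next
      assume "of_cart y \<in> N"
      then show ?thesis by (metis UnI2 image_eqI to_cart_of_cart)
    qed
  qed
  have "emeasure lborel B = emeasure (distr lborel borel to_cart) B'"
    using B' by (subst emeasure_distr) (auto simp: B'_def vimage_def)
  also have "\<dots> = emeasure lebesgue B'"
    by (simp add: distr_lborel_to_cart)
  also have "\<dots> \<le> emeasure lebesgue (g ` T \<union> to_cart ` N)"
    by (rule emeasure_mono[OF sub]) (use gT N' in \<open>auto simp: negligible_imp_sets\<close>)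
  also have "\<dots> = emeasure lebesgue (g ` T)"
    using gT N' by (intro emeasure_Un_null_set) (auto simp: negligible_iff_null_sets)
  also have "\<dots> \<le> ennreal r"
    using gT gT_le by (simp add: emeasure_eq_measure2 ennreal_leI)
  finally show ?thesis
    using r J_cart J_eq by simp
qed simp

text \<open>Both determinants are Leibniz sums. Conjugation by \<open>\<beta>\<close> matches the
  permutations of the index type with those of \<open>{..<d}\<close> and preserves signs.\<close>

lemma det_jnf_eq_det:
  fixes a :: "nat \<Rightarrow> nat \<Rightarrow> real"
  assumes \<beta>: "bij_betw \<beta> (UNIV :: 'n::finite set) {..<d}"
  shows "Determinant.det (Matrix.mat d d (\<lambda>(i, j). a i j))
       = Determinants.det (\<chi> i j. a (\<beta> i) (\<beta> j))"
proof -
  define M where "M = Matrix.mat d d (\<lambda>(i, j). a i j)"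
  have inj: "inj \<beta>" and ran: "range \<beta> = {..<d}"
    using \<beta> by (auto simp: bij_betw_def)
  define T where "T = map_permutation UNIV \<beta>"
  have T: "bij_betw T {p. p permutes UNIV} {p. p permutes {..<d}}"
    using bij_betw_permutations[OF \<beta>]
    by (rule bij_betw_cong[THEN iffD1, rotated])
       (auto simp: T_def map_permutation_def restrict_id_def ran fun_eq_iff)
  have "Determinant.det M = (\<Sum>p | p permutes {..<d}. signof p * (\<Prod>i<d. M $$ (i, p i)))"
    by (subst Determinant.det_def'[of _ d]) (auto simp: M_def lessThan_atLeast0)
  also have "\<dots> = (\<Sum>p | p permutes (UNIV :: 'n set). signof (T p) * (\<Prod>i<d. M $$ (i, T p i)))"
    by (rule sum.reindex_bij_betw[OF T, symmetric])
  also have "\<dots> = (\<Sum>p | p permutes (UNIV :: 'n set). of_int (sign p) * (\<Prod>i\<in>UNIV. a (\<beta> i) (\<beta> (p i))))"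
  proof (rule sum.cong)
    fix p assume "p \<in> {p. p permutes (UNIV :: 'n set)}"
    then have p: "p permutes (UNIV :: 'n set)" by simp
    have s: "sign (T p) = sign p"
      unfolding T_def using inj p by (intro sign_map_permutation) auto
    have "(\<Prod>i<d. M $$ (i, T p i)) = (\<Prod>i\<in>UNIV. M $$ (\<beta> i, T p (\<beta> i)))"
      by (rule prod.reindex_bij_betw[OF \<beta>, symmetric])
    also have "\<dots> = (\<Prod>i\<in>UNIV. a (\<beta> i) (\<beta> (p i)))"
    proof (rule prod.cong)
      fix i :: 'n
      have "T p (\<beta> i) = \<beta> (p i)"
        unfolding T_def using inj by (intro map_permutation_apply) auto
      moreover have "\<beta> i < d" "\<beta> (p i) < d" using ran by auto
      ultimately show "M $$ (\<beta> i, T p (\<beta> i)) = a (\<beta> i) (\<beta> (p i))"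
        by (simp add: M_def)
    qed simp
    finally show "signof (T p) * (\<Prod>i<d. M $$ (i, T p i))
        = of_int (sign p) * (\<Prod>i\<in>UNIV. a (\<beta> i) (\<beta> (p i)))"
      by (simp add: s)
  qed simp
  also have "\<dots> = Determinants.det (\<chi> i j. a (\<beta> i) (\<beta> j))"
    by (simp add: Determinants.det_def)
  finally show ?thesis by (simp add: M_def)
qed

section \<open>Determinants of endomorphisms in orthonormal frames\<close>

definition orthonormal_basis :: "(nat \<Rightarrow> 'a::euclidean_space) \<Rightarrow> bool" where
  "orthonormal_basis u \<longleftrightarrow> (\<forall>i<DIM('a). \<forall>j<DIM('a). u i \<bullet> u j = (if i = j then 1 else 0))"

text \<open>For an orthonormal family that does not span, such as a tangent frame, this is the
  matrix of the compression of \<open>g\<close> to its span.\<close>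

definition frame_mat :: "nat \<Rightarrow> (nat \<Rightarrow> 'a::real_inner) \<Rightarrow> ('a \<Rightarrow> 'a) \<Rightarrow> real Matrix.mat" where
  "frame_mat d u g = Matrix.mat d d (\<lambda>(i, j). u i \<bullet> g (u j))"

lemma ldet_eq_det_coord_basis:
  fixes g :: "'a::euclidean_space \<Rightarrow> 'a"
  shows "ldet g = Determinant.det (frame_mat DIM('a) coord_basis g)"
  unfolding frame_mat_def ldet_def det_jnf_eq_det[OF bij_betw_coord_nat]
  by (simp add: matrix_def of_cart_axis to_cart_def coord_vec_def inner_commute)

lemma sum_coord_basis: "(\<Sum>i<DIM('a). (x \<bullet> coord_basis i) *\<^sub>R coord_basis i) = (x :: 'a::euclidean_space)"
  using sum.reindex_bij_betw[OF bij_betw_coord_basis, of "\<lambda>b. (x \<bullet> b) *\<^sub>R b"]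
  by (simp add: euclidean_representation)

lemma inner_eq_sum_coord_basis:
  "x \<bullet> (y :: 'a::euclidean_space) = (\<Sum>i<DIM('a). (x \<bullet> coord_basis i) * (y \<bullet> coord_basis i))"
proof -
  have "x \<bullet> y = (\<Sum>i<DIM('a). (x \<bullet> coord_basis i) *\<^sub>R coord_basis i) \<bullet> y"
    by (simp add: sum_coord_basis)
  also have "\<dots> = (\<Sum>i<DIM('a). (x \<bullet> coord_basis i) * (y \<bullet> coord_basis i))"
    by (simp add: inner_sum_left inner_commute[of y])
  finally show ?thesis .
qed

text \<open>The matrix \<open>P\<close> that expresses \<open>u\<close> in the standard basis is
  orthogonal, and conjugation by it does not change the determinant.\<close>

lemma ldet_eq_det_frame_mat:
  fixes g :: "'a::euclidean_space \<Rightarrow> 'a"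
  assumes lin: "linear g" and u: "orthonormal_basis u"
  shows "ldet g = Determinant.det (frame_mat DIM('a) u g)"
proof -
  let ?d = "DIM('a)"
  define P where "P = Matrix.mat ?d ?d (\<lambda>(i, j). coord_basis i \<bullet> u j)"
  define B where "B = frame_mat ?d coord_basis g"
  have [simp]: "P \<in> carrier_mat ?d ?d" "B \<in> carrier_mat ?d ?d"
    by (auto simp: P_def B_def frame_mat_def)
  have PP: "P\<^sup>T * P = 1\<^sub>m ?d"
    using u by (intro eq_matI)
      (auto simp: P_def scalar_prod_def orthonormal_basis_def lessThan_atLeast0[symmetric]
        inner_eq_sum_coord_basis[symmetric] inner_commute[of "coord_basis _"])
  have BP: "B * P = Matrix.mat ?d ?d (\<lambda>(i, j). coord_basis i \<bullet> g (u j))"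
  proof (intro eq_matI)
    fix i j assume "i < dim_row (Matrix.mat ?d ?d (\<lambda>(i, j). coord_basis i \<bullet> g (u j)))"
      "j < dim_col (Matrix.mat ?d ?d (\<lambda>(i, j). coord_basis i \<bullet> g (u j)))"
    then have ij: "i < ?d" "j < ?d" by auto
    have "coord_basis i \<bullet> g (u j) = coord_basis i \<bullet> g (\<Sum>k<?d. (u j \<bullet> coord_basis k) *\<^sub>R coord_basis k)"
      by (simp add: sum_coord_basis)
    also have "\<dots> = (\<Sum>k<?d. (coord_basis i \<bullet> g (coord_basis k)) * (coord_basis k \<bullet> u j))"
      by (simp add: linear_sum[OF lin] linear_scale[OF lin] inner_sum_right inner_commute mult.commute)
    finally show "(B * P) $$ (i, j) = Matrix.mat ?d ?d (\<lambda>(i, j). coord_basis i \<bullet> g (u j)) $$ (i, j)"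
      using ij by (simp add: B_def P_def frame_mat_def scalar_prod_def lessThan_atLeast0)
  qed (auto simp: B_def P_def frame_mat_def)
  have "P\<^sup>T * (B * P) = frame_mat ?d u g"
    unfolding BP
    by (intro eq_matI)
      (auto simp: P_def scalar_prod_def frame_mat_def lessThan_atLeast0[symmetric]
        inner_eq_sum_coord_basis[symmetric] inner_commute[of "coord_basis _"])
  then have "Determinant.det (frame_mat ?d u g) = Determinant.det (P\<^sup>T) * (Determinant.det B * Determinant.det P)"
    by (metis (no_types, lifting) Determinant.det_mult \<open>B \<in> carrier_mat ?d ?d\<close> \<open>P \<in> carrier_mat ?d ?d\<close>
        mult_carrier_mat transpose_carrier_mat)
  also have "\<dots> = Determinant.det (P\<^sup>T * P) * Determinant.det B"
    by (subst Determinant.det_mult[of _ ?d]) auto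
  also have "\<dots> = Determinant.det B" by (simp add: PP)
  finally show ?thesis by (simp add: B_def ldet_eq_det_coord_basis)
qed

lemma orthonormal_basis_frame:
  fixes n :: "'a::euclidean_space"
  assumes "norm n = 1" "orthonormal_frame n e"
  shows "orthonormal_basis (case_nat n e)"
  using assms
  by (auto simp: orthonormal_basis_def orthonormal_frame_def norm_eq_1 inner_commute split: nat.splits)

text \<open>In the basis \<open>n\<close>, \<open>e\<close> the hypothesis \<open>tan\<close>
  empties the first row off the diagonal, so the matrix is block triangular. Both Jacobians, of
  \<open>polar_map\<close> and of \<open>level_map\<close>, are computed this way.\<close>

theorem ldet_block:
  fixes g :: "'a::euclidean_space \<Rightarrow> 'a"
  assumes lin: "linear g" and n: "norm n = 1" and e: "orthonormal_frame n e"
    and tan: "\<And>j. j < DIM('a) - 1 \<Longrightarrow> n \<bullet> g (e j) = 0"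
  shows "ldet g = (n \<bullet> g n) * Determinant.det (frame_mat (DIM('a) - 1) e g)"
proof -
  let ?d = "DIM('a) - 1"
  define A3 where "A3 = Matrix.mat ?d 1 (\<lambda>(i, j). e i \<bullet> g n)"
  define A1 where "A1 = Matrix.mat 1 1 (\<lambda>_. n \<bullet> g n)"
  have d: "DIM('a) = 1 + ?d"
    using DIM_positive[where 'a='a] by linarith
  have "frame_mat (1 + ?d) (case_nat n e) g = four_block_mat A1 (0\<^sub>m 1 ?d) A3 (frame_mat ?d e g)"
    using tan
    by (intro eq_matI) (auto simp: A1_def A3_def frame_mat_def split: nat.splits)
  then have "Determinant.det (frame_mat (1 + ?d) (case_nat n e) g)
      = Determinant.det A1 * Determinant.det (frame_mat ?d e g)"
    by (simp add: det_four_block_mat_upper_right_zero[of _ 1 _ ?d] A1_def A3_def frame_mat_def)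
  also have "Determinant.det A1 = n \<bullet> g n"
    by (simp add: A1_def det_single)
  finally show ?thesis
    using ldet_eq_det_frame_mat[OF lin orthonormal_basis_frame[OF n e]] d by simp
qed

lemma orthonormal_frame_exists:
  fixes n :: "'a::euclidean_space"
  assumes n: "norm n = 1"
  shows "\<exists>e. orthonormal_frame n e"
proof -
  obtain B where B: "B \<subseteq> {x. n \<bullet> x = 0}" "pairwise real_inner_class.orthogonal B" "\<And>x. x \<in> B \<Longrightarrow> norm x = 1"
     "independent B" "card B = dim {x. n \<bullet> x = 0}" "span B = {x. n \<bullet> x = 0}"
    using orthonormal_basis_subspace[OF subspace_hyperplane] by blast
  have "card B = DIM('a) - 1"
    using B(5) n dim_hyperplane[of n] by (metis norm_zero zero_neq_one)
  moreover have "finite B"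
    using B(4) by (simp add: independent_imp_finite)
  ultimately obtain e where e: "bij_betw e {..<DIM('a) - 1} B"
    using finite_same_card_bij[of "{..<DIM('a) - 1}" B] by auto
  have "orthonormal_frame n e"
    unfolding orthonormal_frame_def
  proof (intro conjI allI impI)
    fix i assume "i < DIM('a) - 1"
    then have "e i \<in> B" using e by (auto dest: bij_betwE)
    then show "e i \<bullet> n = 0" using B(1) by (auto simp: inner_commute)
  next
    fix i j assume ij: "i < DIM('a) - 1" "j < DIM('a) - 1"
    then have eB: "e i \<in> B" "e j \<in> B" using e by (auto dest: bij_betwE)
    show "e i \<bullet> e j = (if i = j then 1 else 0)"
    proof (cases "i = j")
      case True
      then show ?thesis using B(3)[OF eB(1)] by (simp add: norm_eq_1)
    next
      case False
      then have "e i \<noteq> e j" using e ij by (metis bij_betw_def inj_onD lessThan_iff)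
      then show ?thesis using B(2) eB False by (auto simp: pairwise_def real_inner_class.orthogonal_def)
    qed
  qed
  then show ?thesis by blast
qed

lemma orthonormal_frame_tangent_frame: "norm n = 1 \<Longrightarrow> orthonormal_frame n (tangent_frame n)"
  unfolding tangent_frame_def using someI_ex[OF orthonormal_frame_exists] .

text \<open>The frame together with \<open>n\<close> consists of \<open>DIM('a)\<close> orthonormal
  vectors, hence spans, and the difference of the two sides is orthogonal to all of them.\<close>

lemma orthonormal_frame_expand:
  fixes n :: "'a::euclidean_space"
  assumes n: "norm n = 1" and e: "orthonormal_frame n e" and w: "w \<bullet> n = 0"
  shows "(\<Sum>i<DIM('a) - 1. (w \<bullet> e i) *\<^sub>R e i) = w"
proof -
  let ?d = "DIM('a) - 1"
  have eo: "e i \<bullet> e j = (if i = j then 1 else 0)" if "i < ?d" "j < ?d" for i j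
    using e that by (auto simp: orthonormal_frame_def)
  have en: "e i \<bullet> n = 0" if "i < ?d" for i
    using e that by (auto simp: orthonormal_frame_def)
  have inj: "inj_on e {..<?d}"
    by (rule inj_onI) (metis eo lessThan_iff zero_neq_one)
  have nn: "n \<notin> e ` {..<?d}"
    using en n by (auto simp: norm_eq_1)
  define B where "B = insert n (e ` {..<?d})"
  have orth: "pairwise real_inner_class.orthogonal B"
    unfolding B_def pairwise_insert
    using eo en by (auto simp: pairwise_def real_inner_class.orthogonal_def inner_commute)
  have "0 \<notin> B"
    using n eo unfolding B_def by auto (metis eo inner_zero_left zero_neq_one)
  then have ind: "independent B"
    using orth pairwise_orthogonal_independent by blast
  have "card B = DIM('a)"
    using nn inj by (simp add: B_def card_image)
  then have span: "span B = UNIV"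
    using ind by (metis dim_eq_card_independent dim_eq_full)
  define z where "z = w - (\<Sum>i<?d. (w \<bullet> e i) *\<^sub>R e i)"
  have sum: "(\<Sum>i<?d. (w \<bullet> e i) * (e i \<bullet> e j)) = w \<bullet> e j" if "j < ?d" for j
  proof -
    have "(\<Sum>i<?d. (w \<bullet> e i) * (e i \<bullet> e j)) = (\<Sum>i<?d. if i = j then w \<bullet> e i else 0)"
      using that by (intro sum.cong) (auto simp: eo)
    then show ?thesis using that by simp
  qed
  have "real_inner_class.orthogonal z b" if "b \<in> B" for b
    using that w en sum unfolding B_def real_inner_class.orthogonal_def z_def
    by (auto simp: inner_diff_left inner_sum_left)
  then have "real_inner_class.orthogonal z z"
    using orthogonal_to_span[of z B] span by blast
  then show ?thesis by (simp add: z_def real_inner_class.orthogonal_def)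
qed

subsection \<open>Functions of class C2\<close>

text \<open>\<open>G\<close> is the gradient and \<open>L x\<close> the Hessian as an endomorphism,
  both plain functions instead of bundled operators. Since \<open>L x\<close> is linear on a space
  of finite dimension, continuity in each fixed direction amounts to continuity in operator
  norm.\<close>

definition C2_data ::
    "'a::euclidean_space set \<Rightarrow> ('a \<Rightarrow> real) \<Rightarrow> ('a \<Rightarrow> 'a) \<Rightarrow> ('a \<Rightarrow> 'a \<Rightarrow> 'a) \<Rightarrow> bool" where
  "C2_data S f G L \<longleftrightarrow>
    (\<forall>x\<in>S. (f has_derivative (\<lambda>h. G x \<bullet> h)) (at x within S)) \<and>
    (\<forall>x\<in>S. (G has_derivative L x) (at x within S)) \<and>
    (\<forall>h. continuous_on S (\<lambda>x. L x h))"

lemma C2_dataD: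
  assumes "C2_data S f G L"
  shows "x \<in> S \<Longrightarrow> (f has_derivative (\<lambda>h. G x \<bullet> h)) (at x within S)"
    and "x \<in> S \<Longrightarrow> (G has_derivative L x) (at x within S)"
    and "continuous_on S (\<lambda>x. L x h)"
    and "x \<in> S \<Longrightarrow> linear (L x)"
  using assms unfolding C2_data_def by (blast intro: has_derivative_linear)+

lemma C2_data_subset:
  assumes "C2_data S f G L" "T \<subseteq> S"
  shows "C2_data T f G L"
  using assms has_derivative_subset continuous_on_subset
  unfolding C2_data_def by (metis subsetD)

lemma C2_data_at:
  assumes "C2_data S f G L" "x \<in> interior S"
  shows "(f has_derivative (\<lambda>h. G x \<bullet> h)) (at x)" "(G has_derivative L x) (at x)"
proof -
  have "x \<in> S" using assms(2) interior_subset by blast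
  then show "(f has_derivative (\<lambda>h. G x \<bullet> h)) (at x)" "(G has_derivative L x) (at x)"
    using C2_dataD(1,2)[OF assms(1)] at_within_interior[OF assms(2)] by metis+
qed

lemma C2_data_continuous:
  assumes "C2_data S f G L"
  shows "continuous_on S f" "continuous_on S G"
  using has_derivative_continuous_on[of S f "\<lambda>x h. G x \<bullet> h"] has_derivative_continuous_on[of S G L]
    C2_dataD(1,2)[OF assms] by auto

lemma C2_on_imp_C2_data:
  fixes f :: "'a::euclidean_space \<Rightarrow> real"
  assumes "C2_on S f"
  obtains G L where "C2_data S f G L"
proof -
  obtain f' :: "'a \<Rightarrow> 'a \<Rightarrow>\<^sub>L real" and f'' :: "'a \<Rightarrow> 'a \<Rightarrow>\<^sub>L ('a \<Rightarrow>\<^sub>L real)" where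
    f: "\<And>x. x \<in> S \<Longrightarrow> (f has_derivative blinfun_apply (f' x)) (at x within S)" and
    f': "\<And>x. x \<in> S \<Longrightarrow> (f' has_derivative blinfun_apply (f'' x)) (at x within S)" and
    f'': "continuous_on S f''"
    using assms unfolding C2_on_def by blast
  \<comment> \<open>\<open>R\<close> is the Riesz representative of a functional; it turns
    derivatives into gradients.\<close>
  define R :: "('a \<Rightarrow>\<^sub>L real) \<Rightarrow> 'a" where "R \<phi> = (\<Sum>b\<in>Basis. blinfun_apply \<phi> b *\<^sub>R b)" for \<phi>
  have R: "R \<phi> \<bullet> h = blinfun_apply \<phi> h" for \<phi> h
  proof -
    have "blinfun_apply \<phi> h = blinfun_apply \<phi> (\<Sum>b\<in>Basis. (h \<bullet> b) *\<^sub>R b)"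
      by (simp add: euclidean_representation)
    also have "\<dots> = R \<phi> \<bullet> h"
      by (simp add: R_def blinfun.sum_right blinfun.scaleR_right inner_sum_left inner_commute[of h] mult.commute)
    finally show ?thesis by simp
  qed
  have blR: "bounded_linear R"
    unfolding R_def by (intro bounded_linear_sum bounded_linear_intros)
  have "C2_data S f (\<lambda>x. R (f' x)) (\<lambda>x h. R (blinfun_apply (f'' x) h))"
    unfolding C2_data_def
  proof (intro conjI ballI allI)
    fix x assume "x \<in> S"
    then show "(f has_derivative (\<lambda>h. R (f' x) \<bullet> h)) (at x within S)"
      using f by (simp add: R)
    show "((\<lambda>x. R (f' x)) has_derivative (\<lambda>h. R (blinfun_apply (f'' x) h))) (at x within S)"
      using bounded_linear.has_derivative[OF blR f'[OF \<open>x \<in> S\<close>]] .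
  next
    fix h
    have "continuous_on S (\<lambda>x. blinfun_apply (f'' x) h)"
      by (intro continuous_intros f'')
    then show "continuous_on S (\<lambda>x. R (blinfun_apply (f'' x) h))"
      by (rule bounded_linear.continuous_on[OF blR])
  qed
  then show ?thesis by (rule that)
qed

lemma C2_data_bounded:
  assumes "C2_data S f G L" "compact S"
  obtains K where "K > 0" "\<And>x h. x \<in> S \<Longrightarrow> norm (L x h) \<le> K * norm h"
proof -
  have "\<exists>B. \<forall>x\<in>S. norm (L x b) \<le> B" for b
  proof -
    have "bounded ((\<lambda>x. L x b) ` S)"
      using C2_dataD(3)[OF assms(1)] assms(2) compact_continuous_image compact_imp_bounded by blast
    then show ?thesis by (auto simp: bounded_iff)
  qed
  then obtain B where B: "\<And>b x. x \<in> S \<Longrightarrow> norm (L x b) \<le> B b" by metis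
  define K where "K = (\<Sum>b\<in>Basis. \<bar>B b\<bar>) + 1"
  have "norm (L x h) \<le> K * norm h" if "x \<in> S" for x h
  proof -
    have lin: "linear (L x)" using C2_dataD(4)[OF assms(1) that] .
    have "L x h = L x (\<Sum>b\<in>Basis. (h \<bullet> b) *\<^sub>R b)" by (simp add: euclidean_representation)
    also have "\<dots> = (\<Sum>b\<in>Basis. (h \<bullet> b) *\<^sub>R L x b)"
      by (simp add: linear_sum[OF lin] linear_scale[OF lin])
    finally have "norm (L x h) \<le> (\<Sum>b\<in>Basis. \<bar>h \<bullet> b\<bar> * norm (L x b))"
      using norm_sum[of "\<lambda>b. (h \<bullet> b) *\<^sub>R L x b" Basis] by simp
    also have "\<dots> \<le> (\<Sum>b\<in>Basis. norm h * \<bar>B b\<bar>)"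
      using B[OF that] by (intro sum_mono mult_mono) (auto simp: Basis_le_norm intro: order_trans[OF _ abs_ge_self])
    also have "\<dots> = norm h * (\<Sum>b\<in>Basis. \<bar>B b\<bar>)" by (simp add: sum_distrib_left)
    also have "\<dots> \<le> K * norm h" by (simp add: K_def algebra_simps)
    finally show ?thesis .
  qed
  moreover have "K > 0" unfolding K_def by (intro add_nonneg_pos sum_nonneg) auto
  ultimately show ?thesis using that by blast
qed

text \<open>The mean value theorem along \<open>h\<close>, applied to the increment of
  \<open>f\<close> in direction \<open>k\<close>, leaves a difference of two gradients near
  \<open>x\<close>, which the linearisation \<open>A\<close> controls. The second difference is
  symmetric in \<open>h\<close> and \<open>k\<close>, while \<open>A k \<bullet> h\<close> is not
  yet known to be.\<close>

lemma second_difference_bound: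
  fixes G :: "'a::real_inner \<Rightarrow> 'a"
  assumes f: "\<And>y. norm y < \<delta> \<Longrightarrow> (f has_derivative (\<lambda>h. G (x + y) \<bullet> h)) (at (x + y))"
    and lin: "linear A"
    and G: "\<And>y. norm y < \<delta> \<Longrightarrow> norm (G (x + y) - G x - A y) \<le> \<epsilon> * norm y"
    and \<epsilon>: "\<epsilon> \<ge> 0" and hk: "norm h + norm k < \<delta>"
  shows "\<bar>f (x + h + k) - f (x + h) - f (x + k) + f x - A k \<bullet> h\<bar> \<le> 2 * \<epsilon> * (norm h + norm k)\<^sup>2"
proof -
  define \<phi> where "\<phi> t = f (x + (t *\<^sub>R h + k)) - f (x + t *\<^sub>R h)" for t :: real
  have n1: "norm (t *\<^sub>R h + k) < \<delta>" "norm (t *\<^sub>R h) < \<delta>"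
    and n2: "norm (t *\<^sub>R h + k) \<le> norm h + norm k" "norm (t *\<^sub>R h) \<le> norm h + norm k"
    if "0 \<le> t" "t \<le> 1" for t
  proof -
    have "norm (t *\<^sub>R h) \<le> norm h" using that by (simp add: mult_left_le_one_le)
    then show "norm (t *\<^sub>R h + k) \<le> norm h + norm k" "norm (t *\<^sub>R h) \<le> norm h + norm k"
      using norm_triangle_ineq[of "t *\<^sub>R h" k] norm_ge_zero[of k] by linarith+
    then show "norm (t *\<^sub>R h + k) < \<delta>" "norm (t *\<^sub>R h) < \<delta>" using hk by auto
  qed
  have der: "(\<phi> has_derivative (\<lambda>s. (G (x + (t *\<^sub>R h + k)) - G (x + t *\<^sub>R h)) \<bullet> (s *\<^sub>R h))) (at t within {0..1})"
    if "0 \<le> t" "t \<le> 1" for t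
  proof -
    have "((\<lambda>t. f (x + (t *\<^sub>R h + k))) has_derivative (\<lambda>s. G (x + (t *\<^sub>R h + k)) \<bullet> (s *\<^sub>R h))) (at t within {0..1})"
      by (rule has_derivative_compose[where f="\<lambda>t. x + (t *\<^sub>R h + k)" and x=t, OF _ f[OF n1(1)[OF that]]]) (auto intro!: derivative_eq_intros)
    moreover have "((\<lambda>t. f (x + t *\<^sub>R h)) has_derivative (\<lambda>s. G (x + t *\<^sub>R h) \<bullet> (s *\<^sub>R h))) (at t within {0..1})"
      by (rule has_derivative_compose[where f="\<lambda>t. x + t *\<^sub>R h" and x=t, OF _ f[OF n1(2)[OF that]]]) (auto intro!: derivative_eq_intros)
    ultimately show ?thesis
      unfolding \<phi>_def inner_diff_left by (rule has_derivative_diff)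
  qed
  obtain t where t: "0 < t" "t < 1"
    "\<phi> 1 - \<phi> 0 = (G (x + (t *\<^sub>R h + k)) - G (x + t *\<^sub>R h)) \<bullet> h"
    using mvt_simple[of 0 1 \<phi> "\<lambda>t s. (G (x + (t *\<^sub>R h + k)) - G (x + t *\<^sub>R h)) \<bullet> (s *\<^sub>R h)"] der by auto
  have eq: "G (x + (t *\<^sub>R h + k)) - G (x + t *\<^sub>R h) - A k
      = (G (x + (t *\<^sub>R h + k)) - G x - A (t *\<^sub>R h + k)) - (G (x + t *\<^sub>R h) - G x - A (t *\<^sub>R h))"
    by (simp add: linear_add[OF lin])
  have "norm (G (x + (t *\<^sub>R h + k)) - G (x + t *\<^sub>R h) - A k)
      \<le> \<epsilon> * norm (t *\<^sub>R h + k) + \<epsilon> * norm (t *\<^sub>R h)"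
    unfolding eq using n1[of t] t(1,2)
    by (intro order_trans[OF norm_triangle_ineq4] add_mono G) auto
  also have "\<dots> \<le> \<epsilon> * (norm h + norm k) + \<epsilon> * (norm h + norm k)"
    using n2[of t] t(1,2) \<epsilon> by (intro add_mono mult_left_mono) auto
  finally have le: "norm (G (x + (t *\<^sub>R h + k)) - G (x + t *\<^sub>R h) - A k) \<le> 2 * \<epsilon> * (norm h + norm k)"
    by simp
  have "\<bar>\<phi> 1 - \<phi> 0 - A k \<bullet> h\<bar> = \<bar>(G (x + (t *\<^sub>R h + k)) - G (x + t *\<^sub>R h) - A k) \<bullet> h\<bar>"
    using t(3) by (simp add: inner_diff_left)
  also have "\<dots> \<le> (2 * \<epsilon> * (norm h + norm k)) * (norm h + norm k)"
    using le \<epsilon> by (intro order_trans[OF Cauchy_Schwarz_ineq2] mult_mono) auto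
  finally show ?thesis
    by (simp add: \<phi>_def power2_eq_square algebra_simps)
qed

text \<open>Exchanging \<open>h\<close> and \<open>k\<close> leaves the second difference unchanged,
  so both orders of differentiation approximate the same number, up to an error that is small
  compared with \<open>s\<^sup>2\<close> when both vectors are scaled by \<open>s\<close>.\<close>

lemma second_derivative_symmetric:
  fixes f :: "'a::euclidean_space \<Rightarrow> real"
  assumes U: "open U" "x \<in> U"
    and f: "\<And>y. y \<in> U \<Longrightarrow> (f has_derivative (\<lambda>h. G y \<bullet> h)) (at y)"
    and G: "(G has_derivative A) (at x)"
  shows "A h \<bullet> k = A k \<bullet> h"
proof (rule ccontr)
  assume neq: "A h \<bullet> k \<noteq> A k \<bullet> h"
  have lin: "linear A" using G has_derivative_linear by blast
  define N where "N = norm h + norm k"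
  have N: "N > 0"
    using neq linear_0[OF lin] by (auto simp: N_def add_nonneg_eq_0_iff order_less_le)
  \<comment> \<open>With this choice the final bound \<open>4 * \<epsilon> * N\<^sup>2\<close> is
    half of the asymmetry, a contradiction.\<close>
  define \<epsilon> where "\<epsilon> = \<bar>A h \<bullet> k - A k \<bullet> h\<bar> / (8 * N\<^sup>2)"
  have \<epsilon>: "\<epsilon> > 0" using neq N by (simp add: \<epsilon>_def)
  obtain d1 where d1: "d1 > 0" "ball x d1 \<subseteq> U" using U open_contains_ball by blast
  obtain d2 where d2: "d2 > 0" "\<And>y. norm (y - x) < d2 \<Longrightarrow> norm (G y - G x - A (y - x)) \<le> \<epsilon> * norm (y - x)"
    using G \<epsilon> unfolding has_derivative_at_alt by blast
  define \<delta> where "\<delta> = min d1 d2"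
  have \<delta>: "\<delta> > 0" using d1 d2 by (simp add: \<delta>_def)
  have f\<delta>: "(f has_derivative (\<lambda>h. G (x + y) \<bullet> h)) (at (x + y))" if "norm y < \<delta>" for y
    using that d1(2) by (intro f) (auto simp: \<delta>_def dist_norm subset_iff)
  have G\<delta>: "norm (G (x + y) - G x - A y) \<le> \<epsilon> * norm y" if "norm y < \<delta>" for y
    using d2(2)[of "x + y"] that by (simp add: \<delta>_def)
  define s where "s = \<delta> / (2 * N)"
  have s: "s > 0" using \<delta> N by (simp add: s_def)
  have sN: "norm (s *\<^sub>R h) + norm (s *\<^sub>R k) = s * N" using s by (simp add: N_def algebra_simps)
  have small: "s * N < \<delta>" using \<delta> N by (simp add: s_def)
  have "\<bar>f (x + s *\<^sub>R h + s *\<^sub>R k) - f (x + s *\<^sub>R h) - f (x + s *\<^sub>R k) + f x - A (s *\<^sub>R k) \<bullet> (s *\<^sub>R h)\<bar> \<le> 2 * \<epsilon> * (s * N)\<^sup>2"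
    using second_difference_bound[OF f\<delta> lin G\<delta>, where h="s *\<^sub>R h" and k="s *\<^sub>R k"] \<epsilon> small sN by simp
  moreover have "\<bar>f (x + s *\<^sub>R h + s *\<^sub>R k) - f (x + s *\<^sub>R k) - f (x + s *\<^sub>R h) + f x - A (s *\<^sub>R h) \<bullet> (s *\<^sub>R k)\<bar> \<le> 2 * \<epsilon> * (s * N)\<^sup>2"
    using second_difference_bound[OF f\<delta> lin G\<delta>, where h="s *\<^sub>R k" and k="s *\<^sub>R h"] \<epsilon> small sN by (simp add: add_ac)
  ultimately have "\<bar>A (s *\<^sub>R h) \<bullet> (s *\<^sub>R k) - A (s *\<^sub>R k) \<bullet> (s *\<^sub>R h)\<bar> \<le> 4 * \<epsilon> * (s * N)\<^sup>2"
    by linarith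
  then have "s\<^sup>2 * \<bar>A h \<bullet> k - A k \<bullet> h\<bar> \<le> s\<^sup>2 * (4 * \<epsilon> * N\<^sup>2)"
    by (simp add: linear_scale[OF lin] power2_eq_square abs_mult[symmetric] right_diff_distrib[symmetric] mult_ac)
  then have "\<bar>A h \<bullet> k - A k \<bullet> h\<bar> \<le> 4 * \<epsilon> * N\<^sup>2"
    using s by simp
  also have "\<dots> = \<bar>A h \<bullet> k - A k \<bullet> h\<bar> / 2" using N by (simp add: \<epsilon>_def)
  finally show False using neq by simp
qed

lemma C2_data_symmetric:
  assumes "C2_data S f G L" "x \<in> interior S"
  shows "L x h \<bullet> k = L x k \<bullet> h"
  by (rule second_derivative_symmetric[OF open_interior assms(2)])
     (use C2_data_at[OF assms(1)] assms(2) in auto)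

subsection \<open>Curves on the sphere and sectors of spherical shells\<close>

lemma norm_has_derivative:
  fixes x :: "'a::euclidean_space"
  assumes "x \<noteq> 0"
  shows "(norm has_derivative (\<lambda>h. sgn x \<bullet> h)) (at x)"
  using has_derivative_norm[OF assms] by (simp add: inner_commute)

lemma sgn_has_derivative:
  fixes x :: "'a::euclidean_space"
  assumes "x \<noteq> 0"
  shows "(sgn has_derivative (\<lambda>h. (h - (sgn x \<bullet> h) *\<^sub>R sgn x) /\<^sub>R norm x)) (at x)"
proof -
  have "((\<lambda>x. inverse (norm x) *\<^sub>R x) has_derivative
      (\<lambda>h. inverse (norm x) *\<^sub>R h + (- (inverse (norm x) * (sgn x \<bullet> h) * inverse (norm x))) *\<^sub>R x)) (at x)"
    using has_derivative_scaleR[OF Deriv.has_derivative_inverse[OF _ norm_has_derivative[OF assms]] has_derivative_ident] assms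
    by simp
  moreover have "inverse (norm x) *\<^sub>R h + (- (inverse (norm x) * (sgn x \<bullet> h) * inverse (norm x))) *\<^sub>R x
      = (h - (sgn x \<bullet> h) *\<^sub>R sgn x) /\<^sub>R norm x" for h
    by (simp add: sgn_div_norm scaleR_diff_right mult_ac)
  ultimately show ?thesis
    by (simp add: sgn_div_norm[abs_def])
qed

lemma sphere_chart_norm:
  assumes "norm n = 1" "w \<bullet> n = 0" "norm w \<le> 1"
  shows "norm (sphere_chart n w) = 1"
proof -
  have "(norm w)\<^sup>2 \<le> 1" using assms(3) by (simp add: power_le_one)
  then have "sphere_chart n w \<bullet> sphere_chart n w = 1"
    using assms(1,2)
    by (simp add: sphere_chart_def inner_add_left inner_add_right inner_commute power2_norm_eq_inner
        norm_eq_1 flip: power2_eq_square)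
  then show ?thesis by (simp add: norm_eq_1)
qed

lemma sphere_chart_0 [simp]: "sphere_chart n 0 = n"
  by (simp add: sphere_chart_def)

lemma sphere_chart_has_derivative:
  assumes "norm w < 1"
  shows "(sphere_chart n has_derivative
    (\<lambda>h. h - ((w \<bullet> h) / sqrt (1 - (norm w)\<^sup>2)) *\<^sub>R n)) (at w)"
proof -
  have pos: "1 - w \<bullet> w > 0"
    using assms by (simp add: power2_norm_eq_inner[symmetric] abs_square_less_1)
  have "((\<lambda>w. w + sqrt (1 - w \<bullet> w) *\<^sub>R n) has_derivative
    (\<lambda>h. h - ((w \<bullet> h) / sqrt (1 - w \<bullet> w)) *\<^sub>R n)) (at w)"
    using pos
    by (auto intro!: derivative_eq_intros simp: inner_commute field_simps)
  then show ?thesis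
    by (simp add: sphere_chart_def[abs_def] power2_norm_eq_inner)
qed

lemma sphere_chart_line_has_derivative:
  fixes n w :: "'a::euclidean_space"
  assumes "\<bar>s\<bar> * norm w < 1"
  shows "((\<lambda>s. sphere_chart n (s *\<^sub>R w)) has_derivative
    (\<lambda>h. h *\<^sub>R (w - ((s * (w \<bullet> w)) / sqrt (1 - s\<^sup>2 * (w \<bullet> w))) *\<^sub>R n))) (at s)"
proof -
  have "norm (s *\<^sub>R w) < 1" using assms by simp
  moreover have "((\<lambda>s. s *\<^sub>R w) has_derivative (\<lambda>h. h *\<^sub>R w)) (at s)"
    by (auto intro!: derivative_eq_intros)
  ultimately
  have "((\<lambda>s. sphere_chart n (s *\<^sub>R w)) has_derivative
      (\<lambda>h. h *\<^sub>R w - ((s *\<^sub>R w \<bullet> h *\<^sub>R w) / sqrt (1 - (norm (s *\<^sub>R w))\<^sup>2)) *\<^sub>R n)) (at s)"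
    using has_derivative_compose[where f="\<lambda>s. s *\<^sub>R w"] sphere_chart_has_derivative by blast
  moreover have "(norm (s *\<^sub>R w))\<^sup>2 = s\<^sup>2 * (w \<bullet> w)"
    unfolding power2_norm_eq_inner by (simp add: power2_eq_square)
  ultimately show ?thesis
    by (simp add: scaleR_diff_right mult_ac del: norm_scaleR)
qed

text \<open>A curve on the unit sphere accelerates towards the centre, here by
  \<open>w \<bullet> w\<close>. The same acceleration explains the terms
  \<open>x \<bullet> G x\<close> in the angular Hessian and \<open>n \<bullet> x\<close> in the
  Hessian of the support function.\<close>

lemma sphere_chart_velocity_has_derivative:
  "((\<lambda>s. w - ((s * (w \<bullet> w)) / sqrt (1 - s\<^sup>2 * (w \<bullet> w))) *\<^sub>R n) has_derivative
    (\<lambda>h. h *\<^sub>R (- (w \<bullet> w)) *\<^sub>R n)) (at 0)"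
proof -
  have "((\<lambda>s. (s * (w \<bullet> w)) / sqrt (1 - s\<^sup>2 * (w \<bullet> w))) has_derivative (\<lambda>h. h * (w \<bullet> w))) (at 0)"
    by (auto intro!: derivative_eq_intros)
  from has_derivative_diff[OF has_derivative_const[of w] has_derivative_scaleR_left[OF this]]
  show ?thesis by simp
qed

text \<open>\<open>U\<close> will lie in a hyperplane, where relative derivatives are not unique and
  \<open>frechet_derivative\<close> picks an arbitrary one. A direction along which \<open>U\<close>
  contains a segment around \<open>w\<close> still determines its value.\<close>

lemma frechet_derivative_direction:
  fixes F :: "'a::real_normed_vector \<Rightarrow> 'b::real_normed_vector"
  assumes F: "(F has_derivative D) (at w within U)"
    and \<delta>: "\<delta> > 0" "\<And>s. \<bar>s\<bar> < \<delta> \<Longrightarrow> w + s *\<^sub>R e \<in> U"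
  shows "frechet_derivative F (at w within U) e = D e"
proof -
  let ?D = "frechet_derivative F (at w within U)"
  have D: "(F has_derivative ?D) (at w within U)"
    using F frechet_derivative_works differentiableI by blast
  have line: "((\<lambda>s. F (w + s *\<^sub>R e)) has_derivative (\<lambda>s. D' (s *\<^sub>R e))) (at 0)"
    if "(F has_derivative D') (at w within U)" for D'
  proof -
    define I where "I = {-\<delta><..<\<delta>}"
    have "((\<lambda>s. w + s *\<^sub>R e) has_derivative (\<lambda>s. s *\<^sub>R e)) (at 0 within I)"
      by (auto intro!: derivative_eq_intros)
    moreover have "(F has_derivative D') (at (w + 0 *\<^sub>R e) within (\<lambda>s. w + s *\<^sub>R e) ` I)"
    proof -
      have "(\<lambda>s. w + s *\<^sub>R e) ` I \<subseteq> U"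
        using \<delta>(2) by (force simp: I_def)
      then show ?thesis using has_derivative_subset[OF that] by simp
    qed
    ultimately have "((\<lambda>s. F (w + s *\<^sub>R e)) has_derivative (\<lambda>s. D' (s *\<^sub>R e))) (at 0 within I)"
      by (rule has_derivative_in_compose)
    then show ?thesis using \<delta>(1) at_within_open[of 0 I] by (simp add: I_def)
  qed
  have "(\<lambda>s. ?D (s *\<^sub>R e)) = (\<lambda>s. D (s *\<^sub>R e))"
    by (rule has_derivative_unique[OF line[OF D] line[OF F]])
  then show ?thesis by (metis scaleR_one)
qed

lemma polar_region_iff:
  assumes "0 < R1" "Q \<subseteq> sphere 0 1"
  shows "x \<in> polar_region Q R1 R2 \<longleftrightarrow> R1 \<le> norm x \<and> norm x \<le> R2 \<and> sgn x \<in> Q"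
proof
  assume "x \<in> polar_region Q R1 R2"
  then obtain r \<theta> where x: "x = r *\<^sub>R \<theta>" "R1 \<le> r" "r \<le> R2" "\<theta> \<in> Q"
    by (auto simp: polar_region_def)
  then have "norm \<theta> = 1" "r > 0" using assms by auto
  then show "R1 \<le> norm x \<and> norm x \<le> R2 \<and> sgn x \<in> Q"
    using x by (simp add: sgn_div_norm)
next
  assume x: "R1 \<le> norm x \<and> norm x \<le> R2 \<and> sgn x \<in> Q"
  then have "norm x \<noteq> 0" using assms(1) by linarith
  then have "x = norm x *\<^sub>R sgn x" by (simp add: sgn_div_norm)
  then show "x \<in> polar_region Q R1 R2"
    using x unfolding polar_region_def by blast
qed

lemma interior_polar_region_chart:
  fixes x :: "'a::euclidean_space"
  assumes R: "0 < R1" and Q: "Q \<subseteq> sphere 0 1" and x: "x \<in> interior (polar_region Q R1 R2)"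
  obtains \<delta> where "0 < \<delta>" "\<delta> \<le> 1"
    "\<And>w. w \<bullet> sgn x = 0 \<Longrightarrow> norm w < \<delta> \<Longrightarrow> norm x *\<^sub>R sphere_chart (sgn x) w \<in> interior (polar_region Q R1 R2)"
    "\<And>w. w \<bullet> sgn x = 0 \<Longrightarrow> norm w < \<delta> \<Longrightarrow> sphere_chart (sgn x) w \<in> Q"
proof -
  have x0: "x \<noteq> 0" and nx: "norm (sgn x) = 1"
    using x interior_subset[of "polar_region Q R1 R2"] polar_region_iff[OF R Q] R
    by (auto simp: norm_sgn)
  define h where "h w = norm x *\<^sub>R sphere_chart (sgn x) w" for w
  have "continuous (at 0) h"
    unfolding h_def
    by (intro continuous_intros has_derivative_continuous[OF sphere_chart_has_derivative]) simp
  moreover have "h 0 \<in> interior (polar_region Q R1 R2)"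
    using x x0 by (simp add: h_def sgn_div_norm)
  ultimately obtain d where d: "d > 0" "\<And>w. norm w < d \<Longrightarrow> h w \<in> interior (polar_region Q R1 R2)"
    unfolding continuous_at_open[of 0 h] using open_interior
    by (metis (no_types, lifting) open_contains_ball mem_ball_0 subset_eq)
  have in_Q: "sphere_chart (sgn x) w \<in> Q" if w: "w \<bullet> sgn x = 0" "norm w < min d 1" for w
  proof -
    have "h w \<in> polar_region Q R1 R2" using d(2) w interior_subset by auto
    then have "sgn (h w) \<in> Q" using polar_region_iff[OF R Q] by blast
    moreover have "norm (sphere_chart (sgn x) w) = 1" using sphere_chart_norm[OF nx] w by simp
    ultimately show ?thesis using x0 by (simp add: h_def sgn_div_norm)
  qed
  show ?thesis
    by (rule that[of "min d 1"]) (use d in_Q in \<open>auto simp: h_def\<close>)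
qed

text \<open>Two contributions arise along the sphere of radius \<open>norm x\<close>: the ambient
  Hessian, scaled by the square of the radius, and the radial part of the gradient, which enters on
  the diagonal because the chart bends away from its tangent plane.\<close>

lemma sphere_hessian_entry:
  fixes x :: "'a::euclidean_space"
  assumes R: "0 < R1" and Q: "Q \<subseteq> sphere 0 1" and x: "x \<in> interior (polar_region Q R1 R2)"
    and S: "polar_region Q R1 R2 \<subseteq> S" and f: "C2_data S f G L"
    and ij: "i < DIM('a) - 1" "j < DIM('a) - 1"
  defines "e \<equiv> tangent_frame (sgn x)"
  shows "angular_hessian Q f x $$ (i, j) = (norm x)\<^sup>2 * (L x (e i) \<bullet> e j) - (if i = j then x \<bullet> G x else 0)"
proof -
  define n where "n = sgn x"
  define r where "r = norm x"
  have x0: "x \<noteq> 0" and n: "norm n = 1"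
    using x interior_subset[of "polar_region Q R1 R2"] polar_region_iff[OF R Q] R
    by (auto simp: norm_sgn n_def)
  have rn: "r *\<^sub>R n = x" using x0 by (simp add: r_def n_def sgn_div_norm)
  obtain \<delta> where \<delta>: "0 < \<delta>" "\<delta> \<le> 1"
    "\<And>w. w \<bullet> n = 0 \<Longrightarrow> norm w < \<delta> \<Longrightarrow> r *\<^sub>R sphere_chart n w \<in> interior (polar_region Q R1 R2)"
    "\<And>w. w \<bullet> n = 0 \<Longrightarrow> norm w < \<delta> \<Longrightarrow> sphere_chart n w \<in> Q"
    using interior_polar_region_chart[OF R Q x] unfolding n_def r_def by blast
  have frame: "orthonormal_frame n e"
    using orthonormal_frame_tangent_frame[OF n] by (simp add: e_def n_def)
  have en: "e k \<bullet> n = 0" and e1: "norm (e k) = 1" if "k < DIM('a) - 1" for k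
    using frame that by (auto simp: orthonormal_frame_def norm_eq_1)
  define U where "U = {w. w \<bullet> n = 0 \<and> norm w < 1 \<and> sphere_chart n w \<in> Q}"
  have U: "w \<in> U" if "w \<bullet> n = 0" "norm w < \<delta>" for w
    using that \<delta> by (auto simp: U_def)
  define F where "F w = f (r *\<^sub>R sphere_chart n w)" for w
  define P where "P w = r * (G (r *\<^sub>R sphere_chart n w) \<bullet> (e j - ((w \<bullet> e j) / sqrt (1 - (norm w)\<^sup>2)) *\<^sub>R n))" for w
  have fG: "(f has_derivative (\<lambda>h. G y \<bullet> h)) (at y)" "(G has_derivative L y) (at y)"
    if "y \<in> interior (polar_region Q R1 R2)" for y
    using C2_data_at[OF f] interior_mono[OF S] that by blast+
  have line: "w + s *\<^sub>R e k \<in> U"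
    if "w \<bullet> n = 0" "norm w < \<delta>" "\<bar>s\<bar> < \<delta> - norm w" "k < DIM('a) - 1" for w s k
  proof (rule U)
    show "(w + s *\<^sub>R e k) \<bullet> n = 0" using that en by (simp add: inner_add_left)
    show "norm (w + s *\<^sub>R e k) < \<delta>"
      using norm_triangle_ineq[of w "s *\<^sub>R e k"] that e1 by simp
  qed
  have inner: "frechet_derivative F (at w within U) (e j) = P w" if w: "w \<bullet> n = 0" "norm w < \<delta>" for w
  proof -
    have "((\<lambda>w. r *\<^sub>R sphere_chart n w) has_derivative
        (\<lambda>h. r *\<^sub>R (h - ((w \<bullet> h) / sqrt (1 - (norm w)\<^sup>2)) *\<^sub>R n))) (at w within U)"
      using w \<delta> by (intro has_derivative_scaleR_right has_derivative_at_withinI[OF sphere_chart_has_derivative]) auto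
    from has_derivative_compose[OF this fG(1)[OF \<delta>(3)[OF w]]]
    have "(F has_derivative (\<lambda>h. G (r *\<^sub>R sphere_chart n w) \<bullet>
        (r *\<^sub>R (h - ((w \<bullet> h) / sqrt (1 - (norm w)\<^sup>2)) *\<^sub>R n)))) (at w within U)"
      by (simp add: F_def[abs_def])
    from frechet_derivative_direction[OF this, of "\<delta> - norm w" "e j"] show ?thesis
      using line[OF w _ ij(2)] w by (simp add: P_def)
  qed
  have P: "(P has_derivative (\<lambda>h. r * (L x (r *\<^sub>R h) \<bullet> e j - (h \<bullet> e j) * (G x \<bullet> n)))) (at 0)"
  proof -
    have chart: "((\<lambda>w. r *\<^sub>R sphere_chart n w) has_derivative (\<lambda>h. r *\<^sub>R h)) (at 0)"
      using has_derivative_scaleR_right[OF sphere_chart_has_derivative[of 0 n], of r] by simp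
    have x': "r *\<^sub>R sphere_chart n 0 \<in> interior (polar_region Q R1 R2)"
      using x rn by simp
    have GL: "((\<lambda>w. G (r *\<^sub>R sphere_chart n w)) has_derivative (\<lambda>h. L x (r *\<^sub>R h))) (at 0)"
      using has_derivative_compose[OF chart fG(2)[OF x']] rn by simp
    have q: "((\<lambda>w. (w \<bullet> e j) / sqrt (1 - w \<bullet> w)) has_derivative (\<lambda>h. h \<bullet> e j)) (at 0)"
      by (auto intro!: derivative_eq_intros)
    have "((\<lambda>w. e j - ((w \<bullet> e j) / sqrt (1 - w \<bullet> w)) *\<^sub>R n) has_derivative (\<lambda>h. - ((h \<bullet> e j) *\<^sub>R n))) (at 0)"
      using has_derivative_diff[OF has_derivative_const[of "e j"] has_derivative_scaleR_left[OF q]] by simp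
    from has_derivative_mult_right[OF has_derivative_inner[OF GL this], of r]
    show ?thesis
      using rn by (simp add: P_def[abs_def] power2_norm_eq_inner algebra_simps)
  qed
  \<comment> \<open>The inner derivative is known to equal \<open>P\<close> only for base points
    \<open>w\<close> in the hyperplane near 0, hence the passage to a derivative relative to
    \<open>U\<close>.\<close>
  have "((\<lambda>w. frechet_derivative F (at w within U) (e j)) has_derivative
      (\<lambda>h. r * (L x (r *\<^sub>R h) \<bullet> e j - (h \<bullet> e j) * (G x \<bullet> n)))) (at 0 within U)"
  proof (rule has_derivative_transform_within[OF has_derivative_at_withinI[OF P] \<delta>(1)])
    show "0 \<in> U" using U \<delta>(1) by simp
    fix w assume "w \<in> U" "dist w 0 < \<delta>"
    then show "P w = frechet_derivative F (at w within U) (e j)"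
      using inner by (auto simp: U_def)
  qed
  from frechet_derivative_direction[OF this \<delta>(1), of "e i"]
  have "frechet_derivative (\<lambda>w. frechet_derivative F (at w within U) (e j)) (at 0 within U) (e i)
      = r * (L x (r *\<^sub>R e i) \<bullet> e j - (e i \<bullet> e j) * (G x \<bullet> n))"
    using line[of 0 _ i] ij \<delta>(1) by simp
  also have "\<dots> = r\<^sup>2 * (L x (e i) \<bullet> e j) - (if i = j then x \<bullet> G x else 0)"
  proof -
    have "linear (L x)" using C2_dataD(4)[OF f] S x interior_subset by blast
    moreover have "r * (G x \<bullet> n) = x \<bullet> G x" using rn by (metis inner_commute inner_scaleR_right)
    moreover have "e i \<bullet> e j = (if i = j then 1 else 0)" using frame ij by (simp add: orthonormal_frame_def)
    ultimately show ?thesis by (simp add: linear_scale power2_eq_square algebra_simps)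
  qed
  finally show ?thesis
    using ij by (simp add: angular_hessian_def sphere_hessian_def Let_def F_def[abs_def] U_def n_def r_def e_def)
qed

lemma radial_deriv_interior:
  fixes x :: "'a::euclidean_space"
  assumes R: "0 < R1" and Q: "Q \<subseteq> sphere 0 1" and x: "x \<in> interior (polar_region Q R1 R2)"
    and S: "polar_region Q R1 R2 \<subseteq> S" and f: "C2_data S f G L" and R12: "R1 < R2"
  shows "radial_deriv R1 R2 f x = G x \<bullet> sgn x"
proof -
  have xR: "x \<in> polar_region Q R1 R2" using x interior_subset by blast
  then have x0: "x \<noteq> 0" and nx: "R1 \<le> norm x" "norm x \<le> R2"
    using R polar_region_iff[OF R Q] by auto
  have "((\<lambda>r. r *\<^sub>R sgn x) has_derivative (\<lambda>h. h *\<^sub>R sgn x)) (at (norm x))"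
    by (auto intro!: derivative_eq_intros)
  moreover have "(f has_derivative (\<lambda>h. G x \<bullet> h)) (at (norm x *\<^sub>R sgn x))"
    using C2_data_at[OF f] interior_mono[OF S] x x0 by (auto simp: sgn_div_norm)
  ultimately have "((\<lambda>r. f (r *\<^sub>R sgn x)) has_derivative (\<lambda>h. G x \<bullet> (h *\<^sub>R sgn x))) (at (norm x))"
    by (rule has_derivative_compose)
  then have "((\<lambda>r. f (r *\<^sub>R sgn x)) has_vector_derivative (G x \<bullet> sgn x)) (at (norm x))"
    by (simp add: has_vector_derivative_def)
  then show ?thesis
    unfolding radial_deriv_def using vector_derivative_at_within_ivl[OF _ nx R12] by blast
qed

section \<open>The Jacobian of the map of homogeneous gradients\<close>

lemma continuous_on_ldet:
  fixes g :: "'b::topological_space \<Rightarrow> 'a::euclidean_space \<Rightarrow> 'a"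
  assumes "\<And>h. continuous_on S (\<lambda>x. g x h)"
  shows "continuous_on S (\<lambda>x. ldet (g x))"
  unfolding ldet_def Determinants.det_def matrix_def to_cart_def
  using assms by (auto intro!: continuous_intros)

lemma continuous_on_linear_family:
  fixes A :: "'b::topological_space \<Rightarrow> 'a::euclidean_space \<Rightarrow> 'c::real_normed_vector"
  assumes A: "\<And>h. continuous_on S (\<lambda>x. A x h)" and lin: "\<And>x. x \<in> S \<Longrightarrow> linear (A x)"
    and u: "continuous_on S u"
  shows "continuous_on S (\<lambda>x. A x (u x))"
proof -
  have "A x (u x) = (\<Sum>b\<in>Basis. (u x \<bullet> b) *\<^sub>R A x b)" if "x \<in> S" for x
  proof -
    have "A x (u x) = A x (\<Sum>b\<in>Basis. (u x \<bullet> b) *\<^sub>R b)" by (simp add: euclidean_representation)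
    then show ?thesis using lin[OF that] by (simp add: linear_sum linear_scale)
  qed
  moreover have "continuous_on S (\<lambda>x. \<Sum>b\<in>Basis. (u x \<bullet> b) *\<^sub>R A x b)"
    by (intro continuous_intros A u)
  ultimately show ?thesis by (simp cong: continuous_on_cong)
qed

text \<open>The map \<Psi> of the overview. Its component along \<open>sgn x\<close> is
  \<open>f x\<close> and its tangential part is \<open>norm x\<close> times that of
  \<open>G x\<close>: these are the data of a linear function touching \<open>f\<close> on the
  sphere through \<open>x\<close>.\<close>

definition polar_map :: "('a::euclidean_space \<Rightarrow> real) \<Rightarrow> ('a \<Rightarrow> 'a) \<Rightarrow> 'a \<Rightarrow> 'a" where
  "polar_map f G x = (f x - x \<bullet> G x) *\<^sub>R sgn x + norm x *\<^sub>R G x"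

definition polar_map_deriv ::
    "('a::euclidean_space \<Rightarrow> real) \<Rightarrow> ('a \<Rightarrow> 'a) \<Rightarrow> ('a \<Rightarrow> 'a \<Rightarrow> 'a) \<Rightarrow> 'a \<Rightarrow> 'a \<Rightarrow> 'a" where
  "polar_map_deriv f G L x h =
     (- (x \<bullet> L x h)) *\<^sub>R sgn x
     + (f x - x \<bullet> G x) *\<^sub>R ((h - (sgn x \<bullet> h) *\<^sub>R sgn x) /\<^sub>R norm x)
     + (sgn x \<bullet> h) *\<^sub>R G x + norm x *\<^sub>R L x h"

lemma polar_map_has_derivative:
  assumes f: "(f has_derivative (\<lambda>h. G x \<bullet> h)) (at x)" and G: "(G has_derivative L x) (at x)"
    and x: "x \<noteq> 0"
  shows "(polar_map f G has_derivative polar_map_deriv f G L x) (at x)"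
proof -
  have a: "((\<lambda>x. f x - x \<bullet> G x) has_derivative (\<lambda>h. G x \<bullet> h - (x \<bullet> L x h + h \<bullet> G x))) (at x)"
    by (intro has_derivative_diff f has_derivative_inner has_derivative_ident G)
  \<comment> \<open>Differentiating \<open>x \<bullet> G x\<close> produces
    \<open>h \<bullet> G x\<close>, which cancels the derivative of \<open>f\<close>; only second
    derivatives survive, as for a Legendre transform.\<close>
  have b: "((\<lambda>x. f x - x \<bullet> G x) has_derivative (\<lambda>h. - (x \<bullet> L x h))) (at x)"
    using a by (simp add: inner_commute)
  show ?thesis
    unfolding polar_map_def[abs_def] polar_map_deriv_def[abs_def]
    by (rule has_derivative_eq_rhs[OF has_derivative_add[OF
          has_derivative_scaleR[OF b sgn_has_derivative[OF x]]
          has_derivative_scaleR[OF norm_has_derivative[OF x] G]]])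
       (simp add: fun_eq_iff algebra_simps)
qed

lemma continuous_on_polar_map_deriv:
  assumes f: "C2_data S f G L" and S: "0 \<notin> S"
  shows "continuous_on S (\<lambda>x. polar_map_deriv f G L x h)"
proof -
  have sg: "continuous_on S sgn"
    using S by (intro continuous_on_sgn continuous_on_id) auto
  show ?thesis
    unfolding polar_map_deriv_def
    using S by (intro continuous_intros C2_data_continuous[OF f] C2_dataD(3)[OF f] sg) auto
qed

lemma inner_sgn_self: "x \<bullet> v = norm x * (sgn x \<bullet> v)"
  by (cases "x = 0") (auto simp: sgn_div_norm)

lemma inner_sgn_sgn: "x \<noteq> 0 \<Longrightarrow> sgn x \<bullet> sgn x = 1"
  by (simp add: norm_sgn flip: power2_norm_eq_inner)

text \<open>The radial contributions \<open>- (x \<bullet> L x h)\<close> and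
  \<open>norm x * (sgn x \<bullet> L x h)\<close> cancel. This is the vanishing row that
  \<open>ldet_block\<close> asks for.\<close>

lemma polar_map_deriv_tangent:
  assumes "sgn x \<bullet> h = 0"
  shows "sgn x \<bullet> polar_map_deriv f G L x h = 0"
  using assms
  by (cases "x = 0")
     (auto simp: polar_map_deriv_def inner_add_right inner_diff_right inner_sgn_self[of x "L x h"] inner_sgn_sgn)

lemma polar_map_deriv_radial:
  assumes "x \<noteq> 0"
  shows "sgn x \<bullet> polar_map_deriv f G L x (sgn x) = G x \<bullet> sgn x"
  using assms
  by (simp add: polar_map_deriv_def inner_add_right inner_diff_right inner_sgn_self[of x "L x (sgn x)"]
      inner_sgn_sgn inner_commute[of "G x"])

lemma det_frame_smult:
  "Determinant.det (Matrix.mat d d (\<lambda>(i, j). (c::real) * a i j)) = c ^ d * Determinant.det (Matrix.mat d d (\<lambda>(i, j). a i j))"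
proof -
  have "Matrix.mat d d (\<lambda>(i, j). c * a i j) = c \<cdot>\<^sub>m Matrix.mat d d (\<lambda>(i, j). a i j)"
    by (intro eq_matI) auto
  then show ?thesis by (simp add: det_smult)
qed

lemma angular_matrix_interior:
  fixes x :: "'a::euclidean_space"
  assumes R: "0 < R1" and Q: "Q \<subseteq> sphere 0 1" and x: "x \<in> interior (polar_region Q R1 R2)"
    and S: "polar_region Q R1 R2 \<subseteq> S" and f: "C2_data S f G L"
  defines "e \<equiv> tangent_frame (sgn x)"
  shows "angular_matrix Q f x = Matrix.mat (DIM('a) - 1) (DIM('a) - 1)
    (\<lambda>(i, j). (f x - x \<bullet> G x) * (if i = j then 1 else 0) + (norm x)\<^sup>2 * (L x (e i) \<bullet> e j))"
proof -
  have "angular_hessian Q f x \<in> carrier_mat (DIM('a) - 1) (DIM('a) - 1)"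
    by (simp add: angular_hessian_def sphere_hessian_def Let_def)
  then show ?thesis
    using sphere_hessian_entry[OF R Q x S f]
    by (intro eq_matI) (auto simp: angular_matrix_def e_def)
qed

lemma ldet_polar_map:
  fixes x :: "'a::euclidean_space"
  assumes R: "0 < R1" and Q: "Q \<subseteq> sphere 0 1" and x: "x \<in> interior (polar_region Q R1 R2)"
    and S: "polar_region Q R1 R2 \<subseteq> S" and f: "C2_data S f G L" and R12: "R1 < R2"
  shows "ldet (polar_map_deriv f G L x)
    = radial_deriv R1 R2 f x * Determinant.det (angular_matrix Q f x) / norm x ^ (DIM('a) - 1)"
proof -
  let ?d = "DIM('a) - 1"
  define n where "n = sgn x"
  define e where "e = tangent_frame n"
  have x0: "x \<noteq> 0" and n: "norm n = 1"
    using x interior_subset[of "polar_region Q R1 R2"] polar_region_iff[OF R Q] R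
    by (auto simp: norm_sgn n_def)
  have frame: "orthonormal_frame n e"
    using orthonormal_frame_tangent_frame[OF n] by (simp add: e_def)
  have xS: "x \<in> interior S" using x interior_mono[OF S] by blast
  have der: "(polar_map f G has_derivative polar_map_deriv f G L x) (at x)"
    using C2_data_at[OF f xS] x0 by (intro polar_map_has_derivative)
  then have lin: "linear (polar_map_deriv f G L x)" by (rule has_derivative_linear)
  have en: "n \<bullet> e j = 0" if "j < ?d" for j
    using frame that by (auto simp: orthonormal_frame_def inner_commute)
  \<comment> \<open>Each tangential entry of the Jacobian is an entry of the angular matrix divided
    by \<open>norm x\<close>; the \<open>DIM('a) - 1\<close> factors give the power of the radius in
    the denominator.\<close>
  have entry: "norm x * (e i \<bullet> polar_map_deriv f G L x (e j))
      = (f x - x \<bullet> G x) * (if i = j then 1 else 0) + (norm x)\<^sup>2 * (L x (e i) \<bullet> e j)"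
    if ij: "i < ?d" "j < ?d" for i j
  proof -
    have "e i \<bullet> L x (e j) = L x (e i) \<bullet> e j"
      using C2_data_symmetric[OF f xS] by (simp add: inner_commute)
    moreover have "e i \<bullet> e j = (if i = j then 1 else 0)"
      using frame ij by (simp add: orthonormal_frame_def)
    moreover have "e i \<bullet> sgn x = 0" "sgn x \<bullet> e j = 0" using en ij by (auto simp: n_def inner_commute)
    ultimately show ?thesis
      using x0 by (auto simp: polar_map_deriv_def inner_add_right inner_diff_right power2_eq_square field_simps)
  qed
  have "angular_matrix Q f x = Matrix.mat ?d ?d (\<lambda>(i, j). norm x * (e i \<bullet> polar_map_deriv f G L x (e j)))"
    unfolding angular_matrix_interior[OF R Q x S f]
    by (intro eq_matI) (auto simp: entry simp flip: e_def n_def)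
  then have det: "Determinant.det (angular_matrix Q f x)
      = norm x ^ ?d * Determinant.det (frame_mat ?d e (polar_map_deriv f G L x))"
    by (simp add: det_frame_smult frame_mat_def)
  have "ldet (polar_map_deriv f G L x)
      = (n \<bullet> polar_map_deriv f G L x n) * Determinant.det (frame_mat ?d e (polar_map_deriv f G L x))"
  proof (rule ldet_block[OF lin n frame])
    show "n \<bullet> polar_map_deriv f G L x (e j) = 0" if "j < ?d" for j
      using polar_map_deriv_tangent[of x "e j"] en[OF that] by (simp add: n_def)
  qed
  then show ?thesis
    using x0 polar_map_deriv_radial[OF x0, of f G L] radial_deriv_interior[OF R Q x S f R12]
    by (simp add: det n_def)
qed

lemma quadratic_form_frame:
  fixes A :: "'a::euclidean_space \<Rightarrow> 'a"
  assumes lin: "linear A" and e: "orthonormal_frame n e"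
  shows "(\<Sum>i<DIM('a)-1. \<Sum>j<DIM('a)-1. (a * (if i = j then 1 else 0) + b * (A (e i) \<bullet> e j)) * c i * c j)
    = a * (norm (\<Sum>i<DIM('a)-1. c i *\<^sub>R e i))\<^sup>2
      + b * (A (\<Sum>i<DIM('a)-1. c i *\<^sub>R e i) \<bullet> (\<Sum>i<DIM('a)-1. c i *\<^sub>R e i))"
proof -
  have "(a * (if i = j then 1 else 0) + b * (A (e i) \<bullet> e j)) * c i * c j
      = a * ((c i *\<^sub>R e i) \<bullet> (c j *\<^sub>R e j)) + b * ((c i *\<^sub>R A (e i)) \<bullet> (c j *\<^sub>R e j))"
    if "i < DIM('a) - 1" "j < DIM('a) - 1" for i j
    using e that by (simp add: orthonormal_frame_def algebra_simps)
  then have "(\<Sum>i<DIM('a)-1. \<Sum>j<DIM('a)-1. (a * (if i = j then 1 else 0) + b * (A (e i) \<bullet> e j)) * c i * c j)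
    = (\<Sum>i<DIM('a)-1. \<Sum>j<DIM('a)-1. a * ((c i *\<^sub>R e i) \<bullet> (c j *\<^sub>R e j)) + b * ((c i *\<^sub>R A (e i)) \<bullet> (c j *\<^sub>R e j)))"
    by (intro sum.cong) auto
  also have "\<dots> = a * ((\<Sum>i<DIM('a)-1. c i *\<^sub>R e i) \<bullet> (\<Sum>i<DIM('a)-1. c i *\<^sub>R e i))
      + b * ((\<Sum>i<DIM('a)-1. c i *\<^sub>R A (e i)) \<bullet> (\<Sum>i<DIM('a)-1. c i *\<^sub>R e i))"
    unfolding inner_sum_left unfolding inner_sum_right by (simp add: sum.distrib sum_distrib_left)
  also have "(\<Sum>i<DIM('a)-1. c i *\<^sub>R A (e i)) = A (\<Sum>i<DIM('a)-1. c i *\<^sub>R e i)"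
    by (simp add: linear_sum[OF lin] linear_scale[OF lin])
  finally show ?thesis by (simp add: power2_norm_eq_inner)
qed

text \<open>The sign condition on the angular matrix without a frame. Entries in
  \<open>tangent_frame\<close> depend on an arbitrary choice at each point; this form depends
  visibly continuously on \<open>x\<close> and so leads to Borel sets.\<close>

definition tangentially_nonpos ::
    "('a::euclidean_space \<Rightarrow> real) \<Rightarrow> ('a \<Rightarrow> 'a) \<Rightarrow> ('a \<Rightarrow> 'a \<Rightarrow> 'a) \<Rightarrow> 'a \<Rightarrow> bool" where
  "tangentially_nonpos f G L x \<longleftrightarrow>
    (\<forall>w. w \<bullet> sgn x = 0 \<longrightarrow> (f x - x \<bullet> G x) * (norm w)\<^sup>2 + (norm x)\<^sup>2 * (L x w \<bullet> w) \<le> 0)"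

lemma nonpos_angular_matrix_iff:
  fixes x :: "'a::euclidean_space"
  assumes R: "0 < R1" and Q: "Q \<subseteq> sphere 0 1" and x: "x \<in> interior (polar_region Q R1 R2)"
    and S: "polar_region Q R1 R2 \<subseteq> S" and f: "C2_data S f G L"
  shows "nonpos_quadratic_form (angular_matrix Q f x) \<longleftrightarrow> tangentially_nonpos f G L x"
proof -
  let ?d = "DIM('a) - 1"
  define e where "e = tangent_frame (sgn x)"
  have n: "norm (sgn x) = 1" and xS: "x \<in> S"
    using x interior_subset[of "polar_region Q R1 R2"] polar_region_iff[OF R Q] R S
    by (auto simp: norm_sgn)
  have frame: "orthonormal_frame (sgn x) e"
    using orthonormal_frame_tangent_frame[OF n] by (simp add: e_def)
  have lin: "linear (L x)" using C2_dataD(4)[OF f xS] .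
  let ?q = "\<lambda>w. (f x - x \<bullet> G x) * (norm w)\<^sup>2 + (norm x)\<^sup>2 * (L x w \<bullet> w)"
  have "nonpos_quadratic_form (angular_matrix Q f x) \<longleftrightarrow> (\<forall>c. ?q (\<Sum>i<?d. c i *\<^sub>R e i) \<le> 0)"
    unfolding nonpos_quadratic_form_def angular_matrix_interior[OF R Q x S f]
      quadratic_form_frame[OF lin frame, symmetric]
    by (simp add: e_def)
  also have "\<dots> \<longleftrightarrow> (\<forall>w. w \<bullet> sgn x = 0 \<longrightarrow> ?q w \<le> 0)"
  proof (intro iffI allI impI)
    fix w assume q: "\<forall>c. ?q (\<Sum>i<?d. c i *\<^sub>R e i) \<le> 0" and w: "w \<bullet> sgn x = 0"
    show "?q w \<le> 0"
      using q[rule_format, of "\<lambda>i. w \<bullet> e i"] unfolding orthonormal_frame_expand[OF n frame w] .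
  next
    fix c assume "\<forall>w. w \<bullet> sgn x = 0 \<longrightarrow> ?q w \<le> 0"
    moreover have "(\<Sum>i<?d. c i *\<^sub>R e i) \<bullet> sgn x = 0"
      using frame by (simp add: inner_sum_left orthonormal_frame_def)
    ultimately show "?q (\<Sum>i<?d. c i *\<^sub>R e i) \<le> 0" by blast
  qed
  finally show ?thesis by (simp add: tangentially_nonpos_def)
qed

subsection \<open>The parabolic estimate\<close>

text \<open>A positive \<open>D\<close> would make \<open>\<phi>'\<close> positive just to the right
  of 0 and let \<open>\<phi>\<close> exceed its maximum there.\<close>

lemma local_max_second_derivative:
  fixes \<phi> \<phi>' :: "real \<Rightarrow> real"
  assumes \<delta>: "\<delta> > 0"
    and d1: "\<And>s. \<bar>s\<bar> < \<delta> \<Longrightarrow> (\<phi> has_real_derivative \<phi>' s) (at s)"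
    and d2: "(\<phi>' has_real_derivative D) (at 0)"
    and max: "\<And>s. \<bar>s\<bar> < \<delta> \<Longrightarrow> \<phi> s \<le> \<phi> 0"
  shows "\<phi>' 0 = 0" "D \<le> 0"
proof -
  show z: "\<phi>' 0 = 0"
    using DERIV_local_max[OF d1[of 0] \<delta>] max \<delta> by auto
  show "D \<le> 0"
  proof (rule ccontr)
    assume "\<not> D \<le> 0"
    then obtain d where d: "d > 0" "\<And>h. h > 0 \<Longrightarrow> h < d \<Longrightarrow> \<phi>' 0 < \<phi>' (0 + h)"
      using DERIV_pos_inc_right[OF d2] by auto
    define s where "s = min d \<delta> / 2"
    have s: "s > 0" "s < d" "s < \<delta>" using d \<delta> by (auto simp: s_def)
    obtain t where t: "0 < t" "t < s" "\<phi> s - \<phi> 0 = (s - 0) * \<phi>' t"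
      using MVT2[of 0 s \<phi> \<phi>'] d1 s by (metis abs_of_nonneg order.strict_trans1)
    have "\<phi>' t > 0" using d(2)[of t] t s z by simp
    then have "\<phi> s > \<phi> 0" using t s by (metis diff_gt_0_iff_gt diff_zero mult_pos_pos)
    then show False using max[of s] s by simp
  qed
qed

lemma closed_sphere_frontier:
  fixes Q :: "'a::euclidean_space set"
  assumes "Q \<subseteq> sphere 0 1"
  shows "Q \<union> sphere_frontier Q = closure Q"
    and "\<And>\<theta>. \<theta> \<in> closure Q \<Longrightarrow> \<theta> \<notin> sphere_frontier Q \<Longrightarrow> \<exists>U. open U \<and> \<theta> \<in> U \<and> U \<inter> sphere 0 1 \<subseteq> Q"
proof -
  have sub: "closure Q \<subseteq> sphere 0 1"
    using assms by (simp add: closure_minimal)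
  have cl: "top_of_set (sphere 0 1) closure_of Q = closure Q"
    using sub assms by (auto simp: closure_of_subtopology Int_absorb1)
  have "top_of_set (sphere 0 1) interior_of Q \<subseteq> Q"
    by (rule interior_of_subset)
  then show "Q \<union> sphere_frontier Q = closure Q"
    using closure_subset[of Q] by (auto simp: sphere_frontier_def frontier_of_def cl)
  fix \<theta> assume "\<theta> \<in> closure Q" "\<theta> \<notin> sphere_frontier Q"
  then have "\<theta> \<in> top_of_set (sphere 0 1) interior_of Q"
    by (auto simp: sphere_frontier_def frontier_of_def cl)
  then obtain T where "openin (top_of_set (sphere 0 1)) T" "\<theta> \<in> T" "T \<subseteq> Q"
    by (auto simp: interior_of_def)
  then show "\<exists>U. open U \<and> \<theta> \<in> U \<and> U \<inter> sphere 0 1 \<subseteq> Q"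
    by (auto simp: openin_open)
qed

lemma compact_polar_region:
  assumes "compact Q"
  shows "compact (polar_region Q R1 R2)"
proof -
  have "polar_region Q R1 R2 = (\<lambda>(r, \<theta>). r *\<^sub>R \<theta>) ` ({R1..R2} \<times> Q)"
    by (auto simp: polar_region_def) blast
  moreover have "compact \<dots>"
    by (intro compact_continuous_image compact_Times assms)
       (auto simp: case_prod_unfold intro!: continuous_intros)
  ultimately show ?thesis by simp
qed

lemma polar_region_Un_parabolic_boundary:
  fixes Q :: "'a::euclidean_space set"
  assumes Q: "Q \<subseteq> sphere 0 1" and R: "R1 < R2"
  shows "polar_region Q R1 R2 \<union> parabolic_boundary Q R1 R2 = polar_region (closure Q) R1 R2"
proof -
  have "polar_region Q R2 R2 \<subseteq> polar_region Q R1 R2"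
    using R by (fastforce simp: polar_region_def)
  moreover have "polar_region (closure Q) R1 R2 = polar_region Q R1 R2 \<union> polar_region (sphere_frontier Q) R1 R2"
    unfolding closed_sphere_frontier(1)[OF Q, symmetric] by (auto simp: polar_region_def)
  ultimately show ?thesis by (auto simp: parabolic_boundary_def)
qed

lemma interior_polar_regionI:
  fixes x :: "'a::euclidean_space"
  assumes R: "0 < R1" and Q: "Q \<subseteq> sphere 0 1"
    and x: "R1 < norm x" "norm x < R2" "sgn x \<in> closure Q" "sgn x \<notin> sphere_frontier Q"
  shows "x \<in> interior (polar_region Q R1 R2)"
proof -
  obtain U where U: "open U" "sgn x \<in> U" "U \<inter> sphere 0 1 \<subseteq> Q"
    using closed_sphere_frontier(2)[OF Q x(3,4)] by blast
  define V where "V = {x \<in> - {0}. sgn x \<in> U} \<inter> {x. R1 < norm x} \<inter> {x. norm x < R2}"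
  have "open {x \<in> - {0 :: 'a}. sgn x \<in> U}"
    using U(1) continuous_open_preimage[of "- {0}" "sgn :: 'a \<Rightarrow> 'a" U]
    by (simp add: continuous_on_sgn Int_def vimage_def open_Compl)
  then have "open V"
    unfolding V_def by (intro open_Int open_Collect_less continuous_intros)
  moreover have "V \<subseteq> polar_region Q R1 R2"
    using U(3) polar_region_iff[OF R Q] by (auto simp: V_def norm_sgn)
  moreover have "x \<in> V" using U x R by (auto simp: V_def)
  ultimately show ?thesis by (metis interiorI)
qed

text \<open>The lower bound on \<open>q\<close> keeps the contact off the outer and lateral
  boundary; the strict inequality at \<open>x0\<close> keeps it off the inner face, where
  \<open>f\<close> is not controlled. At the contact point \<open>f x - q \<bullet> sgn x\<close> is
  maximal among all points of the sector at the same or a larger radius.\<close>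

lemma touching_point:
  fixes f :: "'a::euclidean_space \<Rightarrow> real" and q :: 'a
  assumes R: "0 < R1" "R1 < R2" and Q: "Q \<subseteq> sphere 0 1"
    and f: "C2_data (polar_region (closure Q) R1 R2) f G L"
    and m: "\<And>x. x \<in> parabolic_boundary Q R1 R2 \<Longrightarrow> f x \<le> m"
    and x0: "x0 \<in> polar_region (closure Q) R1 R2" "q \<bullet> sgn x0 < f x0"
    and q: "\<And>\<theta>. \<theta> \<in> closure Q \<Longrightarrow> m < q \<bullet> \<theta>"
  obtains x where "x \<in> interior (polar_region Q R1 R2)" "polar_map f G x = q" "G x \<bullet> sgn x \<le> 0"
    "tangentially_nonpos f G L x"
proof -
  define S where "S = polar_region (closure Q) R1 R2"
  have cQ: "closure Q \<subseteq> sphere 0 1" using Q by (simp add: closure_minimal)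
  have S_iff: "x \<in> S \<longleftrightarrow> R1 \<le> norm x \<and> norm x \<le> R2 \<and> sgn x \<in> closure Q" for x
    unfolding S_def by (rule polar_region_iff[OF R(1) cQ])
  have pb_iff: "x \<in> parabolic_boundary Q R1 R2"
    if "x \<in> S" "norm x = R2 \<or> sgn x \<in> sphere_frontier Q" for x
  proof -
    have "sphere_frontier Q \<subseteq> sphere 0 1" using closed_sphere_frontier(1)[OF Q] cQ by blast
    then show ?thesis
      using that S_iff closed_sphere_frontier(1)[OF Q] R polar_region_iff[of R2 Q x R2]
        polar_region_iff[of R1 "sphere_frontier Q" x R2] polar_region_iff[of R1 Q x R2] Q
      by (auto simp: parabolic_boundary_def)
  qed
  have compact_S: "compact S"
    unfolding S_def using cQ compact_polar_region
    by (metis bounded_closure bounded_sphere bounded_subset Q compact_eq_bounded_closed closed_closure)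
  have S0: "0 \<notin> S" using R S_iff by auto
  have cf: "continuous_on S f" using C2_data_continuous[OF f] by (simp add: S_def)
  have csgn: "continuous_on S sgn" using S0 by (intro continuous_on_sgn continuous_on_id) auto
  define T where "T = {x \<in> S. q \<bullet> sgn x \<le> f x}"
  have "closed T"
    unfolding T_def using compact_S
    by (intro continuous_on_closed_Collect_le continuous_intros csgn cf compact_imp_closed)
  moreover have "T = S \<inter> T" by (auto simp: T_def)
  ultimately have "compact T" using compact_S compact_Int_closed by metis
  moreover have "T \<noteq> {}" using x0 by (auto simp: T_def S_def)
  ultimately obtain x where x: "x \<in> T" "\<And>y. y \<in> T \<Longrightarrow> norm y \<le> norm x"
    using continuous_attains_sup[of T norm] continuous_on_norm_id by blast
  have inside: "norm y < R2" "sgn y \<notin> sphere_frontier Q" if "y \<in> T" for y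
  proof -
    have "m < f y" using that q[of "sgn y"] S_iff by (auto simp: T_def)
    then have "y \<notin> parabolic_boundary Q R1 R2" using m[of y] by auto
    then have "\<not> (norm y = R2 \<or> sgn y \<in> sphere_frontier Q)"
      using pb_iff that by (auto simp: T_def)
    then show "norm y < R2" "sgn y \<notin> sphere_frontier Q" using that S_iff by (auto simp: T_def)
  qed
  \<comment> \<open>A strict excess on the last sphere would persist slightly further out on the
    same ray, along which \<open>q \<bullet> sgn y\<close> is constant.\<close>
  have le: "f y \<le> q \<bullet> sgn y" if y: "y \<in> S" "norm y \<ge> norm x" for y
  proof (rule ccontr)
    assume less: "\<not> f y \<le> q \<bullet> sgn y"
    then have yT: "y \<in> T" using y by (simp add: T_def)
    then have ny: "norm y = norm x" using x y by (meson order_antisym)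
    have y0: "y \<noteq> 0" using S0 y by auto
    have yR: "norm y < R2" using inside[OF yT] by simp
    define \<gamma> where "\<gamma> t = t *\<^sub>R sgn y" for t
    have \<gamma>: "norm (\<gamma> t) = t" "sgn (\<gamma> t) = sgn y" if "t > 0" for t
      using that y0 by (auto simp: \<gamma>_def sgn_div_norm field_simps)
    have \<gamma>S: "\<gamma> ` {norm y..R2} \<subseteq> S"
    proof
      fix z assume "z \<in> \<gamma> ` {norm y..R2}"
      then obtain t where t: "z = \<gamma> t" "norm y \<le> t" "t \<le> R2" by auto
      moreover have "t > 0" using t y0 by (metis less_le_trans zero_less_norm_iff)
      ultimately show "z \<in> S" using \<gamma>[of t] y S_iff by auto
    qed
    have "continuous_on {norm y..R2} (\<lambda>t. f (\<gamma> t))"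
      by (rule continuous_on_compose2[OF cf _ \<gamma>S]) (auto simp: \<gamma>_def intro!: continuous_intros)
    then have "continuous (at (norm y) within {norm y..R2}) (\<lambda>t. f (\<gamma> t))"
      using yR by (simp add: continuous_on_eq_continuous_within)
    then have lim: "((\<lambda>t. f (\<gamma> t)) \<longlongrightarrow> f y) (at (norm y) within {norm y..R2})"
      using y0 by (simp add: continuous_within \<gamma>_def sgn_div_norm)
    have ev1: "eventually (\<lambda>t. q \<bullet> sgn y < f (\<gamma> t)) (at (norm y) within {norm y..R2})"
      using order_tendstoD(1)[OF lim] less by simp
    have ev2: "eventually (\<lambda>t. t \<in> {norm y<..R2}) (at (norm y) within {norm y..R2})"
      by (auto simp: eventually_at intro!: exI[of _ 1])
    have "at (norm y) within {norm y..R2} \<noteq> bot"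
      using yR by (simp add: trivial_limit_within)
    from eventually_happens'[OF this eventually_conj[OF ev1 ev2]]
    obtain t where t: "q \<bullet> sgn y < f (\<gamma> t)" "norm y < t" "t \<le> R2" by auto
    have "t > 0" using t(2) by (meson le_less_trans norm_ge_zero)
    then have "\<gamma> t \<in> T" using t \<gamma>S \<gamma>[of t] by (auto simp: T_def image_subset_iff)
    then show False using x(2)[of "\<gamma> t"] \<gamma>[of t] \<open>t > 0\<close> t(2) ny by simp
  qed
  have xS: "x \<in> S" using x by (simp add: T_def)
  have fx: "f x = q \<bullet> sgn x" using le[OF xS] x by (simp add: T_def)
  \<comment> \<open>The strict inequality at \<open>x0\<close> contradicts \<open>le\<close> unless
    \<open>norm x0 < norm x\<close>, so the contact is not on the inner face.\<close>
  have "x0 \<in> T" using x0 by (simp add: T_def S_def)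
  then have "norm x0 < norm x"
    using x(2)[of x0] le[of x0] x0 by (force simp: S_def)
  then have xR1: "R1 < norm x" using x0 S_iff by (force simp: S_def)
  have x_int: "x \<in> interior (polar_region Q R1 R2)"
    by (rule interior_polar_regionI[OF R(1) Q xR1]) (use inside[OF x(1)] xS S_iff in auto)
  have sub: "polar_region Q R1 R2 \<subseteq> S"
    unfolding S_def using closure_subset[of Q] by (auto simp: polar_region_def)
  have fG: "(f has_derivative (\<lambda>h. G y \<bullet> h)) (at y)" "(G has_derivative L y) (at y)"
    if "y \<in> interior (polar_region Q R1 R2)" for y
    using C2_data_at[OF f] interior_mono[OF sub] that unfolding S_def by blast+
  define n where "n = sgn x"
  define r where "r = norm x"
  have x0': "x \<noteq> 0" using xR1 R by auto
  have r: "r > 0" and n: "norm n = 1" and rn: "r *\<^sub>R n = x" and xr: "norm x = r"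
    using x0' by (auto simp: r_def n_def norm_sgn) (simp add: sgn_div_norm)
  have nn: "n \<bullet> n = 1" using n by (simp add: norm_eq_1)
  obtain \<delta> where \<delta>: "0 < \<delta>" "\<delta> \<le> 1"
    "\<And>w. w \<bullet> n = 0 \<Longrightarrow> norm w < \<delta> \<Longrightarrow> r *\<^sub>R sphere_chart n w \<in> interior (polar_region Q R1 R2)"
    using interior_polar_region_chart[OF R(1) Q x_int] unfolding n_def r_def by metis
  have tan: "r * (G x \<bullet> w) = q \<bullet> w"
    "(f x - x \<bullet> G x) * (norm w)\<^sup>2 + (norm x)\<^sup>2 * (L x w \<bullet> w) \<le> 0" if w: "w \<bullet> n = 0" for w
  proof -
    define \<epsilon> where "\<epsilon> = \<delta> / (norm w + 1)"
    have \<epsilon>: "\<epsilon> > 0" using \<delta> by (simp add: \<epsilon>_def add_nonneg_pos)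
    have sw: "(s *\<^sub>R w) \<bullet> n = 0" "norm (s *\<^sub>R w) < \<delta>" if "\<bar>s\<bar> < \<epsilon>" for s
    proof -
      have "\<bar>s\<bar> * (norm w + 1) < \<delta>"
        using that by (simp add: \<epsilon>_def pos_less_divide_eq add_nonneg_pos)
      then show "norm (s *\<^sub>R w) < \<delta>" by (simp add: algebra_simps)
    qed (simp add: w)
    define c where "c s = sphere_chart n (s *\<^sub>R w)" for s
    define c' where "c' s = w - ((s * (w \<bullet> w)) / sqrt (1 - s\<^sup>2 * (w \<bullet> w))) *\<^sub>R n" for s
    have c_der: "(c has_derivative (\<lambda>h. h *\<^sub>R c' s)) (at s)" if s: "\<bar>s\<bar> < \<epsilon>" for s
      unfolding c_def c'_def by (rule sphere_chart_line_has_derivative) (use sw(2)[OF s] \<delta> in simp)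
    have c_int: "r *\<^sub>R c s \<in> interior (polar_region Q R1 R2)" if "\<bar>s\<bar> < \<epsilon>" for s
      using \<delta>(3)[OF sw[OF that]] by (simp add: c_def)
    \<comment> \<open>Along a curve in the sphere through \<open>x\<close> this difference has its
      maximum at 0. First order gives the tangential part of \<open>q\<close>, second order the
      matrix inequality.\<close>
    define \<phi> where "\<phi> s = f (r *\<^sub>R c s) - q \<bullet> c s" for s
    define \<phi>' where "\<phi>' s = r * (G (r *\<^sub>R c s) \<bullet> c' s) - q \<bullet> c' s" for s
    have rc: "((\<lambda>s. r *\<^sub>R c s) has_derivative (\<lambda>h. r *\<^sub>R (h *\<^sub>R c' s))) (at s)" if "\<bar>s\<bar> < \<epsilon>" for s
      by (intro has_derivative_scaleR_right c_der that)
    have d1: "(\<phi> has_real_derivative \<phi>' s) (at s)" if s: "\<bar>s\<bar> < \<epsilon>" for s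
    proof -
      have "((\<lambda>s. f (r *\<^sub>R c s)) has_derivative (\<lambda>h. G (r *\<^sub>R c s) \<bullet> (r *\<^sub>R (h *\<^sub>R c' s)))) (at s)"
        by (rule has_derivative_compose[OF rc[OF s] fG(1)[OF c_int[OF s]]])
      from has_derivative_diff[OF this has_derivative_inner_right[OF c_der[OF s], of q]]
      show ?thesis
        unfolding \<phi>_def[abs_def] \<phi>'_def
        by (rule has_derivative_imp_has_field_derivative) (simp add: algebra_simps)
    qed
    have c0: "c 0 = n" "c' 0 = w" by (auto simp: c_def c'_def)
    have zero: "\<bar>0::real\<bar> < \<epsilon>" using \<epsilon> by simp
    have c'_der: "(c' has_derivative (\<lambda>h. h *\<^sub>R (- (w \<bullet> w)) *\<^sub>R n)) (at 0)"
      unfolding c'_def by (rule sphere_chart_velocity_has_derivative)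
    have d2: "(\<phi>' has_real_derivative (r * (r * (L x w \<bullet> w)) - r * (G x \<bullet> n) * (w \<bullet> w) + (q \<bullet> n) * (w \<bullet> w))) (at 0)"
    proof -
      have "((\<lambda>s. G (r *\<^sub>R c s)) has_derivative (\<lambda>h. L x (r *\<^sub>R (h *\<^sub>R w)))) (at 0)"
        using has_derivative_compose[OF rc[OF zero] fG(2)[OF c_int[OF zero]]] by (simp add: c0 rn)
      from has_derivative_diff[OF has_derivative_mult_right[OF has_derivative_inner[OF this c'_der], of r]
          has_derivative_inner_right[OF c'_der, of q]]
      show ?thesis
        unfolding \<phi>'_def[abs_def] using C2_dataD(4)[OF f] xS unfolding S_def
        by (elim has_derivative_imp_has_field_derivative)
           (simp add: c0 rn linear_scale inner_commute[of n] algebra_simps)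
    qed
    have max: "\<phi> s \<le> \<phi> 0" if s: "\<bar>s\<bar> < \<epsilon>" for s
    proof -
      have "r *\<^sub>R c s \<in> S" using c_int[OF s] sub interior_subset by blast
      moreover have nc: "norm (c s) = 1"
        unfolding c_def using sw[OF s] \<delta> by (intro sphere_chart_norm[OF n]) auto
      ultimately have "f (r *\<^sub>R c s) \<le> q \<bullet> sgn (r *\<^sub>R c s)"
        using r by (intro le) (auto simp: xr)
      moreover have "sgn (r *\<^sub>R c s) = c s" using nc r by (simp add: sgn_div_norm)
      ultimately show ?thesis using fx by (simp add: \<phi>_def c0 rn flip: n_def)
    qed
    note test = local_max_second_derivative[OF \<epsilon> d1 d2 max]
    show "r * (G x \<bullet> w) = q \<bullet> w" using test(1) by (simp add: \<phi>'_def c0 rn)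
    \<comment> \<open>The acceleration of the curve contributes
      \<open>q \<bullet> n - x \<bullet> G x\<close>, and \<open>q \<bullet> n = f x\<close> by
      contact.\<close>
    have "r * (G x \<bullet> n) = x \<bullet> G x" using rn by (metis inner_commute inner_scaleR_right)
    then show "(f x - x \<bullet> G x) * (norm w)\<^sup>2 + (norm x)\<^sup>2 * (L x w \<bullet> w) \<le> 0"
      using test(2) fx by (simp add: xr n_def power2_norm_eq_inner power2_eq_square[of r] algebra_simps)
  qed
  have radial: "G x \<bullet> n \<le> 0"
  proof (rule ccontr)
    assume pos: "\<not> G x \<bullet> n \<le> 0"
    have "((\<lambda>t. t *\<^sub>R n) has_derivative (\<lambda>h. h *\<^sub>R n)) (at r)" by (auto intro!: derivative_eq_intros)
    from has_derivative_compose[OF this, of f "\<lambda>h. G x \<bullet> h"]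
    have "((\<lambda>t. f (t *\<^sub>R n)) has_derivative (\<lambda>h. G x \<bullet> (h *\<^sub>R n))) (at r)"
      using fG(1)[OF x_int] rn by simp
    then have "((\<lambda>t. f (t *\<^sub>R n)) has_real_derivative (G x \<bullet> n)) (at r)"
      by (rule has_derivative_imp_has_field_derivative) simp
    then obtain d where d: "d > 0" "\<And>h. h > 0 \<Longrightarrow> h < d \<Longrightarrow> f (r *\<^sub>R n) < f ((r + h) *\<^sub>R n)"
      using DERIV_pos_inc_right pos by (metis linorder_not_le)
    define h where "h = min (d / 2) (R2 - r)"
    have h: "h > 0" "h < d" "r + h \<le> R2" using d inside(1)[OF x(1)] by (auto simp: h_def xr)
    have s: "norm ((r + h) *\<^sub>R n) = r + h" "sgn ((r + h) *\<^sub>R n) = n"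
      using h r n by (auto simp: sgn_div_norm)
    then have "(r + h) *\<^sub>R n \<in> S" using S_iff xS h by (auto simp: n_def xr)
    then have "f ((r + h) *\<^sub>R n) \<le> q \<bullet> n" using le[of "(r + h) *\<^sub>R n"] s h by (simp add: xr del: norm_scaleR)
    then show False using d(2)[of h] h fx rn by (simp add: n_def)
  qed
  have "polar_map f G x = q"
  proof -
    \<comment> \<open>Both vectors have component \<open>f x\<close> along \<open>n\<close> and the
      same tangential part, so \<open>z\<close> is orthogonal to everything, including
      itself.\<close>
    define z where "z = q - polar_map f G x"
    have "r * (G x \<bullet> n) = x \<bullet> G x" using rn by (metis inner_commute inner_scaleR_right)
    then have zn: "z \<bullet> n = 0"
      using fx nn by (simp add: z_def polar_map_def inner_diff_left inner_add_left xr flip: n_def)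
    have "z \<bullet> w = 0" if "w \<bullet> n = 0" for w
      using tan(1)[OF that] that
      by (simp add: z_def polar_map_def inner_diff_left inner_add_left xr inner_commute[of n w] flip: n_def)
    then have "z \<bullet> z = 0" using zn by blast
    then show ?thesis by (simp add: z_def)
  qed
  then show ?thesis using that[OF x_int] radial tan(2) by (simp add: n_def tangentially_nonpos_def)
qed

section \<open>Sets of directions away from the equator, and null boundaries of sectors\<close>

lemma half_sphere_frontier:
  fixes e \<eta> :: "'a::euclidean_space"
  assumes "norm e = 1" "norm \<eta> = 1" "\<eta> \<bullet> e = 0"
  shows "\<eta> \<in> sphere_frontier (upper_half_sphere e)"
proof -
  have ee: "e \<bullet> e = 1" "\<eta> \<bullet> \<eta> = 1" using assms by (auto simp: norm_eq_1)
  have "\<eta> \<in> closure (upper_half_sphere e)"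
    unfolding closure_approachable
  proof (intro allI impI)
    fix \<epsilon> :: real assume \<epsilon>: "\<epsilon> > 0"
    define g where "g t = cos t *\<^sub>R \<eta> + sin t *\<^sub>R e" for t :: real
    have "continuous (at 0) g"
      unfolding g_def by (intro continuous_intros)
    then obtain d where d: "d > 0" "\<And>t. dist t 0 < d \<Longrightarrow> dist (g t) (g 0) < \<epsilon>"
      using \<epsilon> unfolding continuous_at_eps_delta by blast
    define t where "t = min (d / 2) 1"
    have t: "0 < t" "t < d" "t \<le> 1" using d(1) by (auto simp: t_def)
    have "sin t > 0" using t pi_gt3 by (intro sin_gt_zero) auto
    moreover have "g t \<bullet> g t = 1"
      using assms(3) sin_cos_squared_add[of t]
      by (simp add: g_def inner_add_left inner_add_right inner_commute[of e \<eta>] ee power2_eq_square)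
    ultimately have "g t \<in> upper_half_sphere e"
      using assms(3) by (simp add: upper_half_sphere_def norm_eq_1) (simp add: g_def inner_add_left ee)
    moreover have "dist (g t) \<eta> < \<epsilon>"
      using d(2)[of t] t by (simp add: g_def)
    ultimately show "\<exists>y\<in>upper_half_sphere e. dist y \<eta> < \<epsilon>" by blast
  qed
  moreover have "\<eta> \<notin> upper_half_sphere e" using assms by (simp add: upper_half_sphere_def)
  moreover have "upper_half_sphere e \<subseteq> sphere 0 1" by (auto simp: upper_half_sphere_def)
  ultimately show ?thesis
    using closed_sphere_frontier(1)[of "upper_half_sphere e"] by blast
qed

text \<open>The equator point nearest to \<theta> is its normalised projection \<open>sgn u\<close>.
  With \<open>a = \<theta> \<bullet> e\<close> and \<open>b = norm u\<close> the squared distance is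
  \<open>2 - 2 * b\<close>, and \<open>a\<^sup>2 + b\<^sup>2 = 1\<close> forces
  \<open>1 - b \<le> a\<close>.\<close>

lemma half_sphere_gap:
  fixes e :: "'a::euclidean_space"
  assumes e: "norm e = 1" and Q: "Q \<subseteq> upper_half_sphere e"
    and \<delta>: "\<delta> > 0" "\<forall>\<theta>\<in>Q. \<forall>\<eta>\<in>sphere_frontier (upper_half_sphere e). \<delta> \<le> dist \<theta> \<eta>"
  obtains c where "0 < c" "c \<le> 1" "\<And>\<theta>. \<theta> \<in> closure Q \<Longrightarrow> c \<le> \<theta> \<bullet> e"
proof -
  \<comment> \<open>\<open>\<delta>\<^sup>2 / 2\<close> is the height forced by the distance; the
    minimum with 1 covers \<open>\<theta> = e\<close>, whose projection to the equatorial plane is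
    0.\<close>
  define c where "c = min 1 (\<delta>\<^sup>2 / 2)"
  have ee: "e \<bullet> e = 1" using e by (simp add: norm_eq_1)
  have "c \<le> \<theta> \<bullet> e" if "\<theta> \<in> Q" for \<theta>
  proof -
    define a where "a = \<theta> \<bullet> e"
    define u where "u = \<theta> - a *\<^sub>R e"
    have \<theta>: "\<theta> \<bullet> \<theta> = 1" "a > 0" using Q that by (auto simp: upper_half_sphere_def norm_eq_1 a_def)
    have ue: "u \<bullet> e = 0" by (simp add: u_def inner_diff_left ee a_def)
    have u\<theta>: "\<theta> \<bullet> u = u \<bullet> u"
      using ue by (simp add: u_def inner_diff_left inner_commute)
    have uu: "u \<bullet> u = 1 - a\<^sup>2"
      by (simp add: u_def inner_diff_left inner_diff_right \<theta> ee inner_commute[of e \<theta>] power2_eq_square flip: a_def)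
    show ?thesis
    proof (cases "u = 0")
      case True
      then have "a\<^sup>2 = 1" using uu by simp
      then have "a = 1" using \<theta>(2) by (simp add: power2_eq_1_iff)
      then show ?thesis by (simp add: c_def a_def)
    next
      case False
      define b where "b = norm u"
      have b: "b > 0" "b * b = u \<bullet> u" using False by (auto simp: b_def power2_norm_eq_inner simp flip: power2_eq_square)
      define \<eta> where "\<eta> = sgn u"
      have \<eta>: "norm \<eta> = 1" "\<eta> \<bullet> e = 0" using False ue by (auto simp: \<eta>_def norm_sgn sgn_div_norm)
      have "\<delta> \<le> dist \<theta> \<eta>"
        using \<delta>(2) that half_sphere_frontier[OF e \<eta>] by blast
      then have "\<delta>\<^sup>2 \<le> (norm (\<theta> - \<eta>))\<^sup>2" using \<delta>(1) by (simp add: dist_norm power_mono)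
      also have "\<dots> = 2 - 2 * (\<theta> \<bullet> \<eta>)"
        using \<theta> \<eta> by (simp add: power2_norm_eq_inner inner_diff_left inner_diff_right inner_commute norm_eq_1)
      also have "\<theta> \<bullet> \<eta> = b"
        using u\<theta> b by (simp add: \<eta>_def sgn_div_norm flip: b_def) (metis b(2) nonzero_mult_div_cancel_left less_irrefl divide_inverse mult.commute)
      finally have "\<delta>\<^sup>2 / 2 \<le> 1 - b" by simp
      also have "1 - b \<le> a"
      proof (rule ccontr)
        assume "\<not> 1 - b \<le> a"
        then have "a + b < 1" by simp
        then have "(a + b)\<^sup>2 < 1" using \<theta>(2) b(1) by (simp add: power_less_one_iff abs_square_less_1)
        moreover have "(a + b)\<^sup>2 = 1 + 2 * (a * b)"
          using b(2) uu by (simp add: power2_eq_square algebra_simps)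
        moreover have "a * b > 0" using \<theta>(2) b(1) by simp
        ultimately show False by linarith
      qed
      finally show ?thesis by (simp add: c_def a_def)
    qed
  qed
  then have "Q \<subseteq> {\<theta>. c \<le> \<theta> \<bullet> e}" by blast
  moreover have "closed {\<theta>. c \<le> \<theta> \<bullet> e}"
    by (intro closed_Collect_le continuous_intros)
  ultimately have "closure Q \<subseteq> {\<theta>. c \<le> \<theta> \<bullet> e}" by (rule closure_minimal)
  then show ?thesis using \<delta>(1) by (intro that[of c]) (auto simp: c_def)
qed

text \<open>The cone over \<open>Q\<close> is convex: spherical convexity supplies its segments, and
  the open half-sphere excludes antipodal directions. The frontier of a convex set is null, and so
  are the two spherical faces.\<close>

lemma negligible_polar_region_diff_interior:
  fixes e :: "'a::euclidean_space"
  assumes R: "0 < R1" and Q: "Q \<subseteq> upper_half_sphere e" "spherically_convex Q"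
  shows "negligible (polar_region Q R1 R2 - interior (polar_region Q R1 R2))"
proof -
  have sub: "Q \<subseteq> sphere 0 1" using Q(1) by (auto simp: upper_half_sphere_def)
  define K where "K = {x. x \<noteq> 0 \<and> sgn x \<in> Q}"
  have K: "x \<bullet> e > 0" if "x \<in> K" for x
  proof -
    have "sgn x \<bullet> e > 0" "x \<noteq> 0" using that Q(1) by (auto simp: K_def upper_half_sphere_def)
    then show ?thesis by (simp add: sgn_div_norm zero_less_mult_iff)
  qed
  have "convex K"
  proof (rule convexI)
    fix x y and a b :: real
    assume xy: "x \<in> K" "y \<in> K" and ab: "0 \<le> a" "0 \<le> b" "a + b = 1"
    define z where "z = a *\<^sub>R x + b *\<^sub>R y"
    have ze: "z \<bullet> e > 0"
    proof (cases "a = 0")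
      case True then show ?thesis using K[OF xy(2)] ab by (simp add: z_def)
    next
      case False
      then have "a * (x \<bullet> e) > 0" "b * (y \<bullet> e) \<ge> 0" using K[OF xy(1)] K[OF xy(2)] ab by auto
      then show ?thesis by (simp add: z_def inner_add_left)
    qed
    then have z0: "z \<noteq> 0" by auto
    have x0: "x \<noteq> 0" "y \<noteq> 0" using xy by (auto simp: K_def)
    have "sgn x \<noteq> - sgn y"
    proof
      assume "sgn x = - sgn y"
      then have "sgn x \<bullet> e = - (sgn y \<bullet> e)" by simp
      moreover have "sgn x \<bullet> e > 0" "sgn y \<bullet> e > 0"
        using xy Q(1) by (auto simp: K_def upper_half_sphere_def)
      ultimately show False by simp
    qed
    moreover have eq: "sgn z = (a * norm x / norm z) *\<^sub>R sgn x + (b * norm y / norm z) *\<^sub>R sgn y"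
      using x0 by (simp add: z_def sgn_div_norm scaleR_add_right field_simps)
    moreover have "norm (sgn z) = 1" using z0 by (simp add: norm_sgn)
    moreover have "0 \<le> a * norm x / norm z" "0 \<le> b * norm y / norm z" using ab by auto
    ultimately have "sgn z \<in> Q"
      using Q(2) xy unfolding spherically_convex_def K_def by (metis (no_types, lifting) mem_Collect_eq)
    then show "a *\<^sub>R x + b *\<^sub>R y \<in> K" using z0 by (simp add: K_def z_def)
  qed
  then have "negligible (frontier K)" by (rule negligible_convex_frontier)
  moreover have "polar_region Q R1 R2 - interior (polar_region Q R1 R2) \<subseteq> frontier K \<union> (sphere 0 R1 \<union> sphere 0 R2)"
  proof
    fix x assume x: "x \<in> polar_region Q R1 R2 - interior (polar_region Q R1 R2)"
    then have x': "R1 \<le> norm x" "norm x \<le> R2" "sgn x \<in> Q"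
      using polar_region_iff[OF R sub] by auto
    show "x \<in> frontier K \<union> (sphere 0 R1 \<union> sphere 0 R2)"
    proof (rule ccontr)
      assume no: "x \<notin> frontier K \<union> (sphere 0 R1 \<union> sphere 0 R2)"
      then have less: "R1 < norm x" "norm x < R2" using x' by auto
      have "x \<in> K" using x' R by (auto simp: K_def)
      then have "x \<in> interior K" using no closure_subset[of K] by (auto simp: frontier_def)
      define V where "V = interior K \<inter> {x. R1 < norm x} \<inter> {x. norm x < R2}"
      have "open V" unfolding V_def by (intro open_Int open_Collect_less continuous_intros open_interior)
      moreover have "V \<subseteq> polar_region Q R1 R2"
        using interior_subset[of K] polar_region_iff[OF R sub] by (auto simp: V_def K_def)
      moreover have "x \<in> V" using less \<open>x \<in> interior K\<close> by (simp add: V_def)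
      ultimately have "x \<in> interior (polar_region Q R1 R2)" by (metis interiorI)
      then show False using x by simp
    qed
  qed
  ultimately show ?thesis
    by (meson negligible_Un negligible_sphere negligible_subset)
qed

text \<open>The integral runs over \<open>Gamma_set\<close>, which may contain boundary points with
  merely relative derivatives, whereas the Jacobian formula holds in the interior. Both are
  reconciled because the boundary part is null.\<close>

lemma polar_Gamma_measure:
  fixes f :: "'a::euclidean_space \<Rightarrow> real" and e :: 'a
  assumes R: "0 < R1" "R1 < R2" and Q: "Q \<subseteq> upper_half_sphere e" "spherically_convex Q"
    and f: "C2_data (polar_region (closure Q) R1 R2) f G L"
    and B: "B \<in> sets borel"
    and touch: "\<And>q. q \<in> B \<Longrightarrow> \<exists>x\<in>interior (polar_region Q R1 R2). polar_map f G x = q \<and> G x \<bullet> sgn x \<le> 0 \<and> tangentially_nonpos f G L x"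
  shows "emeasure lborel B \<le> ennreal (LINT x:Gamma_set Q R1 R2 f|lebesgue.
    \<bar>radial_deriv R1 R2 f x * Determinant.det (angular_matrix Q f x)\<bar> / norm x ^ (DIM('a) - 1))"
proof -
  define I where "I = interior (polar_region Q R1 R2)"
  define S where "S = polar_region (closure Q) R1 R2"
  define \<Gamma> where "\<Gamma> = {x \<in> I. G x \<bullet> sgn x \<le> 0 \<and> tangentially_nonpos f G L x}"
  define D where "D = polar_map_deriv f G L"
  have subQ: "Q \<subseteq> sphere 0 1" using Q(1) by (auto simp: upper_half_sphere_def)
  then have cQ: "closure Q \<subseteq> sphere 0 1" by (simp add: closure_minimal)
  have sub: "polar_region Q R1 R2 \<subseteq> S"
    unfolding S_def using closure_subset[of Q] by (auto simp: polar_region_def)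
  then have IS: "I \<subseteq> S" using interior_subset unfolding I_def by blast
  have openI: "open I" by (simp add: I_def)
  have S0: "0 \<notin> S" unfolding S_def using polar_region_iff[OF R(1) cQ] R by auto
  have compact_S: "compact S"
    unfolding S_def using cQ
    by (intro compact_polar_region) (meson bounded_sphere bounded_subset closed_closure compact_eq_bounded_closed)
  have fS: "C2_data S f G L" using f by (simp add: S_def)
  have fI: "C2_data I f G L" using C2_data_subset[OF fS IS] .
  have \<Gamma>I: "\<Gamma> \<subseteq> I" by (auto simp: \<Gamma>_def)
  have Gamma_I: "Gamma_set Q R1 R2 f \<inter> I = \<Gamma>"
  proof -
    have "x \<in> Gamma_set Q R1 R2 f \<longleftrightarrow> x \<in> \<Gamma>" if x: "x \<in> I" for x
    proof -
      have xi: "x \<in> interior (polar_region Q R1 R2)" using x by (simp add: I_def)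
      have "x \<in> polar_region Q R1 R2" using xi interior_subset by blast
      then show ?thesis
        unfolding Gamma_set_def \<Gamma>_def
        using nonpos_angular_matrix_iff[OF R(1) subQ xi sub fS] radial_deriv_interior[OF R(1) subQ xi sub fS R(2)] x
        by simp
    qed
    then show ?thesis using \<Gamma>I by blast
  qed
  have J: "\<bar>radial_deriv R1 R2 f x * Determinant.det (angular_matrix Q f x)\<bar> / norm x ^ (DIM('a) - 1) = \<bar>ldet (D x)\<bar>"
    if "x \<in> I" for x
  proof -
    have xi: "x \<in> interior (polar_region Q R1 R2)" using that by (simp add: I_def)
    show ?thesis
      unfolding D_def ldet_polar_map[OF R(1) subQ xi sub fS R(2)] by simp
  qed
  have cD: "continuous_on S (\<lambda>x. ldet (D x))"
    unfolding D_def by (intro continuous_on_ldet continuous_on_polar_map_deriv[OF fS S0])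
  have \<Gamma>_borel: "\<Gamma> \<in> sets borel"
  proof -
    have csgn: "continuous_on I sgn" using S0 IS by (intro continuous_on_sgn continuous_on_id) auto
    \<comment> \<open>Projecting a fixed \<open>w\<close> to the tangent space at \<open>x\<close>
      replaces the vectors of a varying hyperplane by all \<open>w\<close>, so that \<Gamma> is an
      intersection of sets closed in \<open>I\<close>.\<close>
    define F where "F w x = (let u = w - (w \<bullet> sgn x) *\<^sub>R sgn x in
      (f x - x \<bullet> G x) * (norm u)\<^sup>2 + (norm x)\<^sup>2 * (L x u \<bullet> u))" for w x
    have cF: "continuous_on I (F w)" for w
    proof -
      have cu: "continuous_on I (\<lambda>x. w - (w \<bullet> sgn x) *\<^sub>R sgn x)"
        by (intro continuous_intros csgn)
      have "continuous_on I (\<lambda>x. L x (w - (w \<bullet> sgn x) *\<^sub>R sgn x))"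
        by (rule continuous_on_linear_family[OF C2_dataD(3)[OF fI] C2_dataD(4)[OF fI] cu])
      then show ?thesis
        unfolding F_def Let_def by (intro continuous_intros C2_data_continuous[OF fI] csgn)
    qed
    have "\<Gamma> = {x \<in> I. G x \<bullet> sgn x \<le> 0} \<inter> (\<Inter>w. {x \<in> I. F w x \<le> 0})"
    proof (intro equalityI subsetI)
      fix x assume x: "x \<in> \<Gamma>"
      have "F w x \<le> 0" for w
      proof -
        have "x \<noteq> 0" using x \<Gamma>I IS S0 by auto
        then have "(w - (w \<bullet> sgn x) *\<^sub>R sgn x) \<bullet> sgn x = 0"
          by (simp add: inner_diff_left inner_sgn_sgn)
        then show ?thesis using x by (simp add: F_def Let_def \<Gamma>_def tangentially_nonpos_def)
      qed
      then show "x \<in> {x \<in> I. G x \<bullet> sgn x \<le> 0} \<inter> (\<Inter>w. {x \<in> I. F w x \<le> 0})"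
        using x by (auto simp: \<Gamma>_def)
    next
      fix x assume x: "x \<in> {x \<in> I. G x \<bullet> sgn x \<le> 0} \<inter> (\<Inter>w. {x \<in> I. F w x \<le> 0})"
      have "(f x - x \<bullet> G x) * (norm w)\<^sup>2 + (norm x)\<^sup>2 * (L x w \<bullet> w) \<le> 0" if "w \<bullet> sgn x = 0" for w
      proof -
        have "F w x \<le> 0" using x by auto
        then show ?thesis using that by (simp add: F_def)
      qed
      then show "x \<in> \<Gamma>" using x by (auto simp: \<Gamma>_def tangentially_nonpos_def)
    qed
    moreover have cl: "closedin (top_of_set I) {x \<in> I. g x \<le> 0}" if "continuous_on I g" for g :: "'a \<Rightarrow> real"
      using continuous_closedin_preimage[OF that, of "{..0}"] by (simp add: Int_def vimage_def)
    moreover have "continuous_on I (\<lambda>x. G x \<bullet> sgn x)"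
      by (intro continuous_intros C2_data_continuous[OF fI] csgn)
    ultimately have "closedin (top_of_set I) \<Gamma>"
      using cl[OF cF] by (auto intro!: closedin_Int closedin_INT)
    then obtain T where "closed T" "\<Gamma> = I \<inter> T" by (auto simp: closedin_closed)
    then show ?thesis using openI by auto
  qed
  define h where "h x = indicator \<Gamma> x *\<^sub>R \<bar>ldet (D x)\<bar>" for x
  have h_borel: "h \<in> borel_measurable borel"
    unfolding h_def using \<Gamma>I IS
    by (intro borel_measurable_continuous_on_indicator \<Gamma>_borel continuous_on_rabs continuous_on_subset[OF cD]) auto
  \<comment> \<open>A nonintegrable function would have integral 0 by convention, which would void
    the bound. Continuity of the Jacobian on the compact set \<open>S\<close> supplies
    integrability.\<close>
  have h_int: "integrable lborel h"
  proof -
    obtain K where K: "\<And>x. x \<in> S \<Longrightarrow> norm (ldet (D x)) \<le> K"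
      using compact_imp_bounded[OF compact_continuous_image[OF cD compact_S]] by (auto simp: bounded_iff)
    have "bounded \<Gamma>" using \<Gamma>I IS compact_S by (meson bounded_subset compact_imp_bounded)
    then have "emeasure lborel \<Gamma> < \<infinity>" by (rule emeasure_bounded_finite)
    then have "integrable lborel (\<lambda>x. indicator \<Gamma> x *\<^sub>R h x)"
    proof (intro integrableI_bounded_set_indicator[where B=K])
      have "norm (h x) \<le> K" if "x \<in> \<Gamma>" for x
        using that K \<Gamma>I IS by (auto simp: h_def)
      then show "AE x in lborel. x \<in> \<Gamma> \<longrightarrow> norm (h x) \<le> K" by simp
    qed (use \<Gamma>_borel h_borel in auto)
    moreover have "(\<lambda>x. indicator \<Gamma> x *\<^sub>R h x) = h" by (auto simp: h_def indicator_def)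
    ultimately show ?thesis by simp
  qed
  have "emeasure lborel B \<le> (\<integral>\<^sup>+x\<in>\<Gamma>. ennreal \<bar>ldet (D x)\<bar> \<partial>lborel)"
  proof (rule measure_le_nn_integral_ldet[OF \<Gamma>_borel _ _ negligible_empty B])
    show "(polar_map f G has_derivative D x) (at x within \<Gamma>)" if "x \<in> \<Gamma>" for x
    proof -
      have xS: "x \<in> interior S" using that \<Gamma>I interior_mono[OF sub] by (auto simp: I_def)
      then have "x \<noteq> 0" using S0 interior_subset[of S] by auto
      then show ?thesis
        unfolding D_def
        using has_derivative_at_withinI[OF polar_map_has_derivative[where f=f and G=G and L=L, OF C2_data_at[OF fS xS]]] by blast
    qed
    show "continuous_on \<Gamma> (\<lambda>x. ldet (D x))"
      using \<Gamma>I IS by (intro continuous_on_subset[OF cD]) auto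
    show "B \<subseteq> polar_map f G ` \<Gamma> \<union> {}"
    proof
      fix q assume "q \<in> B"
      from touch[OF this] obtain x where "x \<in> \<Gamma>" "polar_map f G x = q" by (auto simp: \<Gamma>_def I_def)
      then show "q \<in> polar_map f G ` \<Gamma> \<union> {}" by blast
    qed
  qed
  also have "\<dots> = (\<integral>\<^sup>+x. ennreal (h x) \<partial>lborel)"
    by (intro nn_integral_cong) (auto simp: h_def indicator_def)
  also have "\<dots> = ennreal (integral\<^sup>L lborel h)"
    using h_int by (rule nn_integral_eq_integral) (auto simp: h_def)
  also have "integral\<^sup>L lborel h = integral\<^sup>L lebesgue h"
    using integral_completion[of h lborel] h_borel by simp
  also have "\<dots> = (LINT x:Gamma_set Q R1 R2 f|lebesgue.
    \<bar>radial_deriv R1 R2 f x * Determinant.det (angular_matrix Q f x)\<bar> / norm x ^ (DIM('a) - 1))"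
  proof -
    define F where "F x = indicator (Gamma_set Q R1 R2 f) x *\<^sub>R
      (\<bar>radial_deriv R1 R2 f x * Determinant.det (angular_matrix Q f x)\<bar> / norm x ^ (DIM('a) - 1))" for x
    have neg: "negligible (polar_region Q R1 R2 - I)"
      unfolding I_def by (rule negligible_polar_region_diff_interior[OF R(1) Q])
    have Fh: "F x = h x" if "x \<in> UNIV - (polar_region Q R1 R2 - I)" for x
    proof (cases "x \<in> I")
      case True
      then show ?thesis using Gamma_I J[OF True] by (auto simp: F_def h_def indicator_def)
    next
      case False
      then have "x \<notin> Gamma_set Q R1 R2 f" using that by (auto simp: Gamma_set_def)
      then show ?thesis using False \<Gamma>I by (auto simp: F_def h_def indicator_def)
    qed
    have hU: "h absolutely_integrable_on UNIV"
      using h_int integrable_completion[of h lborel] h_borel by (simp add: set_integrable_def)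
    have FU: "F absolutely_integrable_on UNIV"
      by (rule absolutely_integrable_spike[OF hU neg Fh])
    have "integral\<^sup>L lebesgue h = integral UNIV h" "integral\<^sup>L lebesgue F = integral UNIV F"
      using set_lebesgue_integral_eq_integral(2)[OF hU] set_lebesgue_integral_eq_integral(2)[OF FU]
      by (simp_all add: set_lebesgue_integral_def)
    moreover have "integral UNIV h = integral UNIV F" by (rule integral_spike[OF neg Fh])
    ultimately have "integral\<^sup>L lebesgue h = integral\<^sup>L lebesgue F" by simp
    then show ?thesis by (simp add: F_def[abs_def] set_lebesgue_integral_def)
  qed
  finally show ?thesis .
qed

theorem parabolic_maximum_principle:
  fixes e :: "'a::euclidean_space"
  assumes e: "norm e = 1" and Q: "Q \<noteq> {}" "Q \<subseteq> upper_half_sphere e" "spherically_convex Q"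
    and gap: "\<exists>\<delta>>0. \<forall>\<theta>\<in>Q. \<forall>\<eta>\<in>sphere_frontier (upper_half_sphere e). \<delta> \<le> dist \<theta> \<eta>"
  shows "\<exists>C1>0. \<exists>C2>0. \<forall>(R1::real) (R2::real) (f :: 'a \<Rightarrow> real).
           0 < R1 \<longrightarrow> R1 < R2 \<longrightarrow>
           C2_on (polar_region Q R1 R2 \<union> parabolic_boundary Q R1 R2) f \<longrightarrow>
           0 \<le> (SUP x\<in>parabolic_boundary Q R1 R2. f x) \<longrightarrow>
             (SUP x\<in>polar_region Q R1 R2. f x)
               \<le> C1 * (SUP x\<in>parabolic_boundary Q R1 R2. f x)
                 + C2 * (LINT x:Gamma_set Q R1 R2 f|lebesgue.
                     \<bar>radial_deriv R1 R2 f x * Determinant.det (angular_matrix Q f x)\<bar>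
                       / norm x ^ (DIM('a) - 1)) powr (1 / real DIM('a))"
proof -
  define d where "d = DIM('a)"
  have d: "d > 0" by (simp add: d_def)
  obtain c where c: "0 < c" "c \<le> 1" "\<And>\<theta>. \<theta> \<in> closure Q \<Longrightarrow> c \<le> \<theta> \<bullet> e"
    using gap half_sphere_gap[OF e Q(2)] by metis
  define \<omega> where "\<omega> = unit_ball_vol (real d)"
  have \<omega>: "\<omega> > 0" by (simp add: \<omega>_def)
  have subQ: "Q \<subseteq> sphere 0 1" using Q(2) by (auto simp: upper_half_sphere_def)
  then have cQ: "closure Q \<subseteq> sphere 0 1" by (simp add: closure_minimal)
  \<comment> \<open>\<open>2 / c\<close> is the threshold beyond which
    \<open>?m < c * M / 2\<close>; \<open>8 / c\<close> inverts \<open>\<rho> = c * M / 8\<close>,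
    and the remaining factor of \<open>C2\<close> normalises the volume of a ball.\<close>
  define C1 where "C1 = 2 / c"
  define C2 where "C2 = (8 / c) * (1 / \<omega>) powr (1 / real d)"
  have "(SUP x\<in>polar_region Q R1 R2. f x)
      \<le> C1 * (SUP x\<in>parabolic_boundary Q R1 R2. f x)
        + C2 * (LINT x:Gamma_set Q R1 R2 f|lebesgue.
            \<bar>radial_deriv R1 R2 f x * Determinant.det (angular_matrix Q f x)\<bar>
              / norm x ^ (DIM('a) - 1)) powr (1 / real DIM('a))"
    (is "?sup \<le> C1 * ?m + C2 * ?I powr _")
    if R: "0 < R1" "R1 < R2" and C2: "C2_on (polar_region Q R1 R2 \<union> parabolic_boundary Q R1 R2) f"
      and m0: "0 \<le> (SUP x\<in>parabolic_boundary Q R1 R2. f x)" for R1 R2 :: real and f :: "'a \<Rightarrow> real"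
  proof -
    define S where "S = polar_region (closure Q) R1 R2"
    have S_eq: "polar_region Q R1 R2 \<union> parabolic_boundary Q R1 R2 = S"
      unfolding S_def by (rule polar_region_Un_parabolic_boundary[OF subQ R(2)])
    obtain G L where f: "C2_data S f G L"
      using C2_on_imp_C2_data[OF C2] S_eq by metis
    have compact_S: "compact S"
      unfolding S_def using cQ
      by (intro compact_polar_region) (meson bounded_sphere bounded_subset closed_closure compact_eq_bounded_closed)
    obtain \<theta> where "\<theta> \<in> Q" using Q(1) by blast
    then have "R2 *\<^sub>R \<theta> \<in> polar_region Q R1 R2" using R by (force simp: polar_region_def)
    then have ne: "polar_region Q R1 R2 \<noteq> {}" "S \<noteq> {}" using S_eq by auto
    have cf: "continuous_on S f" using C2_data_continuous[OF f] by simp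
    obtain x0 where x0: "x0 \<in> S" "\<And>y. y \<in> S \<Longrightarrow> f y \<le> f x0"
      using continuous_attains_sup[OF compact_S ne(2) cf] by blast
    have sup_le: "?sup \<le> f x0"
      using ne(1) x0(2) S_eq by (intro cSUP_least) auto
    have m: "f x \<le> ?m" if "x \<in> parabolic_boundary Q R1 R2" for x
      using that x0(2) S_eq by (intro cSUP_upper bdd_aboveI2[of _ _ "f x0"]) auto
    have I0: "?I powr (1 / real DIM('a)) \<ge> 0" by simp
    show ?thesis
    proof (cases "f x0 \<le> C1 * ?m")
      case True
      moreover have "C2 * ?I powr (1 / real DIM('a)) \<ge> 0"
        using c \<omega> by (simp add: C2_def)
      ultimately show ?thesis using sup_le by linarith
    next
      case False
      define M where "M = f x0"
      have M: "M > 2 / c * ?m" using False by (simp add: M_def C1_def)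
      have "2 / c * ?m \<ge> 0" using c m0 by simp
      then have M0: "M > 0" using M by linarith
      have mM: "?m < c * M / 2" using M c by (simp add: field_simps)
      define \<rho> where "\<rho> = c * M / 8"
      have \<rho>: "\<rho> > 0" using c M0 by (simp add: \<rho>_def)
      have \<rho>M: "\<rho> \<le> M / 8" using c M0 by (simp add: \<rho>_def mult_le_cancel_right1 field_simps)
      \<comment> \<open>On this ball \<open>q \<bullet> \<theta>\<close> exceeds
        \<open>3 * c * M / 4 - c * M / 8 = 5 * c * M / 8\<close>, hence \<open>?m\<close>, for
        \<theta> in the closure of \<open>Q\<close>; in the direction of the maximum point it stays
        below \<open>3 * M / 4 + M / 8 < M\<close>.\<close>
      have "emeasure lborel (ball ((3 * M / 4) *\<^sub>R e) \<rho>) \<le> ennreal ?I"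
      proof (rule polar_Gamma_measure[OF R Q(2,3) f[unfolded S_def]])
        fix q assume "q \<in> ball ((3 * M / 4) *\<^sub>R e) \<rho>"
        then have qn: "norm (q - (3 * M / 4) *\<^sub>R e) < \<rho>" by (simp add: dist_norm norm_minus_commute)
        have near: "\<bar>q \<bullet> \<theta> - 3 * M / 4 * (\<theta> \<bullet> e)\<bar> < \<rho>" if "\<theta> \<in> closure Q" for \<theta>
        proof -
          have "norm \<theta> = 1" using that cQ by auto
          then have "\<bar>(q - (3 * M / 4) *\<^sub>R e) \<bullet> \<theta>\<bar> < \<rho>"
            using Cauchy_Schwarz_ineq2[of "q - (3 * M / 4) *\<^sub>R e" \<theta>] qn by simp
          then show ?thesis by (simp add: inner_diff_left inner_commute[of e])
        qed
        have lower: "?m < q \<bullet> \<theta>" if "\<theta> \<in> closure Q" for \<theta>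
        proof -
          have "3 * M / 4 * c \<le> 3 * M / 4 * (\<theta> \<bullet> e)"
            using c(3)[OF that] M0 by (intro mult_left_mono) auto
          then have "5 * (c * M) / 8 < q \<bullet> \<theta>"
            using near[OF that] unfolding \<rho>_def abs_less_iff by (simp add: mult.commute[of c M])
          moreover have "c * M > 0" using c M0 by simp
          ultimately show ?thesis using mM by linarith
        qed
        have sx0: "sgn x0 \<in> closure Q"
          using x0(1) polar_region_iff[OF R(1) cQ] by (simp add: S_def)
        have "sgn x0 \<bullet> e \<le> 1"
          using Cauchy_Schwarz_ineq2[of "sgn x0" e] e sx0 cQ by auto
        then have "3 * M / 4 * (sgn x0 \<bullet> e) \<le> 3 * M / 4" using M0 by simp
        then have "q \<bullet> sgn x0 < M"
          using near[OF sx0] \<rho>M M0 unfolding abs_less_iff by linarith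
        then have upper: "q \<bullet> sgn x0 < f x0" by (simp add: M_def)
        show "\<exists>x\<in>interior (polar_region Q R1 R2). polar_map f G x = q \<and> G x \<bullet> sgn x \<le> 0 \<and> tangentially_nonpos f G L x"
          by (rule touching_point[OF R subQ f[unfolded S_def] m x0(1)[unfolded S_def] upper lower]) auto
      qed simp
      moreover have "emeasure lborel (ball ((3 * M / 4) *\<^sub>R e) \<rho>) = ennreal (\<omega> * \<rho> ^ d)"
        using \<rho> by (simp add: emeasure_ball \<omega>_def d_def)
      moreover have pos: "\<omega> * \<rho> ^ d > 0" using \<omega> \<rho> by simp
      ultimately have "ennreal (\<omega> * \<rho> ^ d) \<le> ennreal ?I" by (simp only:)
      then have le: "\<omega> * \<rho> ^ d \<le> ?I"
        using pos unfolding ennreal_le_iff2 by linarith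
      then have "\<rho> ^ d \<le> (1 / \<omega>) * ?I" using \<omega> by (simp add: field_simps)
      then have "(\<rho> ^ d) powr (1 / real d) \<le> ((1 / \<omega>) * ?I) powr (1 / real d)"
        using \<rho> by (intro powr_mono2) auto
      moreover have "(\<rho> ^ d) powr (1 / real d) = \<rho>"
        using \<rho> d by (simp add: powr_powr flip: powr_realpow)
      moreover have "((1 / \<omega>) * ?I) powr (1 / real d) = (1 / \<omega>) powr (1 / real d) * ?I powr (1 / real d)"
        by (rule powr_mult)
      ultimately have "\<rho> \<le> (1 / \<omega>) powr (1 / real d) * ?I powr (1 / real d)" by simp
      then have "(8 / c) * \<rho> \<le> (8 / c) * ((1 / \<omega>) powr (1 / real d) * ?I powr (1 / real d))"
        using c by (intro mult_left_mono) auto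
      moreover have "(8 / c) * \<rho> = M" using c by (simp add: \<rho>_def)
      ultimately have "M \<le> C2 * ?I powr (1 / real d)" by (simp add: C2_def mult.assoc)
      moreover have "C1 * ?m \<ge> 0" using c m0 by (simp add: C1_def)
      ultimately show ?thesis using sup_le by (simp add: M_def d_def)
    qed
  qed
  moreover have "C1 > 0" "C2 > 0" using c \<omega> by (auto simp: C1_def C2_def)
  ultimately show ?thesis by blast
qed

subsection \<open>Level sets around an interior maximum\<close>

text \<open>The inverse function theorem for derivatives given as plain functions. Of the derivative
  of the inverse only \<open>f' (g y) (g' y h) = h\<close> is kept, which is what implicit
  differentiation below uses.\<close>

lemma local_inverse:
  fixes f :: "'a::euclidean_space \<Rightarrow> 'a"
  assumes P: "open P" "a \<in> P"
    and der: "\<And>x. x \<in> P \<Longrightarrow> (f has_derivative f' x) (at x)"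
    and cont: "\<And>h. continuous_on P (\<lambda>x. f' x h)"
    and inj: "inj (f' a)"
  obtains U V g g' where "open U" "U \<subseteq> P" "a \<in> U" "open V" "homeomorphism U V f g"
    "\<And>y. y \<in> V \<Longrightarrow> (g has_derivative g' y) (at y)"
    "\<And>y h. y \<in> V \<Longrightarrow> f' (g y) (g' y h) = h"
proof -
  have bl: "bounded_linear (f' x)" if "x \<in> P" for x
    using der[OF that] has_derivative_bounded_linear by blast
  define F where "F x = Blinfun (f' x)" for x
  have F: "blinfun_apply (F x) = f' x" if "x \<in> P" for x
    using bl[OF that] by (simp add: F_def bounded_linear_Blinfun_apply)
  have derF: "(f has_derivative blinfun_apply (F x)) (at x)" if "x \<in> P" for x
    using der[OF that] F[OF that] by simp
  have contF: "continuous_on P F"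
  proof (rule continuous_on_blinfun_componentwise)
    fix i :: 'a
    show "continuous_on P (\<lambda>x. blinfun_apply (F x) i)"
      using cont[of i] F by (simp cong: continuous_on_cong)
  qed
  have lin: "linear (f' a)" using bl[OF P(2)] by (simp add: bounded_linear.linear)
  obtain k where k: "linear k" "k \<circ> f' a = id"
    using linear_injective_left_inverse[OF lin inj] by blast
  have "Blinfun k o\<^sub>L F a = id_blinfun"
  proof (rule blinfun_eqI)
    fix h
    show "blinfun_apply (Blinfun k o\<^sub>L F a) h = blinfun_apply id_blinfun h"
      using k P(2) by (simp add: F bounded_linear_Blinfun_apply linear_conv_bounded_linear fun_eq_iff)
  qed
  from inverse_function_theorem[OF P(1) derF contF P(2) this]
  obtain U V g g' where *: "open U" "U \<subseteq> P" "a \<in> U" "open V" "homeomorphism U V f g"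
    "\<And>y. y \<in> V \<Longrightarrow> (g has_derivative g' y) (at y)"
    "\<And>y. y \<in> V \<Longrightarrow> g' y = Hilbert_Choice.inv (blinfun_apply (F (g y)))"
    "\<And>y. y \<in> V \<Longrightarrow> bij (blinfun_apply (F (g y)))"
    by metis
  have "f' (g y) (g' y h) = h" if "y \<in> V" for y h
  proof -
    have "g y \<in> P" using *(2,5) that by (auto simp: homeomorphism_def)
    then have "f' (g y) = blinfun_apply (F (g y))" by (simp add: F)
    then show ?thesis using *(7,8)[OF that] by (simp add: bij_is_surj surj_f_inv_f)
  qed
  then show ?thesis using * that by blast
qed

text \<open>The case of part 1 with content: the maximum exceeds a bound \<open>m\<close> for the
  boundary values. Everything above the level \<open>m\<close> then happens in the interior of
  \<open>A\<close>.\<close>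

locale interior_maximum =
  fixes A :: "'a::euclidean_space set" and v :: "'a \<Rightarrow> real" and G :: "'a \<Rightarrow> 'a"
    and L :: "'a \<Rightarrow> 'a \<Rightarrow> 'a" and m :: real and x0 :: 'a
  assumes convex_A: "convex A" and compact_A: "compact A" and C2: "C2_data A v G L"
    and frontier_le: "\<And>x. x \<in> frontier A \<Longrightarrow> v x \<le> m"
    and x0: "x0 \<in> A" "\<And>x. x \<in> A \<Longrightarrow> v x \<le> v x0"
    and gap: "m < v x0"
begin

definition superlevel :: "real \<Rightarrow> 'a set" where
  "superlevel t = {x \<in> A. t \<le> v x}"

text \<open>The map \<Phi> of the overview; above the level \<open>m\<close> it points against the
  gradient.\<close>

definition level_map :: "'a \<Rightarrow> 'a" where
  "level_map x = (m - v x) *\<^sub>R sgn (G x)"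

definition level_map_deriv :: "'a \<Rightarrow> 'a \<Rightarrow> 'a" where
  "level_map_deriv x h = (m - v x) *\<^sub>R ((L x h - (sgn (G x) \<bullet> L x h) *\<^sub>R sgn (G x)) /\<^sub>R norm (G x))
     - (G x \<bullet> h) *\<^sub>R sgn (G x)"

definition regular :: "'a set" where
  "regular = {x \<in> interior A. G x \<noteq> 0 \<and> m < v x}"

lemma cont_v: "continuous_on A v" and cont_G: "continuous_on A G"
  using C2_data_continuous[OF C2] by auto

lemma regular_subset: "regular \<subseteq> interior A" "regular \<subseteq> A"
  using interior_subset by (auto simp: regular_def)

lemma open_regular: "open regular"
proof -
  have "continuous_on (interior A) G" "continuous_on (interior A) v"
    using cont_G cont_v interior_subset continuous_on_subset by blast+
  then have "open (interior A \<inter> G -` (- {0}))" "open (interior A \<inter> v -` {m<..})"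
    by (intro continuous_open_preimage; simp add: open_Compl)+
  moreover have "regular = (interior A \<inter> G -` (- {0})) \<inter> (interior A \<inter> v -` {m<..})"
    by (auto simp: regular_def)
  ultimately show ?thesis by auto
qed

lemma v_deriv: "x \<in> interior A \<Longrightarrow> (v has_derivative (\<lambda>h. G x \<bullet> h)) (at x)"
  and G_deriv: "x \<in> interior A \<Longrightarrow> (G has_derivative L x) (at x)"
  using C2_data_at[OF C2] by auto

lemma interiorI_gt: "x \<in> A \<Longrightarrow> m < v x \<Longrightarrow> x \<in> interior A"
  using frontier_le[of x] compact_imp_closed[OF compact_A]
  by (auto simp: frontier_def)

lemma level_map_has_derivative:
  assumes "x \<in> regular"
  shows "(level_map has_derivative level_map_deriv x) (at x)"
proof -
  have x: "x \<in> interior A" "G x \<noteq> 0" using assms by (auto simp: regular_def)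
  have "((\<lambda>x. m - v x) has_derivative (\<lambda>h. - (G x \<bullet> h))) (at x)"
    using has_derivative_diff[OF has_derivative_const[of m] v_deriv[OF x(1)]] by simp
  moreover have "((\<lambda>x. sgn (G x)) has_derivative (\<lambda>h. (L x h - (sgn (G x) \<bullet> L x h) *\<^sub>R sgn (G x)) /\<^sub>R norm (G x))) (at x)"
    by (rule has_derivative_compose[OF G_deriv[OF x(1)] sgn_has_derivative[OF x(2)]])
  ultimately have "((\<lambda>x. (m - v x) *\<^sub>R sgn (G x)) has_derivative
      (\<lambda>h. (m - v x) *\<^sub>R ((L x h - (sgn (G x) \<bullet> L x h) *\<^sub>R sgn (G x)) /\<^sub>R norm (G x)) + (- (G x \<bullet> h)) *\<^sub>R sgn (G x))) (at x)"
    by (rule has_derivative_scaleR)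
  then show ?thesis
    by (simp add: level_map_def[abs_def] level_map_deriv_def[abs_def])
qed

lemma linear_level_map_deriv: "x \<in> regular \<Longrightarrow> linear (level_map_deriv x)"
  using level_map_has_derivative has_derivative_linear by blast

lemma continuous_level_map_deriv: "continuous_on regular (\<lambda>x. level_map_deriv x h)"
proof -
  have c: "continuous_on regular v" "continuous_on regular G" "continuous_on regular (\<lambda>x. L x h)"
    using cont_v cont_G C2_dataD(3)[OF C2] regular_subset(2) continuous_on_subset by blast+
  have "continuous_on regular (\<lambda>x. sgn (G x))"
    by (intro continuous_on_sgn c) (auto simp: regular_def)
  then show ?thesis
    unfolding level_map_deriv_def by (intro continuous_intros c) (auto simp: regular_def)
qed

lemma inner_level_map_deriv:
  assumes "x \<in> regular"
  shows "sgn (G x) \<bullet> level_map_deriv x h = - (G x \<bullet> h)"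
  using assms inner_sgn_sgn[of "G x"]
  by (simp add: regular_def level_map_deriv_def inner_diff_right)

lemma level_map_norm:
  assumes "x \<in> regular"
  shows "norm (level_map x) = v x - m" "sgn (level_map x) = - sgn (G x)"
proof -
  have x: "G x \<noteq> 0" "m < v x" using assms by (auto simp: regular_def)
  then show n: "norm (level_map x) = v x - m" by (simp add: level_map_def norm_sgn)
  have "inverse (v x - m) * (m - v x) = -1" using x(2) by (simp add: field_simps)
  then show "sgn (level_map x) = - sgn (G x)"
    unfolding sgn_div_norm[of "level_map x"] n by (simp add: level_map_def)
qed

lemma negligible_level_map_degenerate:
  "negligible (level_map ` {x \<in> regular. \<not> inj (level_map_deriv x)})"
  by (rule baby_Sard_euclidean[where f'=level_map_deriv])
     (auto intro: has_derivative_at_withinI level_map_has_derivative)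

text \<open>The length of the slope is the height of \<open>v\<close> above \<open>m\<close>, so a
  displacement that moves the slope \<open>y\<close> orthogonally to itself is tangent to the level
  set, whose normal is \<open>y\<close>. This is the envelope principle used to differentiate
  support functions.\<close>

lemma inner_inverse_deriv:
  assumes x: "x \<in> regular" "level_map x = y" and k: "level_map_deriv x k = h" and orth: "y \<bullet> h = 0"
  shows "y \<bullet> k = 0" "G x \<bullet> k = 0"
proof -
  have "sgn (G x) \<bullet> h = - (G x \<bullet> k)"
    using inner_level_map_deriv[OF x(1), of k] k by simp
  moreover have "(m - v x) * (sgn (G x) \<bullet> h) = 0"
    using orth x(2) by (metis level_map_def inner_scaleR_left)
  ultimately show "G x \<bullet> k = 0" using x(1) by (auto simp: regular_def)
  then show "y \<bullet> k = 0" using x(2) by (auto simp: level_map_def sgn_div_norm)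
qed

section \<open>Slopes with two support points\<close>

definition double_contacts :: "('a \<times> 'a) set \<Rightarrow> 'a set" where
  "double_contacts W = {y. \<exists>(x, x')\<in>W. x \<noteq> x' \<and> level_map x = y \<and> level_map x' = y \<and> y \<bullet> x = y \<bullet> x'}"

text \<open>Local inverses \<open>X\<close> and \<open>Y\<close> of \<open>level_map\<close> turn
  double contacts into zeros of the single function \<open>w\<close>, whose derivative does not
  vanish there: the slopes lie on a hypersurface.\<close>

lemma double_contact_local:
  assumes a: "a \<in> regular" "inj (level_map_deriv a)" and a': "a' \<in> regular" "inj (level_map_deriv a')"
  obtains U U' where "open U" "open U'" "a \<in> U" "a' \<in> U'"
    "negligible (double_contacts (U \<times> U'))"
proof -
  note inv = local_inverse[OF open_regular _ level_map_has_derivative continuous_level_map_deriv]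
  obtain U V X X' where U: "open U" "U \<subseteq> regular" "a \<in> U" "open V" "homeomorphism U V level_map X"
    "\<And>y. y \<in> V \<Longrightarrow> (X has_derivative X' y) (at y)"
    "\<And>y h. y \<in> V \<Longrightarrow> level_map_deriv (X y) (X' y h) = h"
    by (rule inv[OF a(1) _ a(2)], assumption, rule that)
  obtain U' V' Y Y' where U': "open U'" "U' \<subseteq> regular" "a' \<in> U'" "open V'" "homeomorphism U' V' level_map Y"
    "\<And>y. y \<in> V' \<Longrightarrow> (Y has_derivative Y' y) (at y)"
    "\<And>y h. y \<in> V' \<Longrightarrow> level_map_deriv (Y y) (Y' y h) = h"
    by (rule inv[OF a'(1) _ a'(2)], assumption, rule that)
  define N where "N = double_contacts (U \<times> U')"
  define w where "w y = y \<bullet> (X y - Y y)" for y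
  have N: "y \<in> V" "y \<in> V'" "X y \<noteq> Y y" "w y = 0" "X y \<in> regular" "Y y \<in> regular"
    "level_map (X y) = y" "level_map (Y y) = y" if "y \<in> N" for y
  proof -
    obtain x x' where x: "x \<in> U" "x' \<in> U'" "x \<noteq> x'" "level_map x = y" "level_map x' = y" "y \<bullet> x = y \<bullet> x'"
      using \<open>y \<in> N\<close> by (auto simp: N_def double_contacts_def)
    have "X (level_map x) = x" "Y (level_map x') = x'" "level_map x \<in> V" "level_map x' \<in> V'"
      using x(1,2) U(5) U'(5) by (auto simp: homeomorphism_def)
    then have "X y = x" "Y y = x'" "y \<in> V" "y \<in> V'" using x by simp_all
    then show "y \<in> V" "y \<in> V'" "X y \<noteq> Y y" "w y = 0" "X y \<in> regular" "Y y \<in> regular"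
      "level_map (X y) = y" "level_map (Y y) = y"
      using x U(2) U'(2) by (auto simp: w_def inner_diff_right)
  qed
  define \<eta> where "\<eta> y = X y - Y y" for y
  define w' where "w' y h = y \<bullet> (X' y h - Y' y h) + h \<bullet> \<eta> y" for y h
  have w_der: "(w has_derivative w' y) (at y)" if "y \<in> N" for y
    unfolding w_def[abs_def] w'_def[abs_def] \<eta>_def
    using N[OF that]
    by (intro has_derivative_inner has_derivative_diff has_derivative_ident U(6) U'(6))
  \<comment> \<open>Level sets have normal \<open>y\<close> at the preimages of \<open>y\<close>, so along \<open>\<eta> y\<close>, which is orthogonal to \<open>y\<close>,
    only the explicit factor \<open>y\<close> of \<open>w\<close> contributes.\<close>
  have w'_\<eta>: "w' y (\<eta> y) = (norm (\<eta> y))\<^sup>2" if y: "y \<in> N" for y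
  proof -
    have orth: "y \<bullet> \<eta> y = 0" using N(4)[OF y] by (simp add: w_def \<eta>_def)
    have "y \<bullet> X' y (\<eta> y) = 0" "y \<bullet> Y' y (\<eta> y) = 0"
      using inner_inverse_deriv(1)[OF N(5,7)[OF y] U(7) orth] inner_inverse_deriv(1)[OF N(6,8)[OF y] U'(7) orth] N[OF y] by auto
    then show ?thesis by (simp add: w'_def inner_diff_right power2_norm_eq_inner)
  qed
  \<comment> \<open>As \<open>w\<close> vanishes on \<open>N\<close>, the identity agrees there with
    \<open>z - (?c * w z) *\<^sub>R \<eta> y\<close> as a function of \<open>z\<close>, whose
    derivative at \<open>y\<close> kills \<open>\<eta> y\<close>. Sard's theorem for the identity
    thus replaces a submanifold argument.\<close>
  have "negligible ((\<lambda>y. y) ` N)"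
  proof (rule baby_Sard_euclidean)
    fix y assume y: "y \<in> N"
    let ?c = "1 / (norm (\<eta> y))\<^sup>2"
    have \<eta>0: "\<eta> y \<noteq> 0" using N(3)[OF y] by (simp add: \<eta>_def)
    have "((\<lambda>z. z - (?c * w z) *\<^sub>R \<eta> y) has_derivative (\<lambda>h. h - (?c * w' y h) *\<^sub>R \<eta> y)) (at y within N)"
      by (intro has_derivative_diff has_derivative_ident has_derivative_scaleR_left
          has_derivative_mult_right has_derivative_at_withinI[OF w_der[OF y]])
    then show "((\<lambda>y. y) has_derivative (\<lambda>h. h - (?c * w' y h) *\<^sub>R \<eta> y)) (at y within N)"
      by (rule has_derivative_transform_within[where d=1]) (use y in \<open>simp_all add: N(4)\<close>)
    have "\<eta> y - (?c * w' y (\<eta> y)) *\<^sub>R \<eta> y = 0"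
      using w'_\<eta>[OF y] \<eta>0 by simp
    moreover have "0 - (?c * w' y 0) *\<^sub>R \<eta> y = 0"
      using w_der[OF y] has_derivative_linear linear_0 by fastforce
    ultimately show "\<not> inj (\<lambda>h. h - (?c * w' y h) *\<^sub>R \<eta> y)"
      using \<eta>0 unfolding inj_def by metis
  qed
  then have "negligible N" by simp
  then show ?thesis using that U U' unfolding N_def by blast
qed

lemma negligible_double_contact:
  "negligible (double_contacts ({x \<in> regular. inj (level_map_deriv x)} \<times> {x \<in> regular. inj (level_map_deriv x)}))"
    (is "negligible (double_contacts (?R \<times> ?R))")
proof -
  define \<F> where "\<F> = {W. open W \<and> negligible (double_contacts W)}"
  \<comment> \<open>The product space is second countable, so countably many of the local null sets
    suffice.\<close>
  obtain \<G> where \<G>: "\<G> \<subseteq> \<F>" "countable \<G>" "\<Union>\<G> = \<Union>\<F>"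
    using Lindelof[of \<F>] by (auto simp: \<F>_def)
  have "negligible (\<Union>(double_contacts ` \<G>))"
    using \<G>(1,2) by (intro negligible_countable_Union) (auto simp: \<F>_def)
  moreover have "double_contacts (?R \<times> ?R) \<subseteq> \<Union>(double_contacts ` \<G>)"
  proof
    fix y assume "y \<in> double_contacts (?R \<times> ?R)"
    then obtain x x' where x: "x \<in> regular" "inj (level_map_deriv x)" "x' \<in> regular" "inj (level_map_deriv x')"
      and y: "x \<noteq> x'" "level_map x = y" "level_map x' = y" "y \<bullet> x = y \<bullet> x'"
      by (auto simp: double_contacts_def)
    obtain U U' where "open U" "open U'" "x \<in> U" "x' \<in> U'" "negligible (double_contacts (U \<times> U'))"
      by (rule double_contact_local[OF x]) (rule that)
    then have "U \<times> U' \<in> \<F>" "(x, x') \<in> U \<times> U'" by (auto simp: \<F>_def open_Times)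
    then have "(x, x') \<in> \<Union>\<G>" using \<G>(3) by blast
    then obtain W where "W \<in> \<G>" "(x, x') \<in> W" by blast
    moreover from this(2) have "y \<in> double_contacts W" using y by (auto simp: double_contacts_def)
    ultimately show "y \<in> \<Union>(double_contacts ` \<G>)" by blast
  qed
  ultimately show ?thesis by (rule negligible_subset)
qed

end

section \<open>Support points at which the gradient vanishes\<close>

lemma quadratic_bound_at_critical_point:
  fixes v :: "'a::euclidean_space \<Rightarrow> real"
  assumes A: "convex A" and C2: "C2_data A v G L"
    and K: "K \<ge> 0" "\<And>x h. x \<in> A \<Longrightarrow> norm (L x h) \<le> K * norm h"
    and x: "x \<in> A" "G x = 0" and z: "z \<in> A"
  shows "\<bar>v z - v x\<bar> \<le> K * (norm (z - x))\<^sup>2"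
proof -
  \<comment> \<open>The gradient vanishes at \<open>x\<close> and is Lipschitz with constant
    \<open>K\<close> on the convex set \<open>A\<close>; a second mean value estimate along the
    segment gives the square.\<close>
  have G: "norm (G y) \<le> K * norm (y - x)" if "y \<in> A" for y
    using differentiable_bound[OF A C2_dataD(2)[OF C2] _ that x(1), of K] K x(2) onorm_le[of "L _" K]
    by simp
  define S where "S = closed_segment x z"
  have SA: "S \<subseteq> A" using x(1) z A by (simp add: S_def closed_segment_subset)
  have "norm (v z - v x) \<le> (K * norm (z - x)) * norm (z - x)"
  proof (rule differentiable_bound[of S v "\<lambda>y h. G y \<bullet> h"])
    fix y assume y: "y \<in> S"
    then show "(v has_derivative (\<lambda>h. G y \<bullet> h)) (at y within S)"
      using C2_dataD(1)[OF C2] SA has_derivative_subset by blast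
    have "norm (y - x) \<le> norm (z - x)"
      using y segment_bound1 by (metis S_def norm_minus_commute)
    then have "norm (G y) \<le> K * norm (z - x)"
      using G[of y] y SA K(1) by (meson mult_left_mono order_trans subsetD)
    then show "onorm (\<lambda>h. G y \<bullet> h) \<le> K * norm (z - x)"
      by (intro onorm_le) (metis Cauchy_Schwarz_ineq2 mult_right_mono norm_ge_zero order_trans real_norm_def)
  qed (auto simp: S_def)
  then show ?thesis by (simp add: power2_eq_square mult.assoc)
qed

context interior_maximum
begin

lemma compact_superlevel: "compact (superlevel t)"
proof -
  have "superlevel t = A \<inter> (A \<inter> v -` {t..})" by (auto simp: superlevel_def)
  moreover have "closedin (top_of_set A) (A \<inter> v -` {t..})"
    by (intro continuous_closedin_preimage cont_v closed_atLeast)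
  ultimately show ?thesis using closedin_compact[OF compact_A] by (metis closedin_def inf.absorb2 topspace_euclidean_subtopology)
qed

text \<open>A point above the level \<open>m\<close> is interior, so by continuity it has room in
  every direction. This forces maxima of linear functions over a superlevel set to lie exactly on
  the level.\<close>

lemma superlevel_push:
  assumes z: "z \<in> A" "t < v z" "m < v z" and w: "w \<noteq> 0"
  obtains s where "s > 0" "z + s *\<^sub>R w \<in> A" "t < v (z + s *\<^sub>R w)"
proof -
  have zi: "z \<in> interior A" using interiorI_gt z by blast
  define h where "h s = z + s *\<^sub>R w" for s :: real
  have "continuous (at z) v" using has_derivative_continuous[OF v_deriv[OF zi]] .
  then have "eventually (\<lambda>y. t < v y) (nhds z)"
    using z(2) by (simp add: continuous_at_imp_continuous_within isCont_def tendsto_at_iff_tendsto_nhds order_tendstoD(1))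
  moreover have "eventually (\<lambda>y. y \<in> interior A) (nhds z)"
    using zi open_interior eventually_nhds_in_open by blast
  ultimately have "eventually (\<lambda>y. t < v y \<and> y \<in> interior A) (nhds z)"
    by (rule eventually_conj)
  then obtain e where e: "e > 0" "\<And>y. dist y z < e \<Longrightarrow> t < v y \<and> y \<in> interior A"
    unfolding eventually_nhds_metric by blast
  define s where "s = e / (2 * norm w)"
  have "s > 0" using e w by (simp add: s_def)
  moreover have "dist (z + s *\<^sub>R w) z < e" using e w by (simp add: s_def dist_norm)
  ultimately show ?thesis using e(2) interior_subset that by blast
qed

lemma support_level:
  assumes x: "x \<in> superlevel t" and max: "\<And>z. z \<in> superlevel t \<Longrightarrow> y \<bullet> z \<le> y \<bullet> x"
    and y: "y \<noteq> 0" and t: "m < t"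
  shows "v x = t"
proof (rule ccontr)
  assume "v x \<noteq> t"
  then have "x \<in> A" "t < v x" "m < v x" using x t by (auto simp: superlevel_def)
  then obtain s where s: "s > 0" "x + s *\<^sub>R y \<in> A" "t < v (x + s *\<^sub>R y)"
    using superlevel_push y by metis
  then have "y \<bullet> (x + s *\<^sub>R y) \<le> y \<bullet> x" by (intro max) (simp add: superlevel_def)
  then have "s * (y \<bullet> y) \<le> 0" by (simp add: inner_add_right)
  moreover have "s * (y \<bullet> y) > 0" using s(1) y by simp
  ultimately show False by linarith
qed

text \<open>
  Sard's theorem for real functions fails for C2 functions in high dimensions, so that support points
  with \<open>\<nabla>v = 0\<close> need another argument. Parametrised by \<open>u = s \<theta>\<close>, where \<open>s\<close> is the value of the support
  function in direction \<open>\<theta>\<close> relative to \<open>x0\<close>, the level of such points varies quadratically, because it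
  is at least the value of \<open>v\<close> at a displaced critical point. Hence the map from \<open>u\<close> to the
  slope has a singular derivative.
\<close>

definition critical_contacts :: "real \<Rightarrow> ('a \<times> 'a) set" where
  "critical_contacts t0 = {(u, x). u \<noteq> 0 \<and> x \<in> A \<and> t0 \<le> v x \<and> G x = 0 \<and>
     u \<bullet> (x - x0) = u \<bullet> u \<and> (\<forall>z\<in>superlevel (v x). u \<bullet> z \<le> u \<bullet> x)}"

text \<open>The half-space is bounded by the hyperplane through \<open>x0 + u\<close> with normal
  \<open>u\<close>: \<open>u\<close> is the foot of the perpendicular from \<open>x0\<close>, as in
  pedal coordinates.\<close>

definition slab_sup :: "'a \<Rightarrow> real" where
  "slab_sup u = (SUP z\<in>{z \<in> A. u \<bullet> u \<le> u \<bullet> (z - x0)}. v z)"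

lemma slab_sup_upper: "z \<in> A \<Longrightarrow> u \<bullet> u \<le> u \<bullet> (z - x0) \<Longrightarrow> v z \<le> slab_sup u"
  unfolding slab_sup_def using x0 by (intro cSUP_upper) (auto intro!: bdd_aboveI2[of _ _ "v x0"])

text \<open>A point of the half-space with a larger value could be pushed along \<open>u\<close>
  beyond the supporting hyperplane of the superlevel set. Hence the level is a function of
  \<open>u\<close> alone, whichever critical support point is chosen.\<close>

lemma slab_sup_eq:
  assumes t0: "m < t0" and c: "(u, x) \<in> critical_contacts t0"
  shows "slab_sup u = v x"
  unfolding slab_sup_def
proof (rule cSup_eq_maximum)
  show "v x \<in> v ` {z \<in> A. u \<bullet> u \<le> u \<bullet> (z - x0)}"
    using c by (auto simp: critical_contacts_def)
  fix t assume "t \<in> v ` {z \<in> A. u \<bullet> u \<le> u \<bullet> (z - x0)}"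
  then obtain z where z: "z \<in> A" "u \<bullet> u \<le> u \<bullet> (z - x0)" "t = v z" by auto
  have ux: "u \<noteq> 0" "u \<bullet> (x - x0) = u \<bullet> u" "m < v x"
    and max: "\<And>z. z \<in> superlevel (v x) \<Longrightarrow> u \<bullet> z \<le> u \<bullet> x"
    using c t0 by (auto simp: critical_contacts_def)
  show "t \<le> v x"
  proof (rule ccontr)
    assume "\<not> t \<le> v x"
    then have "v x < v z" "m < v z" using z ux by auto
    then obtain s where s: "s > 0" "z + s *\<^sub>R u \<in> A" "v x < v (z + s *\<^sub>R u)"
      using superlevel_push[OF z(1) _ _ ux(1)] by metis
    then have "u \<bullet> (z + s *\<^sub>R u) \<le> u \<bullet> x" by (intro max) (simp add: superlevel_def)
    then have "s * (u \<bullet> u) \<le> 0" using z(2) ux(2) by (simp add: inner_add_right inner_diff_right)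
    moreover have "s * (u \<bullet> u) > 0" using s(1) ux(1) by simp
    ultimately show False by linarith
  qed
qed

text \<open>Shifting the critical point \<open>x1\<close> along \<open>u2\<close> by a distance
  linear in \<open>u1 - u2\<close> brings it into the half-space of \<open>u2\<close>, and near a
  critical point such a shift costs only a quadratic loss of \<open>v\<close>.\<close>

lemma slab_sup_quadratic:
  assumes t0: "m < t0" and u0: "u0 \<noteq> 0"
  obtains C r where "r > 0" "C \<ge> 0"
    "\<And>u1 x1 u2 x2. (u1, x1) \<in> critical_contacts t0 \<Longrightarrow> (u2, x2) \<in> critical_contacts t0 \<Longrightarrow>
       norm (u1 - u0) < r \<Longrightarrow> norm (u2 - u0) < r \<Longrightarrow> slab_sup u1 - slab_sup u2 \<le> C * (norm (u1 - u2))\<^sup>2"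
proof -
  obtain K where K: "K > 0" "\<And>x h. x \<in> A \<Longrightarrow> norm (L x h) \<le> K * norm h"
    using C2_data_bounded[OF C2 compact_A] by metis
  obtain B where B: "B > 0" "\<And>x. x \<in> A \<Longrightarrow> norm x \<le> B"
    using compact_imp_bounded[OF compact_A] bounded_pos by metis
  have "superlevel t0 \<subseteq> interior A"
    using t0 interiorI_gt by (auto simp: superlevel_def)
  then obtain \<delta> where \<delta>: "\<delta> > 0" "(\<Union>x\<in>superlevel t0. ball x \<delta>) \<subseteq> interior A"
    using compact_subset_open_imp_ball_epsilon_subset[OF compact_superlevel open_interior] by metis
  \<comment> \<open>\<open>6 * B\<close> bounds \<open>u2 + u1 - (x1 - x0)\<close>, and division by
    \<open>norm u2 \<ge> norm u0 / 2\<close> doubles it. The two parts of \<open>r\<close> ensure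
    this lower bound and a shift shorter than \<open>\<delta>\<close>, which stays in
    \<open>A\<close>.\<close>
  define c where "c = 12 * B / norm u0"
  have c: "c > 0" using B u0 by (simp add: c_def)
  define r where "r = min (norm u0 / 2) (\<delta> / (2 * c))"
  have r: "r > 0" using u0 \<delta> c by (simp add: r_def)
  have main: "slab_sup u1 - slab_sup u2 \<le> K * c\<^sup>2 * (norm (u1 - u2))\<^sup>2"
    if c1: "(u1, x1) \<in> critical_contacts t0" and c2: "(u2, x2) \<in> critical_contacts t0"
      and near: "norm (u1 - u0) < r" "norm (u2 - u0) < r" for u1 x1 u2 x2
  proof -
    have ub: "norm u \<le> 2 * B" if "(u, x) \<in> critical_contacts t0" for u x
    proof -
      have u: "u \<noteq> 0" "x \<in> A" "u \<bullet> (x - x0) = u \<bullet> u" using that by (auto simp: critical_contacts_def)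
      have "norm u * norm u = u \<bullet> (x - x0)" using u by (simp add: power2_norm_eq_inner flip: power2_eq_square)
      also have "\<dots> \<le> norm u * norm (x - x0)" by (rule norm_cauchy_schwarz)
      finally have "norm u \<le> norm (x - x0)" using u(1) by simp
      also have "\<dots> \<le> 2 * B" using norm_triangle_ineq4[of x x0] B(2)[OF u(2)] B(2)[OF x0(1)] by simp
      finally show ?thesis .
    qed
    have x1: "x1 \<in> A" "t0 \<le> v x1" "G x1 = 0" "u1 \<bullet> (x1 - x0) = u1 \<bullet> u1"
      using c1 by (auto simp: critical_contacts_def)
    have u2: "norm u2 \<ge> norm u0 / 2"
      using norm_triangle_sub[of u0 u2] near(2) by (simp add: norm_minus_commute r_def)
    then have u20: "norm u2 > 0" using u0 by (meson half_gt_zero less_le_trans zero_less_norm_iff)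
    \<comment> \<open>The amount by which \<open>x1\<close> misses the half-space of
      \<open>u2\<close>; \<open>h\<close> is the shortest shift that repairs it. Because
      \<open>u1 \<bullet> (x1 - x0) = u1 \<bullet> u1\<close>, the factor \<open>u2 - u1\<close>
      splits off.\<close>
    define \<kappa> where "\<kappa> = u2 \<bullet> u2 - u2 \<bullet> (x1 - x0)"
    define h where "h = (max 0 \<kappa> / (norm u2)\<^sup>2) *\<^sub>R u2"
    have "\<kappa> = (u2 - u1) \<bullet> u2 + (u2 - u1) \<bullet> u1 - (u2 - u1) \<bullet> (x1 - x0)"
      using x1(4) by (simp add: \<kappa>_def inner_diff_left inner_diff_right inner_commute[of u1 u2])
    then have "\<kappa> = (u2 - u1) \<bullet> (u2 + u1 - (x1 - x0))"
      by (simp add: inner_add_right inner_diff_right)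
    then have "\<kappa> \<le> norm (u2 - u1) * norm (u2 + u1 - (x1 - x0))"
      using norm_cauchy_schwarz by metis
    also have "norm (u2 + u1 - (x1 - x0)) \<le> 6 * B"
      using norm_triangle_ineq4[of "u2 + u1" "x1 - x0"] norm_triangle_ineq[of u2 u1] norm_triangle_ineq4[of x1 x0]
        ub[OF c1] ub[OF c2] B(2)[OF x1(1)] B(2)[OF x0(1)] by linarith
    then have "norm (u2 - u1) * norm (u2 + u1 - (x1 - x0)) \<le> norm (u2 - u1) * (6 * B)"
      by (intro mult_left_mono) auto
    finally have "max 0 \<kappa> \<le> 6 * B * norm (u1 - u2)"
      using B(1) by (simp add: norm_minus_commute mult.commute)
    then have "max 0 \<kappa> / norm u2 \<le> 6 * B * norm (u1 - u2) / (norm u0 / 2)"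
      using u2 u0 by (intro frac_le) auto
    moreover have "norm h = max 0 \<kappa> / norm u2"
      using u20 by (simp add: h_def power2_eq_square)
    ultimately have hn: "norm h \<le> c * norm (u1 - u2)" by (simp add: c_def)
    have "norm (u1 - u2) < 2 * r" using norm_triangle_ineq4[of "u1 - u0" "u2 - u0"] near by simp
    then have "c * norm (u1 - u2) < c * (2 * r)" using c by (rule mult_strict_left_mono)
    also have "\<dots> \<le> c * (2 * (\<delta> / (2 * c)))" using c by (intro mult_left_mono) (auto simp: r_def)
    also have "\<dots> = \<delta>" using c by simp
    finally have "norm h < \<delta>" using hn by simp
    then have "x1 + h \<in> ball x1 \<delta>" by (simp add: dist_norm)
    moreover have "x1 \<in> superlevel t0" using x1 by (simp add: superlevel_def)
    ultimately have zA: "x1 + h \<in> A" using \<delta>(2) interior_subset by blast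
    have "u2 \<bullet> h = max 0 \<kappa>" using u20 by (simp add: h_def power2_norm_eq_inner)
    then have "u2 \<bullet> u2 \<le> u2 \<bullet> (x1 + h - x0)" by (simp add: \<kappa>_def inner_add_right inner_diff_right)
    then have "v (x1 + h) \<le> slab_sup u2" by (rule slab_sup_upper[OF zA])
    moreover have "\<bar>v (x1 + h) - v x1\<bar> \<le> K * (norm h)\<^sup>2"
      using quadratic_bound_at_critical_point[OF convex_A C2 _ K(2) x1(1,3) zA] K(1) by simp
    moreover have "slab_sup u1 = v x1" by (rule slab_sup_eq[OF t0 c1])
    moreover have "K * (norm h)\<^sup>2 \<le> K * (c * norm (u1 - u2))\<^sup>2"
      using hn K(1) by (intro mult_left_mono power_mono) auto
    ultimately show ?thesis by (simp add: power_mult_distrib mult.assoc)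
  qed
  show ?thesis using that[OF r _ main] K(1) by simp
qed

text \<open>Relative to the set of parameters, \<open>slab_sup\<close> has derivative 0 by the
  quadratic estimate. So only \<open>sgn\<close> contributes to the derivative of the map, and its
  derivative annihilates the radial direction.\<close>

lemma negligible_critical_contacts:
  assumes t0: "m < t0"
  shows "negligible ((\<lambda>u. (slab_sup u - m) *\<^sub>R sgn u) ` (fst ` critical_contacts t0))"
proof (rule baby_Sard_euclidean)
  let ?E = "fst ` critical_contacts t0"
  fix u0 assume u0: "u0 \<in> ?E"
  then have u00: "u0 \<noteq> 0" by (auto simp: critical_contacts_def)
  obtain C r where C: "r > 0" "C \<ge> 0"
    "\<And>u1 x1 u2 x2. (u1, x1) \<in> critical_contacts t0 \<Longrightarrow> (u2, x2) \<in> critical_contacts t0 \<Longrightarrow>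
       norm (u1 - u0) < r \<Longrightarrow> norm (u2 - u0) < r \<Longrightarrow> slab_sup u1 - slab_sup u2 \<le> C * (norm (u1 - u2))\<^sup>2"
    by (rule slab_sup_quadratic[OF t0 u00]) (rule that)
  have "(slab_sup has_derivative (\<lambda>_. 0)) (at u0 within ?E)"
    unfolding has_derivative_within_alt
  proof (intro conjI allI impI)
    fix e :: real assume e: "e > 0"
    define d where "d = min r (e / (C + 1))"
    have d: "d > 0" using C e by (simp add: d_def)
    have "norm (slab_sup u - slab_sup u0 - 0) \<le> e * norm (u - u0)" if "u \<in> ?E" "norm (u - u0) < d" for u
    proof -
      have r: "norm (u - u0) < r" "norm (u0 - u0) < r" using that C(1) by (auto simp: d_def)
      obtain x x' where "(u, x) \<in> critical_contacts t0" "(u0, x') \<in> critical_contacts t0"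
        using \<open>u \<in> ?E\<close> u0 by force
      then have "\<bar>slab_sup u - slab_sup u0\<bar> \<le> C * (norm (u - u0))\<^sup>2"
        using C(3)[of u x u0 x'] C(3)[of u0 x' u x] r by (simp add: norm_minus_commute)
      also have "\<dots> = (C * norm (u - u0)) * norm (u - u0)" by (simp add: power2_eq_square)
      also have "\<dots> \<le> e * norm (u - u0)"
      proof (rule mult_right_mono)
        have "norm (u - u0) \<le> e / (C + 1)" using that by (simp add: d_def)
        then have "(C + 1) * norm (u - u0) \<le> e" using C(2) by (simp add: field_simps)
        then show "C * norm (u - u0) \<le> e"
            using norm_ge_zero[of "u - u0"] unfolding distrib_right by linarith
      qed simp
      finally show ?thesis by simp
    qed
    then show "\<exists>d>0. \<forall>u\<in>?E. norm (u - u0) < d \<longrightarrow> norm (slab_sup u - slab_sup u0 - 0) \<le> e * norm (u - u0)"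
      using d by blast
  qed simp
  from has_derivative_scaleR[OF has_derivative_diff[OF this has_derivative_const[of m]]
      has_derivative_at_withinI[OF sgn_has_derivative[OF u00]]]
  show "((\<lambda>u. (slab_sup u - m) *\<^sub>R sgn u) has_derivative
      (\<lambda>h. (slab_sup u0 - m) *\<^sub>R ((h - (sgn u0 \<bullet> h) *\<^sub>R sgn u0) /\<^sub>R norm u0))) (at u0 within ?E)"
    by simp
  have "sgn u0 \<bullet> u0 = norm u0"
    using u00 by (simp add: sgn_div_norm power2_norm_eq_inner[symmetric] power2_eq_square)
  then have "u0 - (sgn u0 \<bullet> u0) *\<^sub>R sgn u0 = 0"
    using u00 by (simp add: sgn_div_norm)
  then show "\<not> inj (\<lambda>h. (slab_sup u0 - m) *\<^sub>R ((h - (sgn u0 \<bullet> h) *\<^sub>R sgn u0) /\<^sub>R norm u0))"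
    using u00 unfolding inj_def by (metis diff_zero inner_zero_right scaleR_zero_left scaleR_zero_right)
qed

section \<open>Almost every slope comes from a unique, nondegenerate support point\<close>

definition strict_contacts :: "'a set" where
  "strict_contacts = {x \<in> regular. inj (level_map_deriv x) \<and>
     (\<forall>z\<in>A. z \<noteq> x \<longrightarrow> v x \<le> v z \<longrightarrow> 0 < G x \<bullet> (z - x))}"

text \<open>Every direction with \<open>G x \<bullet> h > 0\<close> leads into the superlevel set,
  hence satisfies \<open>y \<bullet> h \<le> 0\<close>. One half-space lying in the other forces
  opposite normals.\<close>

lemma sgn_gradient_at_support:
  assumes x: "x \<in> interior A" "G x \<noteq> 0" and y: "y \<noteq> 0"
    and max: "\<And>z. z \<in> A \<Longrightarrow> v x \<le> v z \<Longrightarrow> y \<bullet> z \<le> y \<bullet> x"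
  shows "sgn (G x) = - sgn y"
proof -
  have half: "y \<bullet> h \<le> 0" if h: "G x \<bullet> h > 0" for h
  proof -
    have "((\<lambda>s. x + s *\<^sub>R h) has_derivative (\<lambda>s. s *\<^sub>R h)) (at 0)"
      by (auto intro!: derivative_eq_intros)
    moreover have "(v has_derivative (\<lambda>h. G x \<bullet> h)) (at (x + 0 *\<^sub>R h))" using v_deriv[OF x(1)] by simp
    ultimately have "((\<lambda>s. v (x + s *\<^sub>R h)) has_derivative (\<lambda>s. G x \<bullet> (s *\<^sub>R h))) (at 0)"
      by (rule has_derivative_compose)
    then have "((\<lambda>s. v (x + s *\<^sub>R h)) has_real_derivative (G x \<bullet> h)) (at 0)"
      by (rule has_derivative_imp_has_field_derivative) simp
    from DERIV_pos_inc_right[OF this h]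
    obtain d where d: "d > 0" "\<And>s. s > 0 \<Longrightarrow> s < d \<Longrightarrow> v x < v (x + s *\<^sub>R h)" by auto
    obtain e where e: "e > 0" "ball x e \<subseteq> interior A"
      using x(1) open_interior open_contains_ball by blast
    define k where "k = norm h + 1"
    have k: "k > 0" by (simp add: k_def add_nonneg_pos)
    define s where "s = min (d / 2) (e / (2 * k))"
    have s: "s > 0" "s < d" using d(1) e(1) k by (auto simp: s_def)
    have "s * k \<le> e / (2 * k) * k"
      using k by (intro mult_right_mono) (auto simp: s_def)
    also have "\<dots> = e / 2" using k by simp
    finally have "s * norm h < e" using s(1) e(1) by (simp add: k_def distrib_left)
    then have "x + s *\<^sub>R h \<in> ball x e" using s(1) by (simp add: dist_norm)
    then have "x + s *\<^sub>R h \<in> A" using e(2) interior_subset by blast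
    then have "y \<bullet> (x + s *\<^sub>R h) \<le> y \<bullet> x" using d(2)[OF s] by (intro max) auto
    then show ?thesis using s(1) by (simp add: inner_add_right mult_le_0_iff)
  qed
  define g where "g = sgn (G x)"
  define u where "u = sgn y"
  have gg: "g \<bullet> g = 1" and uu: "u \<bullet> u = 1"
    using x(2) y by (simp_all add: g_def u_def inner_sgn_sgn)
  have half': "u \<bullet> h \<le> 0" if "g \<bullet> h > 0" for h
  proof -
    have "G x \<bullet> h > 0" using that x(2) by (simp add: inner_sgn_self[of "G x"] g_def)
    then have "y \<bullet> h \<le> 0" by (rule half)
    then show ?thesis using y by (simp add: u_def inner_sgn_self[of y] mult_le_0_iff)
  qed
  define a where "a = u \<bullet> g"
  have a: "a \<le> 0" using half'[of g] gg by (simp add: a_def)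
  define h where "h = u - a *\<^sub>R g"
  have gh: "g \<bullet> h = 0" using gg by (simp add: h_def a_def inner_diff_right inner_commute)
  have uh: "u \<bullet> h = h \<bullet> h"
    using gh by (simp add: h_def inner_diff_left inner_diff_right inner_commute)
  \<comment> \<open>The tangential part \<open>h\<close> of \<open>u\<close> lies on the boundary of
    the half-space; a small multiple of \<open>g\<close> moves it inside. The denominator
    \<open>1 - a\<close> is at least 1 and keeps the resulting error below \<open>e\<close>.\<close>
  have "h \<bullet> h \<le> 0"
  proof (rule field_le_epsilon)
    fix e :: real assume e: "e > 0"
    have "g \<bullet> (h + (e / (1 - a)) *\<^sub>R g) > 0" using gh gg e a by (simp add: inner_add_right)
    then have "u \<bullet> (h + (e / (1 - a)) *\<^sub>R g) \<le> 0" by (rule half')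
    then have "h \<bullet> h \<le> (e / (1 - a)) * (- a)" by (simp add: inner_add_right uh a_def)
    also have "\<dots> \<le> e"
    proof -
      have "1 - a > 0" "e * (- a) \<le> e * (1 - a)" using a e by (auto simp: algebra_simps)
      then have "e * (- a) / (1 - a) \<le> e" by (simp only: pos_divide_le_eq)
      then show ?thesis by simp
    qed
    finally show "h \<bullet> h \<le> 0 + e" by simp
  qed
  then have "h = 0" by (metis inner_gt_zero_iff not_le)
  then have ua: "u = a *\<^sub>R g" by (simp add: h_def)
  then have "a * a = 1" using uu gg by simp
  then have "a = -1" using a by (metis abs_of_nonpos abs_one abs_eq_iff minus_minus power2_eq_1_iff power2_eq_square)
  then show ?thesis using ua by (simp add: g_def u_def)
qed

lemma level_map_at_support:
  assumes x: "x \<in> superlevel (m + norm y)" and max: "\<And>z. z \<in> superlevel (m + norm y) \<Longrightarrow> y \<bullet> z \<le> y \<bullet> x"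
    and y: "y \<noteq> 0" and G: "G x \<noteq> 0"
  shows "x \<in> regular" "level_map x = y"
proof -
  have vx: "v x = m + norm y" using support_level[OF x max y] y by simp
  have xi: "x \<in> interior A" using x vx y interiorI_gt by (auto simp: superlevel_def)
  then show "x \<in> regular" using G vx y by (simp add: regular_def)
  have "sgn (G x) = - sgn y"
    using max vx by (intro sgn_gradient_at_support[OF xi G y]) (auto simp: superlevel_def)
  then show "level_map x = y" using y by (simp add: level_map_def vx sgn_div_norm)
qed

text \<open>The parameter is the foot point of the supporting hyperplane relative to
  \<open>x0\<close>: the direction of \<open>y\<close>, with the distance of the hyperplane from
  \<open>x0\<close> as length.\<close>

lemma critical_support:
  assumes t0: "m < t0" "t0 \<le> m + norm y" "m + norm y < v x0"
    and x: "x \<in> superlevel (m + norm y)" and max: "\<And>z. z \<in> superlevel (m + norm y) \<Longrightarrow> y \<bullet> z \<le> y \<bullet> x"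
    and G: "G x = 0"
  shows "y \<in> (\<lambda>u. (slab_sup u - m) *\<^sub>R sgn u) ` (fst ` critical_contacts t0)"
proof -
  have y: "y \<noteq> 0" using t0 by auto
  have vx: "v x = m + norm y" using support_level[OF x max y] y by simp
  define s where "s = sgn y \<bullet> (x - x0)"
  define u where "u = s *\<^sub>R sgn y"
  \<comment> \<open>Since \<open>x0\<close> is strictly above the level, there is room beyond it in
    direction \<open>y\<close>; so the hyperplane has positive distance from \<open>x0\<close>, and
    \<open>u\<close> keeps the direction of \<open>y\<close>.\<close>
  obtain r where r: "r > 0" "x0 + r *\<^sub>R y \<in> A" "m + norm y < v (x0 + r *\<^sub>R y)"
    using superlevel_push[OF x0(1) t0(3) gap y] by metis
  then have "y \<bullet> (x0 + r *\<^sub>R y) \<le> y \<bullet> x" by (intro max) (simp add: superlevel_def)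
  moreover have "r * (y \<bullet> y) > 0" using r(1) y by simp
  ultimately have "y \<bullet> (x - x0) > 0" by (simp add: inner_add_right inner_diff_right)
  then have s: "s > 0" using y by (simp add: s_def inner_sgn_self[of y] zero_less_mult_iff)
  have su: "sgn u = sgn y" "u \<noteq> 0" using s y by (auto simp: u_def sgn_div_norm field_simps)
  have "u \<bullet> u = s * s" using y by (simp add: u_def inner_sgn_sgn)
  moreover have "u \<bullet> (x - x0) = s * s" by (simp add: u_def s_def)
  moreover have "u \<bullet> z \<le> u \<bullet> x" if "z \<in> superlevel (v x)" for z
  proof -
    have "y \<bullet> z \<le> y \<bullet> x" using max that vx by simp
    then show ?thesis using s y by (simp add: u_def inner_sgn_self[of y])
  qed
  ultimately have c: "(u, x) \<in> critical_contacts t0"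
    using su(2) G x t0(2) vx by (simp add: critical_contacts_def superlevel_def)
  have "(slab_sup u - m) *\<^sub>R sgn u = y"
    using slab_sup_eq[OF t0(1) c] su vx y by (simp add: sgn_div_norm)
  moreover have "u \<in> fst ` critical_contacts t0" using c by (rule image_eqI[rotated]) simp
  ultimately show ?thesis by (intro image_eqI[where x=u]) simp_all
qed

text \<open>If a maximiser of \<open>y\<close> on the superlevel set is not strict, there is a
  second maximiser, which is noncritical and nondegenerate for the same reasons as the first; then
  \<open>y\<close> is a double contact.\<close>

lemma strict_contacts_cover:
  assumes t0: "m < t0"
  obtains N where "negligible N"
    "{y. t0 \<le> m + norm y \<and> m + norm y < v x0} \<subseteq> level_map ` strict_contacts \<union> N"
proof -
  \<comment> \<open>The slopes with a critical support point, with a degenerate one, and with two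
    nondegenerate ones.\<close>
  define N1 where "N1 = (\<lambda>u. (slab_sup u - m) *\<^sub>R sgn u) ` (fst ` critical_contacts t0)"
  define N2 where "N2 = level_map ` {x \<in> regular. \<not> inj (level_map_deriv x)}"
  define R where "R = {x \<in> regular. inj (level_map_deriv x)}"
  define N3 where "N3 = double_contacts (R \<times> R)"
  have "negligible (N1 \<union> N2 \<union> N3)"
    unfolding N1_def N2_def N3_def R_def
    by (intro negligible_Un negligible_critical_contacts[OF t0] negligible_level_map_degenerate negligible_double_contact)
  moreover have "y \<in> level_map ` strict_contacts \<union> (N1 \<union> N2 \<union> N3)"
    if y': "t0 \<le> m + norm y" "m + norm y < v x0" for y
  proof (rule ccontr)
    assume no: "y \<notin> level_map ` strict_contacts \<union> (N1 \<union> N2 \<union> N3)"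
    have y: "y \<noteq> 0" using y' t0 by auto
    let ?T = "superlevel (m + norm y)"
    have good: "x \<in> regular \<and> level_map x = y \<and> inj (level_map_deriv x)"
      if x: "x \<in> ?T" and max: "\<And>z. z \<in> ?T \<Longrightarrow> y \<bullet> z \<le> y \<bullet> x" for x
    proof -
      have "G x \<noteq> 0" using critical_support[OF t0 y' x max] no by (auto simp: N1_def)
      from level_map_at_support[OF x max y this] show ?thesis using no by (auto simp: N2_def)
    qed
    have "?T \<noteq> {}" using x0(1) y' by (auto simp: superlevel_def)
    moreover have "continuous_on ?T (\<lambda>z. y \<bullet> z)" by (intro continuous_intros)
    ultimately obtain x where x: "x \<in> ?T" "\<And>z. z \<in> ?T \<Longrightarrow> y \<bullet> z \<le> y \<bullet> x"
      using continuous_attains_sup[OF compact_superlevel] by blast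
    note gx = good[OF x]
    have vx: "v x = m + norm y" using support_level[OF x y] y by simp
    have "x \<notin> strict_contacts" using no gx by blast
    then obtain z where z: "z \<in> A" "z \<noteq> x" "v x \<le> v z" "G x \<bullet> (z - x) \<le> 0"
      using gx by (auto simp: strict_contacts_def not_less)
    have zT: "z \<in> ?T" using z vx by (simp add: superlevel_def)
    have "y \<bullet> (z - x) = (m - v x) * (sgn (G x) \<bullet> (z - x))"
      using gx by (metis level_map_def inner_scaleR_left)
    moreover have "sgn (G x) \<bullet> (z - x) \<le> 0"
      using z(4) gx by (simp add: inner_sgn_self[of "G x"] mult_le_0_iff regular_def)
    ultimately have "y \<bullet> (z - x) \<ge> 0" using vx by (simp add: mult_nonneg_nonpos)
    then have eq: "y \<bullet> z = y \<bullet> x" using x(2)[OF zT] by (simp add: inner_diff_right)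
    have gz: "z \<in> regular \<and> level_map z = y \<and> inj (level_map_deriv z)"
      by (rule good[OF zT]) (simp add: eq x(2))
    have "y \<in> N3"
      using gx gz z(2) eq by (auto simp: N3_def R_def double_contacts_def)
    then show False using no by blast
  qed
  ultimately show ?thesis using that by blast
qed

text \<open>Strictness quantifies over uncountably many \<open>z\<close>. Its failure at distance at
  least \<open>1 / (j + 1)\<close> is a closed relation, and projecting along the compact set
  \<open>A\<close> keeps it closed relative to \<open>P\<close>; only a countable union over
  \<open>j\<close> remains.\<close>

lemma strict_contacts_borel: "strict_contacts \<in> sets borel"
proof -
  define P where "P = {x \<in> regular. inj (level_map_deriv x)}"
  have "P = regular \<inter> (\<lambda>x. ldet (level_map_deriv x)) -` (- {0})"
    using ldet_eq_0_iff[OF linear_level_map_deriv] by (auto simp: P_def)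
  moreover have "open (regular \<inter> (\<lambda>x. ldet (level_map_deriv x)) -` (- {0}))"
    by (intro continuous_open_preimage continuous_on_ldet continuous_level_map_deriv open_regular) (simp add: open_Compl)
  ultimately have openP: "open P" by simp
  have PA: "P \<subseteq> A" using regular_subset by (auto simp: P_def)
  define F where "F j = {p \<in> A \<times> P. 1 / real (Suc j) \<le> norm (fst p - snd p) \<and> v (snd p) \<le> v (fst p) \<and>
      G (snd p) \<bullet> (fst p - snd p) \<le> 0}" for j
  have F_closed: "closedin (top_of_set (A \<times> P)) (F j)" for j
  proof -
    have cont: "continuous_on (A \<times> P) (\<lambda>p. v (fst p))" "continuous_on (A \<times> P) (\<lambda>p. v (snd p))"
      "continuous_on (A \<times> P) (\<lambda>p. G (snd p))"
      using PA by (auto intro!: continuous_on_compose2[OF cont_v] continuous_on_compose2[OF cont_G] continuous_intros)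
    have cl: "closedin (top_of_set (A \<times> P)) {p \<in> A \<times> P. 0 \<le> g p}"
      if "continuous_on (A \<times> P) g" for g :: "'a \<times> 'a \<Rightarrow> real"
      using continuous_closedin_preimage[OF that, of "{0..}"] by (simp add: Int_def vimage_def)
    have F_eq: "F j = {p \<in> A \<times> P. 0 \<le> norm (fst p - snd p) - 1 / real (Suc j)} \<inter>
        {p \<in> A \<times> P. 0 \<le> v (fst p) - v (snd p)} \<inter> {p \<in> A \<times> P. 0 \<le> - (G (snd p) \<bullet> (fst p - snd p))}"
      by (auto simp: F_def)
    show ?thesis
      unfolding F_eq by (intro closedin_Int cl continuous_intros cont)
  qed
  have "closedin (top_of_set P) (snd ` F j)" for j
  proof -
    have "snd ` F j = {y. \<exists>x. x \<in> A \<and> (x, y) \<in> F j}" by (force simp: F_def)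
    then show ?thesis using closedin_compact_projection[OF compact_A F_closed] by simp
  qed
  then have "snd ` F j \<in> sets borel" for j
    using openP by (metis borel_open closedin_closed borel_closed sets.Int)
  then have "P - (\<Union>j. snd ` F j) \<in> sets borel"
    using openP by auto
  moreover have "strict_contacts = P - (\<Union>j. snd ` F j)"
  proof (intro equalityI subsetI)
    fix x assume x: "x \<in> strict_contacts"
    have "x \<notin> snd ` F j" for j
    proof
      assume "x \<in> snd ` F j"
      then obtain z where z: "z \<in> A" "1 / real (Suc j) \<le> norm (z - x)" "v x \<le> v z" "G x \<bullet> (z - x) \<le> 0"
        by (auto simp: F_def)
      then have "z \<noteq> x" by auto
      then show False using x z by (auto simp: strict_contacts_def)
    qed
    then show "x \<in> P - (\<Union>j. snd ` F j)" using x by (auto simp: strict_contacts_def P_def)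
  next
    fix x assume x: "x \<in> P - (\<Union>j. snd ` F j)"
    have "0 < G x \<bullet> (z - x)" if z: "z \<in> A" "z \<noteq> x" "v x \<le> v z" for z
    proof (rule ccontr)
      assume "\<not> 0 < G x \<bullet> (z - x)"
      moreover obtain j where "1 / real (Suc j) < norm (z - x)"
        using reals_Archimedean[of "norm (z - x)"] z(2) by (auto simp: inverse_eq_divide)
      ultimately have "(z, x) \<in> F j" using z x by (auto simp: F_def)
      then show False using x by force
    qed
    then show "x \<in> strict_contacts" using x by (auto simp: strict_contacts_def P_def)
  qed
  ultimately show ?thesis by simp
qed

end

subsection \<open>Curvature at strict contact points\<close>

text \<open>\<open>D\<close> acts as a gradient along rays in the hyperplane and is differentiated
  at 0 alone; the mean value theorem on each ray turns its linearisation into a quadratic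
  expansion.\<close>

lemma second_order_expansion:
  fixes F :: "'a::euclidean_space \<Rightarrow> real" and D A :: "'a \<Rightarrow> 'a"
  assumes \<delta>: "\<delta> > 0"
    and F: "\<And>w s. w \<bullet> n = 0 \<Longrightarrow> norm w < \<delta> \<Longrightarrow> 0 \<le> s \<Longrightarrow> s \<le> 1 \<Longrightarrow>
      ((\<lambda>s. F (s *\<^sub>R w)) has_real_derivative (D (s *\<^sub>R w) \<bullet> w)) (at s)"
    and D: "(D has_derivative A) (at 0)"
  shows "((\<lambda>w. (F w - F 0 - D 0 \<bullet> w - (1/2) * (A w \<bullet> w)) / (norm w)\<^sup>2) \<longlongrightarrow> 0) (at 0 within {w. w \<bullet> n = 0})"
proof (rule tendstoI)
  fix e :: real assume e: "e > 0"
  have lin: "linear A" using D has_derivative_linear by blast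
  have "e / 2 > 0" using e by simp
  then obtain d where d: "d > 0" "\<And>w. norm w < d \<Longrightarrow> norm (D w - D 0 - A w) \<le> e / 2 * norm w"
    using D unfolding has_derivative_at_alt by (metis (no_types, lifting) diff_zero)
  have "dist ((F w - F 0 - D 0 \<bullet> w - (1/2) * (A w \<bullet> w)) / (norm w)\<^sup>2) 0 < e"
    if w: "w \<bullet> n = 0" "w \<noteq> 0" "norm w < min d \<delta>" for w
  proof -
    define q where "q s = F (s *\<^sub>R w) - s * (D 0 \<bullet> w) - s\<^sup>2 / 2 * (A w \<bullet> w)" for s
    define q' where "q' s = D (s *\<^sub>R w) \<bullet> w - D 0 \<bullet> w - s * (A w \<bullet> w)" for s
    have q: "(q has_real_derivative q' s) (at s)" if "0 \<le> s" "s \<le> 1" for s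
    proof -
      have "((\<lambda>s. F (s *\<^sub>R w)) has_real_derivative (D (s *\<^sub>R w) \<bullet> w)) (at s)"
        using F[OF w(1) _ that] w(3) by simp
      then show ?thesis
        unfolding q_def[abs_def] q'_def by (auto intro!: derivative_eq_intros)
    qed
    obtain s where s: "0 < s" "s < 1" "q 1 - q 0 = q' s"
      using MVT2[of 0 1 q q'] q by auto
    have sw: "norm (s *\<^sub>R w) \<le> norm w" using s by (simp add: mult_left_le_one_le)
    then have "norm (s *\<^sub>R w) < d" using w(3) by linarith
    from d(2)[OF this] have "norm (D (s *\<^sub>R w) - D 0 - A (s *\<^sub>R w)) \<le> e / 2 * norm w"
      by (rule order_trans) (use sw e in \<open>intro mult_left_mono, auto\<close>)
    moreover have q'_eq: "q' s = (D (s *\<^sub>R w) - D 0 - A (s *\<^sub>R w)) \<bullet> w"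
      by (simp add: q'_def inner_diff_left linear_scale[OF lin])
    ultimately have "\<bar>q' s\<bar> \<le> e / 2 * norm w * norm w"
      unfolding q'_eq by (intro order_trans[OF Cauchy_Schwarz_ineq2] mult_right_mono) auto
    moreover have "q 1 - q 0 = F w - F 0 - D 0 \<bullet> w - (1/2) * (A w \<bullet> w)"
      by (simp add: q_def)
    ultimately have "\<bar>F w - F 0 - D 0 \<bullet> w - (1/2) * (A w \<bullet> w)\<bar> \<le> e / 2 * (norm w)\<^sup>2"
      using s(3) by (simp add: power2_eq_square mult.assoc)
    then have "\<bar>F w - F 0 - D 0 \<bullet> w - (1/2) * (A w \<bullet> w)\<bar> / (norm w)\<^sup>2 \<le> e / 2"
      using w(2) by (simp add: pos_divide_le_eq)
    moreover have "dist ((F w - F 0 - D 0 \<bullet> w - (1/2) * (A w \<bullet> w)) / (norm w)\<^sup>2) 0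
        = \<bar>F w - F 0 - D 0 \<bullet> w - (1/2) * (A w \<bullet> w)\<bar> / (norm w)\<^sup>2"
      by (simp add: abs_divide dist_norm)
    ultimately show ?thesis using e by linarith
  qed
  then show "\<forall>\<^sub>F w in at 0 within {w. w \<bullet> n = 0}. dist ((F w - F 0 - D 0 \<bullet> w - (1/2) * (A w \<bullet> w)) / (norm w)\<^sup>2) 0 < e"
    using d(1) \<delta> unfolding eventually_at by (intro exI[of _ "min d \<delta>"]) (auto simp: dist_norm)
qed

definition frame_form :: "nat \<Rightarrow> (nat \<Rightarrow> 'a::real_inner) \<Rightarrow> real Matrix.mat \<Rightarrow> 'a \<Rightarrow> real" where
  "frame_form d e M w = (\<Sum>i<d. \<Sum>j<d. M $$ (i, j) * (w \<bullet> e i) * (w \<bullet> e j))"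

lemma frame_form_scale: "frame_form d e M (s *\<^sub>R w) = s\<^sup>2 * frame_form d e M w"
  by (simp add: frame_form_def sum_distrib_left power2_eq_square mult_ac)

lemma frame_form_add:
  assumes "M \<in> carrier_mat d d" "transpose_mat M = M"
  shows "frame_form d e M (u + w) = frame_form d e M u + frame_form d e M w
     + 2 * (\<Sum>i<d. \<Sum>j<d. M $$ (i, j) * (u \<bullet> e i) * (w \<bullet> e j))"
proof -
  have sym: "M $$ (i, j) = M $$ (j, i)" if "i < d" "j < d" for i j
    using assms that by (metis carrier_matD index_transpose_mat(1))
  have "(\<Sum>i<d. \<Sum>j<d. M $$ (i, j) * (w \<bullet> e i) * (u \<bullet> e j)) = (\<Sum>i<d. \<Sum>j<d. M $$ (i, j) * (u \<bullet> e i) * (w \<bullet> e j))"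
    by (subst sum.swap) (auto intro!: sum.cong simp: sym)
  then show ?thesis
    by (simp add: frame_form_def inner_add_left algebra_simps sum.distrib)
qed

text \<open>\<open>alexandrov_hessian\<close> is a definite description, so its value depends on
  this. On each ray the linear terms dominate and must agree first, then the quadratic forms agree;
  polarisation at \<open>e i + e j\<close> recovers the entries of the symmetric matrices.\<close>

lemma alexandrov_hessian_at_unique:
  fixes n :: "'a::euclidean_space"
  assumes n: "norm n = 1" and M: "alexandrov_hessian_at H n M" and M': "alexandrov_hessian_at H n M'"
  shows "M = M'"
proof -
  let ?d = "DIM('a) - 1"
  define e where "e = tangent_frame n"
  have frame: "orthonormal_frame n e"
    using orthonormal_frame_tangent_frame[OF n] by (simp add: e_def)
  define S where "S = {w. w \<bullet> n = 0}"
  have carr: "M \<in> carrier_mat ?d ?d" "M' \<in> carrier_mat ?d ?d" and sym: "transpose_mat M = M" "transpose_mat M' = M'"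
    using M M' by (auto simp: alexandrov_hessian_at_def)
  obtain p where p: "((\<lambda>w. (H (sphere_chart n w) - H n - p \<bullet> w - (1/2) * frame_form ?d e M w) / (norm w)\<^sup>2) \<longlongrightarrow> 0) (at 0 within S)"
    using M by (auto simp: alexandrov_hessian_at_def S_def frame_form_def e_def)
  obtain p' where p': "((\<lambda>w. (H (sphere_chart n w) - H n - p' \<bullet> w - (1/2) * frame_form ?d e M' w) / (norm w)\<^sup>2) \<longlongrightarrow> 0) (at 0 within S)"
    using M' by (auto simp: alexandrov_hessian_at_def S_def frame_form_def e_def)
  have form_eq: "frame_form ?d e M w = frame_form ?d e M' w" if w: "w \<in> S" for w
  proof (cases "w = 0")
    case True then show ?thesis by (simp add: frame_form_def)
  next
    case False
    define a where "a = (p' - p) \<bullet> w"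
    define b where "b = (1/2) * (frame_form ?d e M' w - frame_form ?d e M w)"
    have diff: "((\<lambda>w. ((p' - p) \<bullet> w + (1/2) * (frame_form ?d e M' w - frame_form ?d e M w)) / (norm w)\<^sup>2) \<longlongrightarrow> 0) (at 0 within S)"
    proof -
      have "(H (sphere_chart n w) - H n - p \<bullet> w - (1/2) * frame_form ?d e M w) / (norm w)\<^sup>2
          - (H (sphere_chart n w) - H n - p' \<bullet> w - (1/2) * frame_form ?d e M' w) / (norm w)\<^sup>2
          = ((p' - p) \<bullet> w + (1/2) * (frame_form ?d e M' w - frame_form ?d e M w)) / (norm w)\<^sup>2" for w
        unfolding diff_divide_distrib[symmetric] by (simp add: inner_diff_left diff_divide_distrib)
      then show ?thesis using tendsto_diff[OF p p'] by simp
    qed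
    have line: "filterlim (\<lambda>s. s *\<^sub>R w) (at 0 within S) (at_right (0::real))"
      unfolding filterlim_at
    proof (intro conjI)
      show "\<forall>\<^sub>F s in at_right 0. s *\<^sub>R w \<in> S \<and> s *\<^sub>R w \<noteq> 0"
        using w False by (auto simp: eventually_at_filter S_def)
      have "((\<lambda>s. s *\<^sub>R w) \<longlongrightarrow> 0 *\<^sub>R w) (at_right 0)" by (intro tendsto_intros)
      then show "((\<lambda>s. s *\<^sub>R w) \<longlongrightarrow> 0) (at_right 0)" by simp
    qed
    have lim: "((\<lambda>s. (s * a + s\<^sup>2 * b) / (s\<^sup>2 * (norm w)\<^sup>2)) \<longlongrightarrow> 0) (at_right 0)"
      using filterlim_compose[OF diff line]
      by (simp add: frame_form_scale a_def b_def power_mult_distrib algebra_simps)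
    \<comment> \<open>Multiplication by \<open>s * (norm w)\<^sup>2\<close> isolates the linear part
      \<open>a\<close>; once \<open>a = 0\<close>, the quotient is the constant
      \<open>b / (norm w)\<^sup>2\<close>.\<close>
    have "((\<lambda>s. (s * (norm w)\<^sup>2) * ((s * a + s\<^sup>2 * b) / (s\<^sup>2 * (norm w)\<^sup>2))) \<longlongrightarrow> (0 * (norm w)\<^sup>2) * 0) (at_right 0)"
      by (intro tendsto_intros lim)
    moreover have "\<forall>\<^sub>F s in at_right 0. (s * (norm w)\<^sup>2) * ((s * a + s\<^sup>2 * b) / (s\<^sup>2 * (norm w)\<^sup>2)) = a + s * b"
      using False by (auto simp: eventually_at_filter field_simps power2_eq_square)
    ultimately have "((\<lambda>s. a + s * b) \<longlongrightarrow> 0) (at_right 0)"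
      using tendsto_cong by force
    moreover have "((\<lambda>s. a + s * b) \<longlongrightarrow> a + 0 * b) (at_right 0)"
      by (intro tendsto_intros)
    ultimately have a0: "a = 0" using tendsto_unique[OF trivial_limit_at_right_real] by fastforce
    have "\<forall>\<^sub>F s in at_right 0. (s * a + s\<^sup>2 * b) / (s\<^sup>2 * (norm w)\<^sup>2) = b / (norm w)\<^sup>2"
      using False by (auto simp: eventually_at_filter a0)
    then have "((\<lambda>s. b / (norm w)\<^sup>2) \<longlongrightarrow> 0) (at_right (0::real))"
      using lim tendsto_cong by force
    then have "b / (norm w)\<^sup>2 = 0"
      by (simp only: tendsto_const_iff[OF trivial_limit_at_right_real])
    then show ?thesis using False by (simp add: b_def)
  qed
  have entry: "(\<Sum>k<?d. \<Sum>l<?d. N $$ (k, l) * (e i \<bullet> e k) * (e j \<bullet> e l)) = N $$ (i, j)"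
    if ij: "i < ?d" "j < ?d" for i j and N :: "real Matrix.mat"
  proof -
    have "(\<Sum>k<?d. \<Sum>l<?d. N $$ (k, l) * (e i \<bullet> e k) * (e j \<bullet> e l))
        = (\<Sum>k<?d. \<Sum>l<?d. if l = j then (if k = i then N $$ (k, l) else 0) else 0)"
      using frame ij by (intro sum.cong) (auto simp: orthonormal_frame_def)
    also have "\<dots> = N $$ (i, j)" using ij by simp
    finally show ?thesis .
  qed
  show ?thesis
  proof (rule eq_matI)
    fix i j assume "i < dim_row M'" "j < dim_col M'"
    then have ij: "i < ?d" "j < ?d" using carr by auto
    have eS: "e i \<in> S" "e j \<in> S" "e i + e j \<in> S"
      using frame ij by (auto simp: S_def orthonormal_frame_def inner_add_left)
    show "M $$ (i, j) = M' $$ (i, j)"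
      using form_eq[OF eS(1)] form_eq[OF eS(2)] form_eq[OF eS(3)]
        frame_form_add[OF carr(1) sym(1), of e "e i" "e j"] frame_form_add[OF carr(2) sym(2), of e "e i" "e j"]
        entry[OF ij, of M] entry[OF ij, of M'] by linarith
  qed (use carr in auto)
qed

text \<open>On the segment from the identity to \<open>P\<close> the form is positive definite
  before the end point, so the determinant has no zero and keeps the sign that it has at the
  identity.\<close>

lemma det_pos_of_nonneg_form:
  fixes P :: "real Matrix.mat"
  assumes P: "P \<in> carrier_mat d d" and nonneg: "\<And>c. (\<Sum>i<d. \<Sum>j<d. P $$ (i, j) * c i * c j) \<ge> 0"
    and det: "Determinant.det P \<noteq> 0"
  shows "Determinant.det P > 0"
proof -
  define Q where "Q s = Matrix.mat d d (\<lambda>(i, j). s * P $$ (i, j) + (1 - s) * (if i = j then 1 else 0))" for s :: real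
  have Q: "Q s \<in> carrier_mat d d" for s by (simp add: Q_def)
  have Q1: "Q 1 = P" using P by (intro eq_matI) (auto simp: Q_def)
  have Q0: "Q 0 = 1\<^sub>m d" by (intro eq_matI) (auto simp: Q_def)
  have nz: "Determinant.det (Q s) \<noteq> 0" if s: "0 \<le> s" "s < 1" for s
  proof
    assume "Determinant.det (Q s) = 0"
    then obtain u where u: "u \<in> carrier_vec d" "u \<noteq> 0\<^sub>v d" "Q s *\<^sub>v u = 0\<^sub>v d"
      using det_0_iff_vec_prod_zero[OF Q] by blast
    define c where "c i = vec_index u i" for i
    have row: "(\<Sum>j<d. (s * P $$ (i, j) + (1 - s) * (if i = j then 1 else 0)) * c j) = 0" if "i < d" for i
    proof -
      have "vec_index (Q s *\<^sub>v u) i = 0" using u that by simp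
      then show ?thesis
        using that u(1) by (simp add: Q_def scalar_prod_def c_def lessThan_atLeast0)
    qed
    have "0 = (\<Sum>i<d. c i * (\<Sum>j<d. (s * P $$ (i, j) + (1 - s) * (if i = j then 1 else 0)) * c j))"
      by (simp add: row)
    also have "\<dots> = (\<Sum>i<d. \<Sum>j<d. s * (P $$ (i, j) * c i * c j) + (if j = i then (1 - s) * (c i)\<^sup>2 else 0))"
      by (auto simp: sum_distrib_left algebra_simps power2_eq_square intro!: sum.cong)
    also have "\<dots> = s * (\<Sum>i<d. \<Sum>j<d. P $$ (i, j) * c i * c j) + (1 - s) * (\<Sum>i<d. (c i)\<^sup>2)"
      by (simp add: sum.distrib sum_distrib_left)
    finally have "(1 - s) * (\<Sum>i<d. (c i)\<^sup>2) \<le> 0"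
      using mult_nonneg_nonneg[OF s(1) nonneg[of c]] by linarith
    then have "(\<Sum>i<d. (c i)\<^sup>2) \<le> 0" using s by (simp add: mult_le_0_iff)
    then have "(\<Sum>i<d. (c i)\<^sup>2) = 0" using sum_nonneg[of "{..<d}" "\<lambda>i. (c i)\<^sup>2"] by simp
    then have "c i = 0" if "i < d" for i using that by (simp add: sum_nonneg_eq_0_iff)
    then have "u = 0\<^sub>v d" using u(1) by (intro eq_vecI) (auto simp: c_def)
    then show False using u(2) by simp
  qed
  have cont: "continuous_on {0..1} (\<lambda>s. Determinant.det (Q s))"
  proof -
    have eq: "(\<lambda>s. Determinant.det (Q s)) = (\<lambda>s. \<Sum>p | p permutes {0..<d}. signof p *
        (\<Prod>i = 0..<d. s * P $$ (i, p i) + (1 - s) * (if i = p i then 1 else 0)))"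
      unfolding Determinant.det_def'[OF Q]
      by (intro ext sum.cong refl arg_cong2[where f="(*)"] prod.cong) (auto simp: Q_def permutes_in_image)
    show ?thesis unfolding eq by (intro continuous_intros)
  qed
  show ?thesis
  proof (rule ccontr)
    assume "\<not> Determinant.det P > 0"
    then have "Determinant.det (Q 1) \<le> 0" "0 \<le> Determinant.det (Q 0)" using det by (auto simp: Q1 Q0)
    then obtain s where "0 \<le> s" "s \<le> 1" "Determinant.det (Q s) = 0"
      using IVT2'[of "\<lambda>s. Determinant.det (Q s)" 1 0 0] cont by auto
    then show False using nz[of s] det Q1 by (cases "s = 1") auto
  qed
qed

section \<open>Normals and support functions at strict contacts\<close>

lemma support_fun_convex_hull:
  assumes z: "z \<in> T" and max: "\<And>y. y \<in> T \<Longrightarrow> \<theta> \<bullet> y \<le> \<theta> \<bullet> z"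
  shows "support_fun (convex hull T) \<theta> = \<theta> \<bullet> z"
  unfolding support_fun_def
proof (rule cSup_eq_maximum)
  show "\<theta> \<bullet> z \<in> (\<lambda>x. \<theta> \<bullet> x) ` (convex hull T)" by (intro imageI hull_inc z)
  have "convex hull T \<subseteq> {y. \<theta> \<bullet> y \<le> \<theta> \<bullet> z}"
    using max by (intro hull_minimal convex_halfspace_le) auto
  then show "t \<le> \<theta> \<bullet> z" if "t \<in> (\<lambda>x. \<theta> \<bullet> x) ` (convex hull T)" for t
    using that by blast
qed

context interior_maximum
begin

lemma strict_contacts_support:
  assumes x: "x \<in> strict_contacts" and z: "z \<in> superlevel (v x)"
  shows "- sgn (G x) \<bullet> z \<le> - sgn (G x) \<bullet> x" "z \<noteq> x \<Longrightarrow> - sgn (G x) \<bullet> z < - sgn (G x) \<bullet> x"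
proof -
  have g: "G x \<noteq> 0" using x by (auto simp: strict_contacts_def regular_def)
  show less: "- sgn (G x) \<bullet> z < - sgn (G x) \<bullet> x" if "z \<noteq> x"
  proof -
    have "0 < G x \<bullet> (z - x)" using x z that by (auto simp: strict_contacts_def superlevel_def)
    then have "0 < sgn (G x) \<bullet> (z - x)" using g by (simp add: inner_sgn_self[of "G x"] zero_less_mult_iff)
    then show ?thesis by (simp add: inner_diff_right)
  qed
  show "- sgn (G x) \<bullet> z \<le> - sgn (G x) \<bullet> x" using less by (cases "z = x") auto
qed

text \<open>\<open>gauss_curvature\<close> first asks for a unique normal. Strictness makes
  \<open>- sgn (G x)\<close> a normal of the hull, and smoothness of the level set at
  \<open>x\<close> admits no other.\<close>

lemma outer_unit_normal_strict_contact:
  assumes x: "x \<in> strict_contacts"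
  shows "outer_unit_normal (convex hull superlevel (v x)) x k \<longleftrightarrow> k = - sgn (G x)"
proof
  have xr: "x \<in> interior A" "G x \<noteq> 0" using x by (auto simp: strict_contacts_def regular_def)
  {
    assume k: "outer_unit_normal (convex hull superlevel (v x)) x k"
    then have k1: "norm k = 1" by (simp add: outer_unit_normal_def)
    have "k \<bullet> z \<le> k \<bullet> x" if "z \<in> A" "v x \<le> v z" for z
    proof -
      have "z \<in> convex hull superlevel (v x)" using that by (intro hull_inc) (simp add: superlevel_def)
      then show ?thesis using k by (auto simp: outer_unit_normal_def inner_diff_right)
    qed
    then have "sgn (G x) = - sgn k" using xr k1 by (intro sgn_gradient_at_support) auto
    then show "k = - sgn (G x)" using k1 by (simp add: sgn_div_norm)
  next
    assume k: "k = - sgn (G x)"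
    have "convex hull superlevel (v x) \<subseteq> {y. k \<bullet> y \<le> k \<bullet> x}"
      using strict_contacts_support(1)[OF x] k by (intro hull_minimal convex_halfspace_le) auto
    then show "outer_unit_normal (convex hull superlevel (v x)) x k"
      using xr k by (auto simp: outer_unit_normal_def norm_sgn inner_diff_right)
  }
qed

text \<open>Every step from \<open>x\<close> along its outer normal leaves the hull, so
  \<open>x\<close> is on the frontier.\<close>

lemma strict_contacts_subset_contact_points: "strict_contacts \<subseteq> contact_points (\<lambda>y. - v y) A"
proof
  fix x assume x: "x \<in> strict_contacts"
  then have xr: "x \<in> interior A" "G x \<noteq> 0" "x \<in> A"
    using regular_subset by (auto simp: strict_contacts_def regular_def)
  have eq: "sublevel (\<lambda>y. - v y) A (- v x) = superlevel (v x)"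
    by (auto simp: sublevel_def superlevel_def)
  let ?C = "convex hull superlevel (v x)"
  have xC: "x \<in> ?C" using xr by (intro hull_inc) (simp add: superlevel_def)
  have "x \<notin> interior ?C"
  proof
    assume "x \<in> interior ?C"
    then obtain e where e: "e > 0" "ball x e \<subseteq> ?C" by (meson mem_interior)
    define k where "k = - sgn (G x)"
    have k: "norm k = 1" using xr by (simp add: k_def norm_sgn)
    have "x + (e / 2) *\<^sub>R k \<in> ?C" using e k by (auto simp: dist_norm subset_iff)
    moreover have "outer_unit_normal ?C x k" using outer_unit_normal_strict_contact[OF x] k_def by blast
    ultimately have "k \<bullet> ((e / 2) *\<^sub>R k) \<le> 0" unfolding outer_unit_normal_def by fastforce
    then show False using e(1) k by (simp add: power2_norm_eq_inner[symmetric])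
  qed
  then have "x \<in> frontier ?C" using xC closure_subset by (auto simp: frontier_def)
  then show "x \<in> contact_points (\<lambda>y. - v y) A"
    unfolding contact_points_def using xr eq by (auto simp: superlevel_def intro!: exI[of _ "- v x"])
qed

text \<open>Outside \<open>U\<close> the direction \<open>n\<close> has a uniform deficit by
  compactness, which nearby directions cannot make up. This turns a local inverse of
  \<open>level_map\<close> into information on the global support function.\<close>

lemma support_near_strict_contact:
  assumes x: "x \<in> strict_contacts" and U: "open U" "x \<in> U"
  obtains \<delta> where "\<delta> > 0"
    "\<And>\<theta> z. norm (\<theta> + sgn (G x)) < \<delta> \<Longrightarrow> z \<in> superlevel (v x) \<Longrightarrow> \<theta> \<bullet> x \<le> \<theta> \<bullet> z \<Longrightarrow> z \<in> U"
proof -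
  define n where "n = - sgn (G x)"
  define T where "T = superlevel (v x)"
  have "compact (T - U)" unfolding T_def using compact_superlevel U(1) compact_diff by blast
  obtain B where B: "B > 0" "\<And>x. x \<in> A \<Longrightarrow> norm x \<le> B"
    using compact_imp_bounded[OF compact_A] bounded_pos by metis
  have xA: "x \<in> A" using x regular_subset by (auto simp: strict_contacts_def)
  show ?thesis
  proof (cases "T - U = {}")
    case True
    then show ?thesis by (intro that[of 1]) (auto simp: T_def)
  next
    case False
    have "continuous_on (T - U) (\<lambda>z. n \<bullet> z)" by (intro continuous_intros)
    then obtain z0 where z0: "z0 \<in> T - U" "\<And>z. z \<in> T - U \<Longrightarrow> n \<bullet> z \<le> n \<bullet> z0"
      using continuous_attains_sup[OF \<open>compact (T - U)\<close> False] by blast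
    then have "z0 \<noteq> x" using U(2) by blast
    define \<eta> where "\<eta> = n \<bullet> x - n \<bullet> z0"
    have \<eta>: "\<eta> > 0"
      using strict_contacts_support(2)[OF x _ \<open>z0 \<noteq> x\<close>] z0(1) by (simp add: \<eta>_def n_def T_def)
    show ?thesis
    \<comment> \<open>Points of \<open>A\<close> are at most \<open>2 * B\<close> apart, so a change
      of direction by less than \<open>\<eta> / (2 * B)\<close> alters the comparison with
      \<open>x\<close> by less than the deficit \<open>\<eta>\<close>.\<close>
    proof (rule that[of "\<eta> / (2 * B)"])
      show "\<eta> / (2 * B) > 0" using \<eta> B(1) by simp
      fix \<theta> z assume \<theta>: "norm (\<theta> + sgn (G x)) < \<eta> / (2 * B)" and z: "z \<in> superlevel (v x)" "\<theta> \<bullet> x \<le> \<theta> \<bullet> z"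
      show "z \<in> U"
      proof (rule ccontr)
        assume "z \<notin> U"
        then have nz: "n \<bullet> z \<le> n \<bullet> x - \<eta>" using z0(2)[of z] z(1) by (simp add: \<eta>_def T_def)
        have zA: "z \<in> A" using z(1) by (simp add: superlevel_def)
        have "norm (z - x) \<le> 2 * B"
          using norm_triangle_ineq4[of z x] B(2)[OF zA] B(2)[OF xA] by simp
        have "(\<theta> - n) \<bullet> (z - x) \<le> norm (\<theta> - n) * norm (z - x)" by (rule norm_cauchy_schwarz)
        also have "\<dots> \<le> norm (\<theta> - n) * (2 * B)" using \<open>norm (z - x) \<le> 2 * B\<close> by (intro mult_left_mono) auto
        also have "\<dots> < \<eta>" using \<theta> B(1) by (simp add: n_def pos_less_divide_eq)
        finally show False using nz z(2) by (simp add: inner_diff_left inner_diff_right)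
      qed
    qed
  qed
qed

text \<open>For directions \<theta> near \<open>n\<close> the maximiser on the superlevel set is
  caught in \<open>U\<close> and has slope \<open>\<rho> *\<^sub>R \<theta>\<close>, so the local
  inverse returns it. The level stays fixed at \<open>v x\<close>; hence the slopes concerned all
  have length \<open>\<rho>\<close>.\<close>

lemma support_inverse:
  assumes x: "x \<in> strict_contacts"
  defines "n \<equiv> - sgn (G x)" and "\<rho> \<equiv> v x - m"
  obtains V X X' \<delta> where "open V" "\<delta> > 0" "\<rho> *\<^sub>R n \<in> V" "X (\<rho> *\<^sub>R n) = x"
    "\<And>y. y \<in> V \<Longrightarrow> (X has_derivative X' y) (at y)"
    "\<And>y. y \<in> V \<Longrightarrow> X y \<in> regular \<and> level_map (X y) = y"
    "\<And>y h. y \<in> V \<Longrightarrow> level_map_deriv (X y) (X' y h) = h"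
    "\<And>\<theta>. norm \<theta> = 1 \<Longrightarrow> norm (\<theta> - n) < \<delta> \<Longrightarrow> \<rho> *\<^sub>R \<theta> \<in> V \<and> X (\<rho> *\<^sub>R \<theta>) \<in> superlevel (v x) \<and>
       (\<forall>z\<in>superlevel (v x). \<theta> \<bullet> z \<le> \<theta> \<bullet> X (\<rho> *\<^sub>R \<theta>))"
proof -
  have xr: "x \<in> regular" "inj (level_map_deriv x)" using x by (auto simp: strict_contacts_def)
  then have \<rho>: "\<rho> > 0" and vx: "v x = m + \<rho>" by (auto simp: regular_def \<rho>_def)
  have lx: "level_map x = \<rho> *\<^sub>R n" by (simp add: level_map_def \<rho>_def n_def scaleR_left_diff_distrib)
  obtain U V X X' where U: "open U" "U \<subseteq> regular" "x \<in> U" "open V" "homeomorphism U V level_map X"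
    "\<And>y. y \<in> V \<Longrightarrow> (X has_derivative X' y) (at y)"
    "\<And>y h. y \<in> V \<Longrightarrow> level_map_deriv (X y) (X' y h) = h"
    by (rule local_inverse[OF open_regular _ level_map_has_derivative continuous_level_map_deriv, OF xr(1) _ xr(2)],
        assumption, rule that)
  have XU: "X (level_map z) = z" "level_map z \<in> V" if "z \<in> U" for z
    using U(5) that by (auto simp: homeomorphism_def)
  have XV: "X y \<in> regular \<and> level_map (X y) = y" if "y \<in> V" for y
    using U(2,5) that by (auto simp: homeomorphism_def)
  obtain \<delta> where \<delta>: "\<delta> > 0"
    "\<And>\<theta> z. norm (\<theta> + sgn (G x)) < \<delta> \<Longrightarrow> z \<in> superlevel (v x) \<Longrightarrow> \<theta> \<bullet> x \<le> \<theta> \<bullet> z \<Longrightarrow> z \<in> U"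
    by (rule support_near_strict_contact[OF x U(1,3)]) (rule that)
  have "\<rho> *\<^sub>R \<theta> \<in> V \<and> X (\<rho> *\<^sub>R \<theta>) \<in> superlevel (v x) \<and> (\<forall>z\<in>superlevel (v x). \<theta> \<bullet> z \<le> \<theta> \<bullet> X (\<rho> *\<^sub>R \<theta>))"
    if \<theta>: "norm \<theta> = 1" "norm (\<theta> - n) < \<delta>" for \<theta>
  proof -
    have xT: "x \<in> superlevel (v x)" using xr regular_subset by (auto simp: superlevel_def)
    moreover have "continuous_on (superlevel (v x)) (\<lambda>z. \<theta> \<bullet> z)" by (intro continuous_intros)
    ultimately obtain z where z: "z \<in> superlevel (v x)" "\<And>y. y \<in> superlevel (v x) \<Longrightarrow> \<theta> \<bullet> y \<le> \<theta> \<bullet> z"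
      using continuous_attains_sup[OF compact_superlevel] by blast
    have zU: "z \<in> U" using \<delta>(2)[OF _ z(1) z(2)[OF xT]] \<theta>(2) by (simp add: n_def)
    have "level_map z = \<rho> *\<^sub>R \<theta>"
    proof (rule level_map_at_support(2))
      show "z \<in> superlevel (m + norm (\<rho> *\<^sub>R \<theta>))" using z(1) \<theta>(1) \<rho> by (simp add: vx)
      show "\<rho> *\<^sub>R \<theta> \<bullet> y \<le> \<rho> *\<^sub>R \<theta> \<bullet> z" if "y \<in> superlevel (m + norm (\<rho> *\<^sub>R \<theta>))" for y
        using z(2)[of y] that \<theta>(1) \<rho> by (simp add: vx)
      show "\<rho> *\<^sub>R \<theta> \<noteq> 0" using \<rho> \<theta>(1) by auto
      show "G z \<noteq> 0" using zU U(2) by (auto simp: regular_def)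
    qed
    then show ?thesis using XU[OF zU] z by auto
  qed
  then show ?thesis
    using that[of V \<delta> X X'] U(4,6,7) \<delta>(1) XU[OF U(3)] XV by (simp add: lx)
qed

text \<open>By the envelope principle the first derivative of \<open>H\<close> in tangential
  directions is given by the support point itself. One derivative of the support point thus yields a
  second derivative of \<open>H\<close>, namely \<open>B\<close> up to the correction
  \<open>n \<bullet> x\<close> for the curvature of the chart.\<close>

lemma support_fun_expansion:
  assumes x: "x \<in> strict_contacts"
  defines "n \<equiv> - sgn (G x)" and "\<rho> \<equiv> v x - m" and "H \<equiv> support_fun (convex hull superlevel (v x))"
  obtains B where "linear B" "\<And>h. level_map_deriv x (B h) = \<rho> *\<^sub>R h" "H n = n \<bullet> x"
    "((\<lambda>w. (H (sphere_chart n w) - H n - x \<bullet> w - (1/2) * ((B w - (n \<bullet> x) *\<^sub>R w) \<bullet> w)) / (norm w)\<^sup>2)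
       \<longlongrightarrow> 0) (at 0 within {w. w \<bullet> n = 0})"
    "\<And>w. w \<bullet> n = 0 \<Longrightarrow> B w \<bullet> w \<ge> 0"
proof -
  obtain V X X' \<delta> where V: "open V" "\<delta> > 0" "\<rho> *\<^sub>R n \<in> V" "X (\<rho> *\<^sub>R n) = x"
    and X_der: "\<And>y. y \<in> V \<Longrightarrow> (X has_derivative X' y) (at y)"
    and X_reg: "\<And>y. y \<in> V \<Longrightarrow> X y \<in> regular \<and> level_map (X y) = y"
    and X_inv: "\<And>y h. y \<in> V \<Longrightarrow> level_map_deriv (X y) (X' y h) = h"
    and X_max: "\<And>\<theta>. norm \<theta> = 1 \<Longrightarrow> norm (\<theta> - n) < \<delta> \<Longrightarrow> \<rho> *\<^sub>R \<theta> \<in> V \<and> X (\<rho> *\<^sub>R \<theta>) \<in> superlevel (v x) \<and>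
       (\<forall>z\<in>superlevel (v x). \<theta> \<bullet> z \<le> \<theta> \<bullet> X (\<rho> *\<^sub>R \<theta>))"
    by (rule support_inverse[OF x, folded n_def \<rho>_def]) (rule that)
  have xr: "x \<in> regular" using x by (auto simp: strict_contacts_def)
  then have \<rho>: "\<rho> > 0" and n: "norm n = 1" and nn: "n \<bullet> n = 1"
    by (auto simp: regular_def \<rho>_def n_def norm_sgn inner_sgn_sgn)
  have xT: "x \<in> superlevel (v x)" using xr regular_subset by (auto simp: superlevel_def)
  have H_eq: "H \<theta> = \<theta> \<bullet> X (\<rho> *\<^sub>R \<theta>)" if "norm \<theta> = 1" "norm (\<theta> - n) < \<delta>" for \<theta>
    unfolding H_def using X_max[OF that] by (intro support_fun_convex_hull) auto
  obtain d where d: "d > 0" "\<And>w. norm w < d \<Longrightarrow> norm (sphere_chart n w - n) < \<delta>"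
  proof -
    have "continuous (at 0) (sphere_chart n)"
      by (rule has_derivative_continuous[OF sphere_chart_has_derivative]) simp
    then show thesis using that V(2) by (auto simp: continuous_at_eps_delta dist_norm)
  qed
  define \<epsilon> where "\<epsilon> = min d 1"
  have \<epsilon>: "\<epsilon> > 0" "\<epsilon> \<le> 1" "\<epsilon> \<le> d" using d(1) by (auto simp: \<epsilon>_def)
  have near: "norm (sphere_chart n w) = 1" "norm (sphere_chart n w - n) < \<delta>" "\<rho> *\<^sub>R sphere_chart n w \<in> V"
    if "w \<bullet> n = 0" "norm w < \<epsilon>" for w
  proof -
    show "norm (sphere_chart n w) = 1" "norm (sphere_chart n w - n) < \<delta>"
      using sphere_chart_norm[OF n that(1)] d(2)[of w] that(2) \<epsilon> by auto
    then show "\<rho> *\<^sub>R sphere_chart n w \<in> V" using X_max by blast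
  qed
  define Z where "Z w = X (\<rho> *\<^sub>R sphere_chart n w)" for w
  define F where "F w = H (sphere_chart n w)" for w
  \<comment> \<open>The chain rule for the chart: pairing \<open>D\<close> with the direction of a
    ray equals pairing the support point with the velocity of the chart curve, see
    \<open>c'_Z\<close>.\<close>
  define D where "D w = Z w - ((n \<bullet> Z w) * inverse (sqrt (1 - w \<bullet> w))) *\<^sub>R w" for w
  define B where "B h = X' (\<rho> *\<^sub>R n) (\<rho> *\<^sub>R h)" for h
  have linX: "linear (X' (\<rho> *\<^sub>R n))" using X_der[OF V(3)] has_derivative_linear by blast
  have linB: "linear B"
    by (rule linearI) (simp_all add: B_def linear_add[OF linX] linear_scale[OF linX] scaleR_add_right mult.commute)
  have B_inv: "level_map_deriv x (B h) = \<rho> *\<^sub>R h" for h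
    using X_inv[OF V(3)] by (simp add: B_def V(4))
  have Z0: "Z 0 = x" by (simp add: Z_def V(4))
  have Z_der: "(Z has_derivative B) (at 0)"
  proof -
    have "((\<lambda>w. \<rho> *\<^sub>R sphere_chart n w) has_derivative (\<lambda>h. \<rho> *\<^sub>R h)) (at 0)"
      using has_derivative_scaleR_right[OF sphere_chart_has_derivative[of 0 n], of \<rho>] by simp
    moreover have "(X has_derivative X' (\<rho> *\<^sub>R n)) (at (\<rho> *\<^sub>R sphere_chart n 0))" using X_der[OF V(3)] by simp
    ultimately show ?thesis unfolding Z_def B_def by (rule has_derivative_compose)
  qed
  have D0: "D 0 = x" by (simp add: D_def Z0)
  have D_der: "(D has_derivative (\<lambda>h. B h - (n \<bullet> x) *\<^sub>R h)) (at 0)"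
  proof -
    have "((\<lambda>w::'a. inverse (sqrt (1 - w \<bullet> w))) has_derivative (\<lambda>h. 0)) (at 0)"
      by (auto intro!: derivative_eq_intros)
    from has_derivative_diff[OF Z_der has_derivative_scaleR[OF
          has_derivative_mult[OF has_derivative_inner_right[OF Z_der, of n] this] has_derivative_ident]]
    show ?thesis by (simp add: D_def[abs_def] Z0)
  qed
  define c' where "c' w s = w - ((s * (w \<bullet> w)) / sqrt (1 - s\<^sup>2 * (w \<bullet> w))) *\<^sub>R n" for w s
  have sw: "(s *\<^sub>R w) \<bullet> n = 0" "norm (s *\<^sub>R w) < \<epsilon>" "\<bar>s\<bar> * norm w < 1"
    if "w \<bullet> n = 0" "\<bar>s\<bar> * norm w < \<epsilon>" for w s
    using that \<epsilon> by auto
  have c'_Z: "c' w s \<bullet> Z (s *\<^sub>R w) = D (s *\<^sub>R w) \<bullet> w" for w s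
  proof -
    have "(s *\<^sub>R w) \<bullet> (s *\<^sub>R w) = s\<^sup>2 * (w \<bullet> w)" by (simp add: power2_eq_square)
    then show ?thesis
      unfolding c'_def D_def inner_diff_left inner_scaleR_left
      by (simp only: inner_commute[of w "Z (s *\<^sub>R w)"] divide_inverse mult_ac)
  qed
  have F_line: "((\<lambda>s. F (s *\<^sub>R w)) has_derivative (\<lambda>h. h * (c' w s \<bullet> Z (s *\<^sub>R w)))) (at s)"
    if w: "w \<bullet> n = 0" and s: "\<bar>s\<bar> * norm w < \<epsilon>" for w s
  proof -
    define c where "c s = sphere_chart n (s *\<^sub>R w)" for s
    note nr = near[OF sw(1,2)[OF w s]]
    have c: "(c has_derivative (\<lambda>h. h *\<^sub>R c' w s)) (at s)"
      unfolding c_def c'_def by (rule sphere_chart_line_has_derivative) (use sw(3)[OF w s] in simp)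
    have "s\<^sup>2 * (w \<bullet> w) < 1"
      using sw(3)[OF w s]
      by (simp add: power2_norm_eq_inner[symmetric] power_mult_distrib[symmetric] abs_square_less_1 abs_mult)
    then have "c s \<bullet> c' w s = 0"
      using w n nn
      by (simp add: c_def c'_def sphere_chart_def inner_add_left inner_diff_right inner_commute[of n w]
          power_mult_distrib power2_norm_eq_inner)
    then have orth: "\<rho> *\<^sub>R c s \<bullet> \<rho> *\<^sub>R (h *\<^sub>R c' w s) = 0" for h by simp
    have cV: "\<rho> *\<^sub>R c s \<in> V" using nr by (simp add: c_def)
    \<comment> \<open>The support point moves within its level set, orthogonally to
      \<open>c s\<close>, so its own variation does not change the support value to first
      order.\<close>
    have zero: "c s \<bullet> X' (\<rho> *\<^sub>R c s) (\<rho> *\<^sub>R (h *\<^sub>R c' w s)) = 0" for h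
      using inner_inverse_deriv(1)[OF _ _ X_inv[OF cV] orth[of h]] X_reg[OF cV] \<rho> by simp
    have "((\<lambda>s. c s \<bullet> X (\<rho> *\<^sub>R c s)) has_derivative
        (\<lambda>h. c s \<bullet> X' (\<rho> *\<^sub>R c s) (\<rho> *\<^sub>R (h *\<^sub>R c' w s)) + h *\<^sub>R c' w s \<bullet> X (\<rho> *\<^sub>R c s))) (at s)"
      by (intro has_derivative_inner c has_derivative_compose[OF has_derivative_scaleR_right[OF c] X_der[OF cV]])
    then have "((\<lambda>s. c s \<bullet> X (\<rho> *\<^sub>R c s)) has_derivative (\<lambda>h. h * (c' w s \<bullet> Z (s *\<^sub>R w)))) (at s)"
      unfolding zero by (simp add: Z_def c_def)
    moreover have "open {s. \<bar>s\<bar> * norm w < \<epsilon>}" by (intro open_Collect_less continuous_intros)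
    moreover have "c s' \<bullet> X (\<rho> *\<^sub>R c s') = F (s' *\<^sub>R w)" if "s' \<in> {s. \<bar>s\<bar> * norm w < \<epsilon>}" for s'
      using H_eq near[OF sw(1,2)[OF w]] that by (simp add: F_def c_def)
    ultimately show ?thesis
      using has_derivative_transform_within_open[of _ _ s UNIV "{s. \<bar>s\<bar> * norm w < \<epsilon>}"] s by fastforce
  qed
  have exp: "((\<lambda>w. (F w - F 0 - D 0 \<bullet> w - (1/2) * ((B w - (n \<bullet> x) *\<^sub>R w) \<bullet> w)) / (norm w)\<^sup>2)
       \<longlongrightarrow> 0) (at 0 within {w. w \<bullet> n = 0})"
  proof (rule second_order_expansion[OF \<epsilon>(1) _ D_der])
    fix w :: 'a and s :: real
    assume w: "w \<bullet> n = 0" "norm w < \<epsilon>" and s: "0 \<le> s" "s \<le> 1"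
    have "\<bar>s\<bar> * norm w \<le> norm w" using s by (simp add: mult_left_le_one_le)
    then have "\<bar>s\<bar> * norm w < \<epsilon>" using w by linarith
    from F_line[OF w(1) this] show "((\<lambda>s. F (s *\<^sub>R w)) has_real_derivative (D (s *\<^sub>R w) \<bullet> w)) (at s)"
      by (rule has_derivative_imp_has_field_derivative) (simp add: c'_Z)
  qed
  have Hn: "H n = n \<bullet> x" using H_eq[OF n] V(2,4) by simp
  have F0: "F 0 = H n" by (simp add: F_def)
  have nonneg: "B w \<bullet> w \<ge> 0" if w: "w \<bullet> n = 0" for w
  proof -
    define \<tau> where "\<tau> = \<epsilon> / (norm w + 1)"
    have \<tau>: "\<tau> > 0" using \<epsilon>(1) by (simp add: \<tau>_def add_nonneg_pos)
    have sm: "\<bar>s\<bar> * norm w < \<epsilon>" if "\<bar>s\<bar> < \<tau>" for s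
    proof -
      have "\<bar>s\<bar> * (norm w + 1) < \<epsilon>"
        using that by (simp add: \<tau>_def pos_less_divide_eq add_nonneg_pos)
      then show ?thesis by (simp add: distrib_left)
    qed
    \<comment> \<open>\<open>x\<close> remains a competitor in the supremum, so its linear function
      lies below \<open>H\<close> and touches it at \<open>n\<close>; the second derivative of the
      difference at 0 is \<open>- (B w \<bullet> w)\<close>.\<close>
    define \<phi> where "\<phi> s = sphere_chart n (s *\<^sub>R w) \<bullet> x - F (s *\<^sub>R w)" for s
    have "D' \<le> 0" if "((\<lambda>s. c' w s \<bullet> (x - Z (s *\<^sub>R w))) has_real_derivative D') (at 0)" for D'
    proof (rule local_max_second_derivative(2)[OF \<tau> _ that])
      fix s :: real assume s: "\<bar>s\<bar> < \<tau>"
      have "((\<lambda>s. sphere_chart n (s *\<^sub>R w)) has_derivative (\<lambda>h. h *\<^sub>R c' w s)) (at s)"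
        unfolding c'_def by (rule sphere_chart_line_has_derivative) (use sw(3)[OF w sm[OF s]] in simp)
      from has_derivative_diff[OF has_derivative_inner_left[OF this, of x] F_line[OF w sm[OF s]]]
      show "(\<phi> has_real_derivative (c' w s \<bullet> (x - Z (s *\<^sub>R w)))) (at s)"
        unfolding \<phi>_def by (rule has_derivative_imp_has_field_derivative) (simp add: inner_diff_right algebra_simps)
      have "sphere_chart n (s *\<^sub>R w) \<bullet> x \<le> F (s *\<^sub>R w)"
        unfolding F_def using H_eq X_max near[OF sw(1,2)[OF w sm[OF s]]] xT by metis
      then show "\<phi> s \<le> \<phi> 0" by (simp add: \<phi>_def F0 Hn)
    qed
    moreover have "((\<lambda>s. c' w s \<bullet> (x - Z (s *\<^sub>R w))) has_real_derivative (- (B w \<bullet> w))) (at 0)"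
    proof -
      have "((\<lambda>s. s *\<^sub>R w) has_derivative (\<lambda>h. h *\<^sub>R w)) (at 0)" by (auto intro!: derivative_eq_intros)
      moreover have "(Z has_derivative B) (at (0 *\<^sub>R w))" using Z_der by simp
      ultimately have "((\<lambda>s. Z (s *\<^sub>R w)) has_derivative (\<lambda>h. B (h *\<^sub>R w))) (at 0)" by (rule has_derivative_compose)
      from has_derivative_inner[OF sphere_chart_velocity_has_derivative[of w n] has_derivative_diff[OF has_derivative_const[of x] this]]
      show ?thesis
        unfolding c'_def by (rule has_derivative_imp_has_field_derivative)
          (simp add: Z0 linear_scale[OF linB] inner_commute[of w "B w"])
    qed
    ultimately show ?thesis by fastforce
  qed
  show ?thesis
    by (rule that[OF linB B_inv Hn _ nonneg]) (use exp in \<open>simp_all add: F0 D0 F_def\<close>)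
qed

text \<open>On the tangent space the derivative is the tangential Hessian of \<open>v\<close> times
  \<open>(m - v x) / norm (G x)\<close>, that is, \<open>v x - m\<close> times the shape operator
  for the outer normal.\<close>

lemma level_map_deriv_symmetric:
  assumes x: "x \<in> regular" and h: "G x \<bullet> h = 0" and k: "G x \<bullet> k = 0"
  shows "level_map_deriv x h \<bullet> k = level_map_deriv x k \<bullet> h"
proof -
  have "L x h \<bullet> k = L x k \<bullet> h"
    using x regular_subset(1) by (intro C2_data_symmetric[OF C2]) auto
  moreover have "sgn (G x) \<bullet> h = 0" "sgn (G x) \<bullet> k = 0" using h k by (auto simp: sgn_div_norm)
  ultimately show ?thesis using h k by (simp add: level_map_deriv_def inner_diff_left)
qed

text \<open>On the tangent space the derivatives of slope and support point are inverse up to scale: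
  \<open>D * P\<close> is \<open>\<rho>\<close> times the identity, where \<open>P\<close> is the
  matrix in the definition of K. So the determinant of \<open>D\<close> is
  \<open>\<rho> ^ ?d\<close> times the curvature, and the normal direction contributes
  \<open>- norm (G x)\<close>.\<close>

lemma gauss_curvature_strict_contact:
  assumes x: "x \<in> strict_contacts"
  shows "norm (G x) * gauss_curvature (convex hull superlevel (v x)) x
    = \<bar>ldet (level_map_deriv x)\<bar> / (v x - m) ^ (DIM('a) - 1)"
proof -
  let ?d = "DIM('a) - 1"
  define C where "C = convex hull superlevel (v x)"
  define n where "n = - sgn (G x)"
  define \<rho> where "\<rho> = v x - m"
  define H where "H = support_fun C"
  define e where "e = tangent_frame n"
  obtain B where linB: "linear B" and B_inv: "\<And>h. level_map_deriv x (B h) = \<rho> *\<^sub>R h" and Hn: "H n = n \<bullet> x"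
    and exp: "((\<lambda>w. (H (sphere_chart n w) - H n - x \<bullet> w - (1/2) * ((B w - (n \<bullet> x) *\<^sub>R w) \<bullet> w)) / (norm w)\<^sup>2)
       \<longlongrightarrow> 0) (at 0 within {w. w \<bullet> n = 0})"
    and nonneg: "\<And>w. w \<bullet> n = 0 \<Longrightarrow> B w \<bullet> w \<ge> 0"
    by (rule support_fun_expansion[OF x, folded n_def \<rho>_def C_def, folded H_def]) (rule that)
  have xr: "x \<in> regular" "inj (level_map_deriv x)" using x by (auto simp: strict_contacts_def)
  then have \<rho>: "\<rho> > 0" and n: "norm n = 1" and G0: "G x \<noteq> 0"
    by (auto simp: regular_def \<rho>_def n_def norm_sgn)
  have Gn: "G x \<bullet> h = - norm (G x) * (n \<bullet> h)" for h
    by (simp add: inner_sgn_self[of "G x"] n_def)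
  have frame: "orthonormal_frame n e"
    using orthonormal_frame_tangent_frame[OF n] by (simp add: e_def)
  have en: "n \<bullet> e j = 0" "e j \<bullet> n = 0" if "j < ?d" for j
    using frame that by (auto simp: orthonormal_frame_def inner_commute)
  have ee: "e i \<bullet> e j = (if i = j then 1 else 0)" if "i < ?d" "j < ?d" for i j
    using frame that by (simp add: orthonormal_frame_def)
  have lin: "linear (level_map_deriv x)" using linear_level_map_deriv xr by blast
  have nD: "n \<bullet> level_map_deriv x h = G x \<bullet> h" for h
    using inner_level_map_deriv[OF xr(1), of h] by (simp add: n_def)
  have B_tan: "n \<bullet> B w = 0" if "n \<bullet> w = 0" for w
    using nD[of "B w"] Gn[of "B w"] that G0 by (simp add: B_inv)
  have B_sym: "B w \<bullet> u = B u \<bullet> w" if w: "n \<bullet> w = 0" and u: "n \<bullet> u = 0" for w u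
  proof -
    have "level_map_deriv x (B w) \<bullet> B u = level_map_deriv x (B u) \<bullet> B w"
      using level_map_deriv_symmetric[OF xr(1), of "B w" "B u"] Gn B_tan[OF w] B_tan[OF u] by simp
    then show ?thesis using \<rho> by (simp add: B_inv inner_commute)
  qed
  have Bee: "B (e i) \<bullet> e j = B (e j) \<bullet> e i" if "i < ?d" "j < ?d" for i j
    using B_sym en that by blast
  define M where "M = Matrix.mat ?d ?d (\<lambda>(i, j). (B (e i) - (n \<bullet> x) *\<^sub>R e i) \<bullet> e j)"
  define P where "P = frame_mat ?d e B"
  define D where "D = frame_mat ?d e (level_map_deriv x)"
  have carr: "P \<in> carrier_mat ?d ?d" "D \<in> carrier_mat ?d ?d" "M \<in> carrier_mat ?d ?d"
    by (auto simp: P_def D_def M_def frame_mat_def)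
  have M_hess: "alexandrov_hessian_at H n M"
    unfolding alexandrov_hessian_at_def
  proof (intro conjI exI[of _ x])
    show "M \<in> carrier_mat ?d ?d" by (rule carr)
    show "transpose_mat M = M"
      by (intro eq_matI) (auto simp: M_def inner_diff_left ee intro: Bee)
    define A where "A h = B h - (n \<bullet> x) *\<^sub>R h" for h
    have linA: "linear A"
      by (rule linearI) (simp_all add: A_def linear_add[OF linB] linear_scale[OF linB] algebra_simps)
    have form: "(\<Sum>i<?d. \<Sum>j<?d. M $$ (i, j) * (w \<bullet> tangent_frame n i) * (w \<bullet> tangent_frame n j)) = A w \<bullet> w"
      if w: "w \<bullet> n = 0" for w
    proof -
      have "(\<Sum>i<?d. \<Sum>j<?d. M $$ (i, j) * (w \<bullet> e i) * (w \<bullet> e j))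
          = (\<Sum>i<?d. \<Sum>j<?d. (0 * (if i = j then 1 else 0) + 1 * (A (e i) \<bullet> e j)) * (w \<bullet> e i) * (w \<bullet> e j))"
        by (intro sum.cong) (auto simp: M_def A_def)
      also have "\<dots> = A w \<bullet> w"
        unfolding quadratic_form_frame[OF linA frame] orthonormal_frame_expand[OF n frame w] by simp
      finally show ?thesis by (simp add: e_def)
    qed
    have "\<forall>\<^sub>F w in at 0 within {w. w \<bullet> n = 0}.
        (H (sphere_chart n w) - H n - x \<bullet> w - (1/2) * ((B w - (n \<bullet> x) *\<^sub>R w) \<bullet> w)) / (norm w)\<^sup>2
      = (H (sphere_chart n w) - H n - x \<bullet> w - (1/2) * (\<Sum>i<?d. \<Sum>j<?d.
                  M $$ (i, j) * (w \<bullet> tangent_frame n i) * (w \<bullet> tangent_frame n j))) / (norm w)\<^sup>2"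
      using form by (auto simp: eventually_at_filter A_def)
    from tendsto_cong[OF this] exp
    show "((\<lambda>w. (H (sphere_chart n w) - H n - x \<bullet> w - (1/2) * (\<Sum>i<?d. \<Sum>j<?d.
                  M $$ (i, j) * (w \<bullet> tangent_frame n i) * (w \<bullet> tangent_frame n j))) / (norm w)\<^sup>2)
       \<longlongrightarrow> 0) (at 0 within {w. w \<bullet> n = 0})" by simp
  qed
  then have hess: "alexandrov_hessian H n = M"
    unfolding alexandrov_hessian_def using alexandrov_hessian_at_unique[OF n] by (intro the_equality) auto
  \<comment> \<open>The chart correction \<open>- (n \<bullet> x)\<close> in \<open>M\<close>
    cancels against \<open>H n = n \<bullet> x\<close>.\<close>
  have P_eq: "H n \<cdot>\<^sub>m 1\<^sub>m ?d + alexandrov_hessian H n = P"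
    unfolding hess
  proof (rule eq_matI)
    fix i j assume "i < dim_row P" "j < dim_col P"
    then have ij: "i < ?d" "j < ?d" using carr by auto
    have "B (e i) \<bullet> e j = e i \<bullet> B (e j)" using Bee[OF ij] by (simp add: inner_commute)
    then show "(H n \<cdot>\<^sub>m 1\<^sub>m ?d + M) $$ (i, j) = P $$ (i, j)"
      using ij by (simp add: M_def P_def frame_mat_def inner_diff_left ee Hn)
  qed (use carr in auto)
  have DP: "D * P = \<rho> \<cdot>\<^sub>m 1\<^sub>m ?d"
  proof (rule eq_matI)
    fix i j assume "i < dim_row (\<rho> \<cdot>\<^sub>m 1\<^sub>m ?d)" "j < dim_col (\<rho> \<cdot>\<^sub>m 1\<^sub>m ?d)"
    then have ij: "i < ?d" "j < ?d" by auto
    have "B (e j) \<bullet> n = 0" using B_tan[OF en(1)[OF ij(2)]] by (simp add: inner_commute)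
    from orthonormal_frame_expand[OF n frame this]
    have "level_map_deriv x (B (e j)) = level_map_deriv x (\<Sum>k<?d. (B (e j) \<bullet> e k) *\<^sub>R e k)" by simp
    then have "\<rho> *\<^sub>R e j = (\<Sum>k<?d. (B (e j) \<bullet> e k) *\<^sub>R level_map_deriv x (e k))"
      by (simp add: B_inv linear_sum[OF lin] linear_scale[OF lin])
    then have "e i \<bullet> (\<rho> *\<^sub>R e j) = (\<Sum>k<?d. (B (e j) \<bullet> e k) * (e i \<bullet> level_map_deriv x (e k)))"
      by (simp only: inner_sum_right inner_scaleR_right)
    then have "\<rho> * (if i = j then 1 else 0) = (\<Sum>k<?d. (e i \<bullet> level_map_deriv x (e k)) * (e k \<bullet> B (e j)))"
      using ij by (simp add: ee mult.commute inner_commute[of "B (e j)"])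
    then show "(D * P) $$ (i, j) = (\<rho> \<cdot>\<^sub>m 1\<^sub>m ?d) $$ (i, j)"
      using ij by (simp add: D_def P_def frame_mat_def scalar_prod_def lessThan_atLeast0)
  qed (use carr in auto)
  have detDP: "Determinant.det D * Determinant.det P = \<rho> ^ ?d"
    using Determinant.det_mult[OF carr(2,1)] by (simp add: DP det_smult)
  \<comment> \<open>The curvature enters without absolute value, so the sign matters. The form of
    \<open>P\<close> is nonnegative because the support function lies above the linear function of
    \<open>x\<close>.\<close>
  have pos: "Determinant.det P > 0"
  proof (rule det_pos_of_nonneg_form[OF carr(1)])
    show "Determinant.det P \<noteq> 0" using detDP \<rho> by auto
    fix c :: "nat \<Rightarrow> real"
    define w where "w = (\<Sum>i<?d. c i *\<^sub>R e i)"
    have nw: "w \<bullet> n = 0" using en by (simp add: w_def inner_sum_left)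
    have "(\<Sum>i<?d. \<Sum>j<?d. P $$ (i, j) * c i * c j)
        = (\<Sum>i<?d. \<Sum>j<?d. (0 * (if i = j then 1 else 0) + 1 * (B (e i) \<bullet> e j)) * c i * c j)"
      using Bee by (intro sum.cong refl) (simp add: P_def frame_mat_def inner_commute)
    also have "\<dots> = B w \<bullet> w"
      unfolding quadratic_form_frame[OF linB frame] by (simp add: w_def)
    finally show "(\<Sum>i<?d. \<Sum>j<?d. P $$ (i, j) * c i * c j) \<ge> 0" using nonneg[OF nw] by simp
  qed
  have normal: "outer_unit_normal C x k \<longleftrightarrow> k = n" for k
    unfolding C_def n_def by (rule outer_unit_normal_strict_contact[OF x])
  have the_normal: "The (outer_unit_normal C x) = n" "\<exists>!k. outer_unit_normal C x k"
    using normal by (auto intro: the_equality)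
  have "twice_alexandrov_differentiable H n"
    using M_hess by (auto simp: twice_alexandrov_differentiable_def)
  then have "gauss_curvature C x = 1 / Determinant.det P"
    unfolding gauss_curvature_def Let_def the_normal H_def[symmetric] P_eq
    using pos the_normal(2) by simp
  moreover have "ldet (level_map_deriv x) = - norm (G x) * Determinant.det D"
  proof -
    have "ldet (level_map_deriv x) = (n \<bullet> level_map_deriv x n) * Determinant.det D"
      unfolding D_def using en by (intro ldet_block[OF lin n frame]) (simp add: nD Gn)
    moreover have "n \<bullet> n = 1" using n by (simp add: norm_eq_1)
    ultimately show ?thesis by (simp add: nD Gn)
  qed
  moreover have "Determinant.det D = \<rho> ^ ?d / Determinant.det P" using detDP pos by (simp add: field_simps)
  ultimately show ?thesis
    using pos \<rho> by (simp add: C_def \<rho>_def abs_mult)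
qed

section \<open>Integration over strict contacts and the first estimate\<close>

lemma gradient_interior: "x \<in> interior A \<Longrightarrow> gradient v x = G x"
  unfolding gradient_def
proof (rule the_equality)
  assume x: "x \<in> interior A"
  show G: "GDERIV v x :> G x"
    using v_deriv[OF x] by (simp add: gderiv_def inner_commute)
  show "D = G x" if "GDERIV v x :> D" for D
  proof -
    have "(\<lambda>h. h \<bullet> D) = (\<lambda>h. h \<bullet> G x)"
      using that G unfolding gderiv_def by (rule has_derivative_unique)
    then have "(D - G x) \<bullet> D = (D - G x) \<bullet> G x" by metis
    then have "(D - G x) \<bullet> (D - G x) = 0" by (simp add: inner_diff_right)
    then show ?thesis by simp
  qed
qed

theorem interior_maximum_estimate:
  "v x0 - m \<le> 4 ^ DIM('a) / unit_ball_vol DIM('a) * r"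
  if r: "(\<integral>\<^sup>+x\<in>contact_points (\<lambda>y. - v y) A.
      ennreal (norm (gradient v x) * gauss_curvature (convex hull {y \<in> A. v x \<le> v y}) x) \<partial>lebesgue) = ennreal r" "r \<ge> 0"
proof -
  let ?d = "DIM('a)"
  \<comment> \<open>Half the gap: slopes with \<open>\<mu> \<le> norm y < 2 * \<mu>\<close> belong
    to levels at least \<open>m + \<mu>\<close>, a bound strictly above \<open>m\<close> as
    \<open>strict_contacts_cover\<close> requires, and keep the weight below
    \<open>(2 * \<mu>) ^ (?d - 1)\<close>.\<close>
  define \<mu> where "\<mu> = (v x0 - m) / 2"
  have \<mu>: "\<mu> > 0" "v x0 = m + 2 * \<mu>" using gap by (auto simp: \<mu>_def field_simps)
  define b :: 'a where "b = (SOME b. b \<in> Basis)"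
  have b: "norm b = 1" using some_in_eq[of "Basis :: 'a set"] by (simp add: b_def)
  \<comment> \<open>Centred at distance \<open>3 / 2 * \<mu>\<close> from the origin, a ball of
    radius \<open>\<mu> / 2\<close> just fits into the shell of these slopes.\<close>
  let ?Ball = "ball ((3 / 2 * \<mu>) *\<^sub>R b) (\<mu> / 2)"
  obtain N where N: "negligible N"
    "{y. m + \<mu> \<le> m + norm y \<and> m + norm y < v x0} \<subseteq> level_map ` strict_contacts \<union> N"
    using strict_contacts_cover[of "m + \<mu>"] \<mu>(1) by auto
  define S where "S = {x \<in> strict_contacts. level_map x \<in> ?Ball}"
  have norms: "\<mu> \<le> norm y" "norm y < 2 * \<mu>" if "y \<in> ?Ball" for y
  proof -
    have "norm (y - (3 / 2 * \<mu>) *\<^sub>R b) < \<mu> / 2" using that by (simp add: dist_norm norm_minus_commute)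
    moreover have "norm ((3 / 2 * \<mu>) *\<^sub>R b) = 3 / 2 * \<mu>" using b \<mu>(1) by simp
    ultimately show "\<mu> \<le> norm y" "norm y < 2 * \<mu>"
      using norm_triangle_ineq2[of "(3 / 2 * \<mu>) *\<^sub>R b" y] norm_triangle_ineq2[of y "(3 / 2 * \<mu>) *\<^sub>R b"]
      by (auto simp: norm_minus_commute)
  qed
  have S_reg: "S \<subseteq> regular" by (auto simp: S_def strict_contacts_def)
  have S_borel: "S \<in> sets borel"
  proof -
    have "continuous_on regular level_map"
      using level_map_has_derivative has_derivative_at_withinI by (intro has_derivative_continuous_on) blast
    then have "open (regular \<inter> level_map -` ?Ball)"
      by (intro continuous_open_preimage open_regular) auto
    moreover have "S = strict_contacts \<inter> (regular \<inter> level_map -` ?Ball)"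
      by (auto simp: S_def strict_contacts_def)
    ultimately show ?thesis using strict_contacts_borel by auto
  qed
  have \<rho>: "v x - m < 2 * \<mu>" "v x - m > 0" if "x \<in> S" for x
    using that norms(2)[of "level_map x"] level_map_norm(1)[of x] S_reg \<mu>(1)
    by (auto simp: S_def regular_def)
  define c where "c = (2 * \<mu>) ^ (?d - 1)"
  have c: "c > 0" using \<mu>(1) by (simp add: c_def)
  define g where "g x = indicator S x *\<^sub>R (\<bar>ldet (level_map_deriv x)\<bar> / c)" for x
  have cont_ldet: "continuous_on S (\<lambda>x. ldet (level_map_deriv x))"
    by (rule continuous_on_subset[OF continuous_on_ldet[OF continuous_level_map_deriv] S_reg])
  have g_borel: "g \<in> borel_measurable borel"
    unfolding g_def using c
    by (intro borel_measurable_continuous_on_indicator S_borel continuous_intros cont_ldet) auto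
  have "emeasure lborel ?Ball \<le> (\<integral>\<^sup>+x\<in>S. ennreal \<bar>ldet (level_map_deriv x)\<bar> \<partial>lborel)"
  proof (rule measure_le_nn_integral_ldet[OF S_borel _ _ N(1)])
    show "(level_map has_derivative level_map_deriv x) (at x within S)" if "x \<in> S" for x
      by (rule has_derivative_at_withinI[OF level_map_has_derivative]) (use that S_reg in auto)
    show "continuous_on S (\<lambda>x. ldet (level_map_deriv x))" by (rule cont_ldet)
    show "?Ball \<subseteq> level_map ` S \<union> N"
    proof
      fix y assume y: "y \<in> ?Ball"
      then have "y \<in> level_map ` strict_contacts \<union> N" using N(2) norms[OF y] \<mu> by auto
      then show "y \<in> level_map ` S \<union> N" using y by (auto simp: S_def)
    qed
  qed simp
  also have "\<dots> = (\<integral>\<^sup>+x. ennreal c * ennreal (g x) \<partial>lborel)"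
    using c by (intro nn_integral_cong) (auto simp: g_def indicator_def ennreal_mult[symmetric])
  also have "\<dots> = ennreal c * (\<integral>\<^sup>+x. ennreal (g x) \<partial>lborel)"
    using g_borel by (intro nn_integral_cmult) simp
  also have "(\<integral>\<^sup>+x. ennreal (g x) \<partial>lborel) = (\<integral>\<^sup>+x. ennreal (g x) \<partial>lebesgue)"
    by (simp add: nn_integral_completion)
  also have "\<dots> \<le> ennreal r"
    unfolding r(1)[symmetric]
  \<comment> \<open>Monotonicity of the nonnegative integral asks for no measurability, so the
    curvature integrand is compared pointwise: with the Jacobian on \<open>S\<close>, with 0
    elsewhere.\<close>
  proof (rule nn_integral_mono)
    fix x :: 'a
    show "ennreal (g x) \<le> ennreal (norm (gradient v x) * gauss_curvature (convex hull {y \<in> A. v x \<le> v y}) x)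
        * indicator (contact_points (\<lambda>y. - v y) A) x"
    proof (cases "x \<in> S")
      case True
      then have x: "x \<in> strict_contacts" "x \<in> contact_points (\<lambda>y. - v y) A" "x \<in> interior A"
        using strict_contacts_subset_contact_points by (auto simp: S_def contact_points_def)
      have "norm (gradient v x) * gauss_curvature (convex hull {y \<in> A. v x \<le> v y}) x
          = \<bar>ldet (level_map_deriv x)\<bar> / (v x - m) ^ (?d - 1)"
        using gauss_curvature_strict_contact[OF x(1)] gradient_interior[OF x(3)] by (simp add: superlevel_def)
      moreover have "\<bar>ldet (level_map_deriv x)\<bar> / c \<le> \<bar>ldet (level_map_deriv x)\<bar> / (v x - m) ^ (?d - 1)"
        unfolding c_def using \<rho>[OF True] by (intro divide_left_mono power_mono mult_pos_pos zero_less_power) auto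
      ultimately show ?thesis
        using True x(2) by (simp add: g_def ennreal_leI)
    qed (simp add: g_def)
  qed
  finally have "emeasure lborel ?Ball \<le> ennreal c * ennreal r"
    by (simp add: mult_left_mono)
  also have "\<dots> = ennreal ((2 * \<mu>) ^ (?d - 1) * r)"
    using \<mu>(1) r(2) by (simp add: ennreal_mult c_def)
  also have "emeasure lborel ?Ball = ennreal (unit_ball_vol ?d * (\<mu> / 2) ^ ?d)"
    using \<mu>(1) by (simp add: emeasure_ball)
  finally have "unit_ball_vol ?d * (\<mu> / 2) ^ ?d \<le> (2 * \<mu>) ^ (?d - 1) * r"
    using \<mu>(1) r(2) by (simp add: ennreal_le_iff)
  moreover have "(2 * \<mu>) ^ ?d = 2 * \<mu> * (2 * \<mu>) ^ (?d - 1)"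
    by (metis DIM_positive power_eq_if less_irrefl)
  \<comment> \<open>Writing \<open>\<mu> / 2\<close> as \<open>2 * \<mu> / 4\<close> produces the
    \<open>4 ^ ?d\<close> of the constant; cancelling \<open>(2 * \<mu>) ^ (?d - 1)\<close> then
    leaves one power of the gap.\<close>
  moreover have "(\<mu> / 2) ^ ?d = (2 * \<mu>) ^ ?d / 4 ^ ?d"
    using power_divide[of "2 * \<mu>" 4 ?d] by simp
  ultimately have "(2 * \<mu>) ^ (?d - 1) * (unit_ball_vol ?d * (2 * \<mu>) / 4 ^ ?d) \<le> (2 * \<mu>) ^ (?d - 1) * r"
    by (simp add: mult_ac)
  then have "unit_ball_vol ?d * (2 * \<mu>) / 4 ^ ?d \<le> r"
    by (rule mult_left_le_imp_le) (use \<mu>(1) in simp)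
  then show ?thesis using \<mu>(2) by (simp add: field_simps)
qed

end

theorem curvature_maximum_principle:
  fixes A :: "'a::euclidean_space set" and v :: "'a \<Rightarrow> real"
  assumes A: "convex A" "compact A" "A \<noteq> {}" and C2: "C2_on A v"
  shows "ereal (SUP x\<in>A. v x)
      \<le> ereal (SUP x\<in>frontier A. v x)
        + ereal (4 ^ DIM('a) / unit_ball_vol DIM('a)) * enn2ereal (\<integral>\<^sup>+x\<in>contact_points (\<lambda>y. - v y) A.
            ennreal (norm (gradient v x)
              * gauss_curvature (convex hull {y \<in> A. v x \<le> v y}) x) \<partial>lebesgue)"
    (is "_ \<le> ereal ?m + ereal ?C * enn2ereal ?I")
proof -
  have C: "?C > 0" by simp
  obtain G L where GL: "C2_data A v G L" using C2_on_imp_C2_data[OF C2] by blast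
  obtain x0 where x0: "x0 \<in> A" "\<And>x. x \<in> A \<Longrightarrow> v x \<le> v x0"
    using continuous_attains_sup[OF A(2,3) C2_data_continuous(1)[OF GL]] by blast
  have sup: "(SUP x\<in>A. v x) = v x0"
    using x0 by (intro cSup_eq_maximum) auto
  have "frontier A \<subseteq> A" using A(2) compact_imp_closed frontier_subset_eq by blast
  then have m: "v x \<le> ?m" if "x \<in> frontier A" for x
    using that x0 by (intro cSUP_upper bdd_aboveI2[of _ _ "v x0"]) auto
  show ?thesis
  proof (cases ?I)
    case (real r)
    have "v x0 \<le> ?m + ?C * r"
    proof (cases "v x0 \<le> ?m")
      case True
      moreover have "?C * r \<ge> 0" using C real(1) by (intro mult_nonneg_nonneg) auto
      ultimately show ?thesis by linarith
    next
      case False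
      then interpret interior_maximum A v G L ?m x0
        using A GL x0 m by unfold_locales auto
      show ?thesis using interior_maximum_estimate[OF real(2,1)] by simp
    qed
    then have "ereal (v x0) \<le> ereal (?m + ?C * r)" by (simp only: ereal_less_eq(3))
    then show ?thesis
      unfolding sup real(2) using real(1) by (simp add: enn2ereal_ennreal)
  next
    \<comment> \<open>The constant is positive, so an infinite integral makes the right-hand side
      infinite.\<close>
    case top
    moreover have "unit_ball_vol (real DIM('a)) \<noteq> 0"
      using unit_ball_vol_pos[of "real DIM('a)"] by linarith
    ultimately show ?thesis by simp
  qed
qed

theorem theorem5p2:
  shows
    "(\<exists>C::real. \<forall>(A :: 'a::euclidean_space set) (v :: 'a \<Rightarrow> real).
        convex A \<longrightarrow> compact A \<longrightarrow> A \<noteq> {} \<longrightarrow> C2_on A v \<longrightarrow>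
          ereal (SUP x\<in>A. v x)
            \<le> ereal (SUP x\<in>frontier A. v x)
              + ereal C * enn2ereal (\<integral>\<^sup>+x\<in>contact_points (\<lambda>y. - v y) A.
                  ennreal (norm (gradient v x)
                    * gauss_curvature (convex hull {y \<in> A. v x \<le> v y}) x) \<partial>lebesgue))
     \<and>
     (\<forall>(e :: 'a) (Q :: 'a set).
        norm e = 1 \<longrightarrow> Q \<noteq> {} \<longrightarrow> Q \<subseteq> upper_half_sphere e \<longrightarrow> spherically_convex Q \<longrightarrow>
        (\<exists>\<delta>>0. \<forall>\<theta>\<in>Q. \<forall>\<eta>\<in>sphere_frontier (upper_half_sphere e). \<delta> \<le> dist \<theta> \<eta>) \<longrightarrow>
        (\<exists>C1>0. \<exists>C2>0. \<forall>(R1::real) (R2::real) (f :: 'a \<Rightarrow> real).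
           0 < R1 \<longrightarrow> R1 < R2 \<longrightarrow>
           C2_on (polar_region Q R1 R2 \<union> parabolic_boundary Q R1 R2) f \<longrightarrow>
           0 \<le> (SUP x\<in>parabolic_boundary Q R1 R2. f x) \<longrightarrow>
             (SUP x\<in>polar_region Q R1 R2. f x)
               \<le> C1 * (SUP x\<in>parabolic_boundary Q R1 R2. f x)
                 + C2 * (LINT x:Gamma_set Q R1 R2 f|lebesgue.
                     \<bar>radial_deriv R1 R2 f x * Determinant.det (angular_matrix Q f x)\<bar>
                       / norm x ^ (DIM('a) - 1)) powr (1 / real DIM('a))))"
proof (intro conjI allI impI)
  show "\<exists>C::real. \<forall>(A :: 'a set) (v :: 'a \<Rightarrow> real).
        convex A \<longrightarrow> compact A \<longrightarrow> A \<noteq> {} \<longrightarrow> C2_on A v \<longrightarrow>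
          ereal (SUP x\<in>A. v x)
            \<le> ereal (SUP x\<in>frontier A. v x)
              + ereal C * enn2ereal (\<integral>\<^sup>+x\<in>contact_points (\<lambda>y. - v y) A.
                  ennreal (norm (gradient v x)
                    * gauss_curvature (convex hull {y \<in> A. v x \<le> v y}) x) \<partial>lebesgue)"
    by (intro exI allI impI) (rule curvature_maximum_principle)
qed (rule parabolic_maximum_principle)

end
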